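(* Let $k$ be a positive integer and let $P$ be a subfactor planar algebra of finite depth at most $k$. Then $P$ is generated (as a planar algebra) by a single $2k$-box, i.e., there is an element $z\in P_{2k}$ such that the smallest planar subalgebra of $P$ containing $z$ is $P$.
   Context: **Tangles.** $Col=\{0_+,0_-,1,2,\dots\}$ is the set of colours; $0$ without sign means $0_+$. A (planar) tangle has an external box (disc) $D_0$, a finite, possibly empty, ordered collection of disjoint internal boxes $D_1,\dots,D_b$ inside $D_0$, an even number of marked points on the boundary of each box (a box with $2n$ marked points has colour $n$, and is called an $n$-box), and a collection of disjoint curves in the complement of the internal boxes, each closed or joining two marked points, each marked point being the endpoint of exactly one curve. The regions carry a chequerboard shading (black/white). Each box with at least one marked point has a boundary interval between adjacent marked points marked $*$, and the region adjacent to it is white. A box without marked points has colour $0_+$ (resp. $0_-$) if the region touching it is white (resp. black). Tangles are taken up to planar isotopy preserving the $*$'s, the shading and the numbering of internal boxes. A tangle with external colour $n_0$ and internal colours $n_1,\dots,n_b$ is an $(n_0;n_1,\dots,n_b)$-tangle, or an $n_0$-tangle. Tangles of matching colours may be substituted into internal boxes (matching the $*$'s). **Planar algebras.** A planar algebra $P$ is a collection of vector spaces $\{P_n\}_{n\in Col}$ with linear maps $Z_T^P:P_{n_1}\otimes\cdots\otimes P_{n_b}\to P_{n_0}$ for each $(n_0;n_1,\dots,n_b)$-tangle $T$ (the empty tensor product being the ground field), compatible with substitution of tangles and renumbering of internal boxes, identity tangles acting as identities. A planar subalgebra is a collection of subspaces $Q_n\subseteq P_n$ preserved by all $Z_T^P$.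 Draw boxes with $*$ at the left, $n$ marked points on top and $n$ at the bottom. Each $P_n$ is a unital algebra with multiplication given by the tangle $M_{n,n}^n$ stacking $D_1$ above $D_2$, and unit given by the tangle $1^n$ of $n$ vertical strands; $P_n$ maps to $P_{n+1}$ via the tangle adding a vertical strand at the right; $E_n\in P_n$ ($n\ge2$) is the element given by the tangle without internal boxes having $n-2$ vertical strands at the left and a cap and a cup joining the last two top points and the last two bottom points respectively. A subfactor planar algebra is a planar algebra over $\mathbb C$ such that: each $P_n$ is finite-dimensional and $\dim P_{0_\pm}=1$; there is a modulus $\delta>0$ such that each closed loop of a tangle $T$ contributes a multiplicative factor $\delta$ to $Z_T^P$; it is spherical (for $0$-tangles $T$, $Z_T^P$ is invariant under isotopy of $T$ on the 2-sphere); each $P_n$ is a $C^*$-algebra with $Z_T^P(x_1\otimes\cdots\otimes x_b)^*=Z_{T^*}^P(x_1^*\otimes\cdots\otimes x_b^* )$, where $T^*$ is the reflection of $T$; and for each $n\ge0$, $\tau(x)=\delta^{-n}Z^P_{TR_n^0}(x)\in P_0=\mathbb C$ is a faithful positive normalised trace on $P_n$, where $TR_n^0$ closes up all $n$ strands of an $n$-box on the right. It has finite depth if $P_{k+1}=P_kE_{k+1}P_k$ (linear span of products) for some positive integer $k$; the smallest such $k$ is its depth. *)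

theory Defs
  imports "HOL-Analysis.Analysis" "HOL-Combinatorics.Permutations"
begin

section \<open>Planar tangles\<close>

text \<open>\<open>Col 0\<close> is the colour \<open>0\<^sub>+\<close>, and \<open>Zero_minus\<close> is \<open>0\<^sub>-\<close>.\<close>

datatype colour = Zero_minus | Col nat

text \<open>
  A box is a closed disc in the plane together with its marked boundary interval \<open>*\<close>.
  A box without marked points has no \<open>*\<close>; its second component is then its whole boundary,
  so that it carries no information.
\<close>

datatype planar_box = Planar_Box (disc: "complex set") (starred: "complex set")

text \<open>
  The curves of a tangle are the connected components of the set \<open>strings\<close>, the marked
  points of a box are the points of \<open>strings\<close> on its boundary, and \<open>black\<close> is the
  union of the black regions. Regions are taken in the closed set \<open>body\<close> below, so they include
  the adjacent boundary intervals of the boxes.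
\<close>

datatype tangle = Tangle (ext_box: planar_box) (int_boxes: "planar_box list")
  (strings: "complex set") (black: "complex set")

definition boxes :: "tangle \<Rightarrow> planar_box set" where
  "boxes T = insert (ext_box T) (set (int_boxes T))"

definition body :: "tangle \<Rightarrow> complex set" where
  "body T = disc (ext_box T) - (\<Union>b\<in>set (int_boxes T). interior (disc b))"

definition open_body :: "tangle \<Rightarrow> complex set" where
  "open_body T = interior (disc (ext_box T)) - (\<Union>b\<in>set (int_boxes T). disc b)"

definition marks :: "tangle \<Rightarrow> planar_box \<Rightarrow> complex set" where
  "marks T b = strings T \<inter> frontier (disc b)"

definition white :: "tangle \<Rightarrow> complex set" where
  "white T = body T - strings T - black T"

definition closed_curve_in :: "tangle \<Rightarrow> complex set \<Rightarrow> bool" where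
  "closed_curve_in T c \<longleftrightarrow>
     (\<exists>g. simple_path g \<and> pathfinish g = pathstart g \<and> c = path_image g \<and> c \<subseteq> open_body T)"

definition arc_in :: "tangle \<Rightarrow> complex set \<Rightarrow> bool" where
  "arc_in T c \<longleftrightarrow>
     (\<exists>g. arc g \<and> c = path_image g \<and>
        {pathstart g, pathfinish g} \<subseteq> (\<Union>b\<in>boxes T. frontier (disc b)) \<and>
        c - {pathstart g, pathfinish g} \<subseteq> open_body T)"

text \<open>
  Every point of a curve has exactly two local sides; the closure condition says that one of
  them is black and the other one white, that is, the shading is a chequerboard shading.
\<close>

definition tangle :: "tangle \<Rightarrow> bool" where
  "tangle T \<longleftrightarrow>
     (\<forall>b\<in>boxes T. disc b homeomorphic cball (0::complex) 1) \<and>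
     (\<forall>b\<in>set (int_boxes T). disc b \<subseteq> interior (disc (ext_box T))) \<and>
     (\<forall>i j. i < j \<and> j < length (int_boxes T) \<longrightarrow>
        disc (int_boxes T ! i) \<inter> disc (int_boxes T ! j) = {}) \<and>
     (\<exists>C. finite C \<and> pairwise disjnt C \<and> \<Union>C = strings T \<and>
        (\<forall>c\<in>C. closed_curve_in T c \<or> arc_in T c)) \<and>
     (\<forall>b\<in>boxes T. even (card (marks T b))) \<and>
     openin (top_of_set (body T - strings T)) (black T) \<and>
     closedin (top_of_set (body T - strings T)) (black T) \<and>
     strings T \<subseteq> closure (black T) \<inter> closure (white T) \<and>
     (\<forall>b\<in>boxes T. starred b \<in> components (frontier (disc b) - strings T) \<and>
        (marks T b \<noteq> {} \<longrightarrow> starred b \<subseteq> white T))"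

definition box_colour :: "tangle \<Rightarrow> planar_box \<Rightarrow> colour" where
  "box_colour T b =
     (if marks T b = {} \<and> frontier (disc b) \<subseteq> black T then Zero_minus
      else Col (card (marks T b) div 2))"

abbreviation ext_colour :: "tangle \<Rightarrow> colour" where
  "ext_colour T \<equiv> box_colour T (ext_box T)"

subsection \<open>Isotopy, reflection, renumbering and substitution\<close>

definition map_box :: "(complex \<Rightarrow> complex) \<Rightarrow> planar_box \<Rightarrow> planar_box" where
  "map_box f b = Planar_Box (f ` disc b) (f ` starred b)"

definition transform :: "(complex \<Rightarrow> complex) \<Rightarrow> tangle \<Rightarrow> tangle" where
  "transform f T = Tangle (map_box f (ext_box T)) (map (map_box f) (int_boxes T))
     (f ` strings T) (f ` black T)"

definition ambient_isotopy :: "'a::topological_space set \<Rightarrow> (real \<Rightarrow> 'a \<Rightarrow> 'a) \<Rightarrow> bool" where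
  "ambient_isotopy S h \<longleftrightarrow>
     continuous_on ({0..1} \<times> S) (\<lambda>(t, x). h t x) \<and>
     (\<forall>t\<in>{0..1}. \<exists>g. homeomorphism S S (h t) g) \<and>
     (\<forall>x\<in>S. h 0 x = x)"

definition isotopic :: "tangle \<Rightarrow> tangle \<Rightarrow> bool" where
  "isotopic T T' \<longleftrightarrow> (\<exists>h. ambient_isotopy UNIV h \<and> T' = transform (h 1) T)"

definition reflect :: "tangle \<Rightarrow> tangle" where
  "reflect T = transform cnj T"

definition renumber :: "(nat \<Rightarrow> nat) \<Rightarrow> tangle \<Rightarrow> tangle" where
  "renumber f T = Tangle (ext_box T) (permute_list f (int_boxes T)) (strings T) (black T)"

text \<open>
  \<open>S\<close> can be glued into the \<open>i\<close>-th internal box of \<open>T\<close> (counting from \<open>0\<close>) if its external box is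
  literally that box, with the same marked points, the same \<open>*\<close> and the same shading. A tangle
  of the appropriate external colour can be brought into this position by an isotopy.
\<close>

definition fits :: "tangle \<Rightarrow> nat \<Rightarrow> tangle \<Rightarrow> bool" where
  "fits T i S \<longleftrightarrow> i < length (int_boxes T) \<and> ext_box S = int_boxes T ! i \<and>
     strings S \<inter> frontier (disc (ext_box S)) = strings T \<inter> frontier (disc (ext_box S)) \<and>
     black S \<inter> frontier (disc (ext_box S)) = black T \<inter> frontier (disc (ext_box S))"

definition substitute :: "tangle \<Rightarrow> nat \<Rightarrow> tangle \<Rightarrow> tangle" where
  "substitute T i S = Tangle (ext_box T)
     (take i (int_boxes T) @ int_boxes S @ drop (Suc i) (int_boxes T))
     (strings T \<union> strings S) (black T \<union> black S)"

text \<open>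
  A contractible closed loop of \<open>T\<close> is a closed curve with nothing inside it. After its removal
  its inside gets the colour of the region surrounding it.
\<close>

definition contractible_loop :: "tangle \<Rightarrow> complex set \<Rightarrow> bool" where
  "contractible_loop T L \<longleftrightarrow> closed_curve_in T L \<and> L \<in> components (strings T) \<and>
     inside L \<subseteq> open_body T - strings T"

definition remove_loop :: "tangle \<Rightarrow> complex set \<Rightarrow> tangle" where
  "remove_loop T L = Tangle (ext_box T) (int_boxes T) (strings T - L)
     (if inside L \<subseteq> black T then black T - inside L else black T \<union> L \<union> inside L)"

text \<open>
  The plane is included into the sphere by stereographic projection. On the sphere the external
  box of a \<open>0\<^sub>+\<close>-tangle is forgotten, its complement becoming part of a white region.
\<close>

definition to_sphere :: "complex \<Rightarrow> complex \<times> real" where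
  "to_sphere z = ((2 / ((norm z)\<^sup>2 + 1)) *\<^sub>R z, ((norm z)\<^sup>2 - 1) / ((norm z)\<^sup>2 + 1))"

definition sphere_isotopic :: "tangle \<Rightarrow> tangle \<Rightarrow> bool" where
  "sphere_isotopic T T' \<longleftrightarrow>
     (\<exists>h. ambient_isotopy (sphere 0 1) h \<and>
        map (\<lambda>b. (to_sphere ` disc b, to_sphere ` starred b)) (int_boxes T') =
        map (\<lambda>b. (h 1 ` to_sphere ` disc b, h 1 ` to_sphere ` starred b)) (int_boxes T) \<and>
        to_sphere ` strings T' = h 1 ` to_sphere ` strings T \<and>
        to_sphere ` black T' = h 1 ` to_sphere ` black T)"

subsection \<open>Some specific tangles\<close>

text \<open>
  \<open>draw A Bs Rs\<close> is the tangle with rectangular boxes \<open>A\<close> and \<open>Bs\<close>, given by their lower left and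
  upper right corners and having \<open>*\<close> at the left, whose curves are the parts in the body of the
  frontiers of the closed sets \<open>Rs\<close>; the points that lie in an odd number of the \<open>Rs\<close> are black.
\<close>

definition rectangle_box :: "complex set \<Rightarrow> complex \<times> complex \<Rightarrow> planar_box" where
  "rectangle_box C = (\<lambda>(a, b). Planar_Box (cbox a b)
     (connected_component_set (frontier (cbox a b) - C) (Complex (Re a) ((Im a + Im b) / 2))))"

definition draw ::
  "complex \<times> complex \<Rightarrow> (complex \<times> complex) list \<Rightarrow> complex set list \<Rightarrow> tangle" where
  "draw A Bs Rs =
     (let D = (case A of (a, b) \<Rightarrow> cbox a b) - (\<Union>(a, b)\<in>set Bs. interior (cbox a b));
          C = D \<inter> (\<Union>R\<in>set Rs. frontier R)
      in Tangle (rectangle_box C A) (map (rectangle_box C) Bs) C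
           {z \<in> D - C. odd (length (filter (\<lambda>R. z \<in> R) Rs))})"

text \<open>
  \<open>n\<close> vertical strands at the abscissae \<open>1, \<dots>, n\<close>. For the colour \<open>0\<^sub>-\<close> there
  is no strand, and the whole plane is black.
\<close>

definition vertical_strands :: "nat \<Rightarrow> complex set list" where
  "vertical_strands n = map (\<lambda>j. {z. real j \<le> Re z}) [1..<Suc n]"

fun strand_count :: "colour \<Rightarrow> nat" where
  "strand_count Zero_minus = 0"
| "strand_count (Col n) = n"

fun through_strands :: "colour \<Rightarrow> complex set list" where
  "through_strands Zero_minus = [UNIV]"
| "through_strands (Col n) = vertical_strands n"

definition identity_tangle :: "colour \<Rightarrow> tangle" where
  "identity_tangle c = (let w = real (strand_count c) in
     draw (Complex (-1) (-2), Complex (w + 2) 2) [(Complex 0 (-1), Complex (w + 1) 1)]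
       (through_strands c))"

definition mult_tangle :: "colour \<Rightarrow> tangle" where
  "mult_tangle c = (let w = real (strand_count c) in
     draw (Complex (-1) (-3), Complex (w + 2) 3)
       [(Complex 0 1, Complex (w + 1) 2), (Complex 0 (-2), Complex (w + 1) (-1))]
       (through_strands c))"

definition unit_tangle :: "colour \<Rightarrow> tangle" where
  "unit_tangle c = draw (Complex 0 (-1), Complex (real (strand_count c) + 1) 1) []
     (through_strands c)"

definition inclusion_tangle :: "nat \<Rightarrow> tangle" where
  "inclusion_tangle n =
     draw (Complex (-1) (-2), Complex (real n + 2) 2) [(Complex 0 (-1), Complex (real n + 1/2) 1)]
       (vertical_strands (Suc n))"

definition jones_tangle :: "nat \<Rightarrow> tangle" where
  "jones_tangle n = draw (Complex 0 (-1), Complex (real n + 1) 1) []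
     (vertical_strands (n - 2) @
      [cball (Complex (real n - 1/2) 1) (1/2), cball (Complex (real n - 1/2) (-1)) (1/2)])"

text \<open>
  The \<open>j\<close>-th strand of the box is closed up on the right by the frontier of a rectangle with
  left side \<open>Re z = j\<close>; these rectangles are nested.
\<close>

definition trace_tangle :: "nat \<Rightarrow> tangle" where
  "trace_tangle n =
     draw (Complex (-1) (- real n - 2), Complex (2 * real n + 2) (real n + 2))
       [(Complex 0 (-1), Complex (real n + 1) 1)]
       (map (\<lambda>j. cbox (Complex (real j) (- (real n + 2 - real j)))
                     (Complex (2 * real n + 2 - real j) (real n + 2 - real j))) [1..<Suc n])"

section \<open>Unital C*-algebras\<close>

locale cstar_algebra = vector_space scale
  for scale :: "complex \<Rightarrow> 'v::ab_group_add \<Rightarrow> 'v" +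
  fixes A :: "'v set"
    and mult :: "'v \<Rightarrow> 'v \<Rightarrow> 'v"
    and unit :: 'v
    and adj :: "'v \<Rightarrow> 'v"
    and N :: "'v \<Rightarrow> real"
  assumes subspace_A: "subspace A"
    and mult_closed: "x \<in> A \<Longrightarrow> y \<in> A \<Longrightarrow> mult x y \<in> A"
    and mult_assoc: "x \<in> A \<Longrightarrow> y \<in> A \<Longrightarrow> z \<in> A \<Longrightarrow> mult (mult x y) z = mult x (mult y z)"
    and mult_add_left: "x \<in> A \<Longrightarrow> y \<in> A \<Longrightarrow> z \<in> A \<Longrightarrow> mult (x + y) z = mult x z + mult y z"
    and mult_add_right: "x \<in> A \<Longrightarrow> y \<in> A \<Longrightarrow> z \<in> A \<Longrightarrow> mult x (y + z) = mult x y + mult x z"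
    and mult_scale_left: "x \<in> A \<Longrightarrow> y \<in> A \<Longrightarrow> mult (scale a x) y = scale a (mult x y)"
    and mult_scale_right: "x \<in> A \<Longrightarrow> y \<in> A \<Longrightarrow> mult x (scale a y) = scale a (mult x y)"
    and unit_closed: "unit \<in> A"
    and unit_left: "x \<in> A \<Longrightarrow> mult unit x = x"
    and unit_right: "x \<in> A \<Longrightarrow> mult x unit = x"
    and adj_closed: "x \<in> A \<Longrightarrow> adj x \<in> A"
    and adj_adj: "x \<in> A \<Longrightarrow> adj (adj x) = x"
    and adj_add: "x \<in> A \<Longrightarrow> y \<in> A \<Longrightarrow> adj (x + y) = adj x + adj y"
    and adj_scale: "x \<in> A \<Longrightarrow> adj (scale a x) = scale (cnj a) (adj x)"
    and adj_mult: "x \<in> A \<Longrightarrow> y \<in> A \<Longrightarrow> adj (mult x y) = mult (adj y) (adj x)"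
    and norm_nonneg: "x \<in> A \<Longrightarrow> N x \<ge> 0"
    and norm_zero_iff: "x \<in> A \<Longrightarrow> N x = 0 \<longleftrightarrow> x = 0"
    and norm_triangle: "x \<in> A \<Longrightarrow> y \<in> A \<Longrightarrow> N (x + y) \<le> N x + N y"
    and norm_scale: "x \<in> A \<Longrightarrow> N (scale a x) = cmod a * N x"
    and norm_mult: "x \<in> A \<Longrightarrow> y \<in> A \<Longrightarrow> N (mult x y) \<le> N x * N y"
    and norm_adj_mult: "x \<in> A \<Longrightarrow> N (mult (adj x) x) = (N x)\<^sup>2"
    and complete: "(\<And>n. X n \<in> A) \<Longrightarrow>
       (\<And>e. e > 0 \<Longrightarrow> \<exists>M. \<forall>m\<ge>M. \<forall>n\<ge>M. N (X m - X n) < e) \<Longrightarrow>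
       \<exists>x\<in>A. (\<lambda>n::nat. N (X n - x)) \<longlonglongrightarrow> 0"

section \<open>Planar algebras\<close>

text \<open>
  The spaces \<open>P c\<close> are subspaces of an ambient vector space, and the linear map on a tensor
  product is given as a multilinear map on lists of vectors.
\<close>

definition inputs :: "(colour \<Rightarrow> 'v set) \<Rightarrow> tangle \<Rightarrow> 'v list set" where
  "inputs P T = {xs. list_all2 (\<lambda>x b. x \<in> P (box_colour T b)) xs (int_boxes T)}"

locale planar_algebra = vector_space scale
  for scale :: "'k::field \<Rightarrow> 'v::ab_group_add \<Rightarrow> 'v" +
  fixes P :: "colour \<Rightarrow> 'v set"
    and Z :: "tangle \<Rightarrow> 'v list \<Rightarrow> 'v"
  assumes subspace_P: "subspace (P c)"
    and Z_closed: "tangle T \<Longrightarrow> xs \<in> inputs P T \<Longrightarrow> Z T xs \<in> P (ext_colour T)"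
    and Z_add: "tangle T \<Longrightarrow> us @ x # vs \<in> inputs P T \<Longrightarrow> us @ y # vs \<in> inputs P T \<Longrightarrow>
       Z T (us @ (x + y) # vs) = Z T (us @ x # vs) + Z T (us @ y # vs)"
    and Z_scale: "tangle T \<Longrightarrow> us @ x # vs \<in> inputs P T \<Longrightarrow>
       Z T (us @ scale a x # vs) = scale a (Z T (us @ x # vs))"
    and Z_isotopic: "tangle T \<Longrightarrow> isotopic T T' \<Longrightarrow> xs \<in> inputs P T \<Longrightarrow> Z T' xs = Z T xs"
    and Z_substitute: "tangle T \<Longrightarrow> tangle S \<Longrightarrow> fits T (length us) S \<Longrightarrow> ys \<in> inputs P S \<Longrightarrow>
       us @ Z S ys # vs \<in> inputs P T \<Longrightarrow>
       Z (substitute T (length us) S) (us @ ys @ vs) = Z T (us @ Z S ys # vs)"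
    and Z_renumber: "tangle T \<Longrightarrow> xs \<in> inputs P T \<Longrightarrow> f permutes {..<length xs} \<Longrightarrow>
       Z (renumber f T) (permute_list f xs) = Z T xs"
    and Z_identity: "x \<in> P c \<Longrightarrow> Z (identity_tangle c) [x] = x"
begin

definition mult :: "colour \<Rightarrow> 'v \<Rightarrow> 'v \<Rightarrow> 'v" where
  "mult c x y = Z (mult_tangle c) [x, y]"

definition unit :: "colour \<Rightarrow> 'v" where
  "unit c = Z (unit_tangle c) []"

definition incl :: "nat \<Rightarrow> 'v \<Rightarrow> 'v" where
  "incl n x = Z (inclusion_tangle n) [x]"

definition E :: "nat \<Rightarrow> 'v" where
  "E n = Z (jones_tangle n) []"

text \<open>
  If \<open>P (Col 0)\<close> is one-dimensional and spanned by \<open>unit (Col 0)\<close>, it is identified with the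
  ground field via \<open>a \<mapsto> scale a (unit (Col 0))\<close>.
\<close>

definition scalar_of :: "'v \<Rightarrow> 'k" where
  "scalar_of x = (THE a. x = scale a (unit (Col 0)))"

definition tr :: "'k \<Rightarrow> nat \<Rightarrow> 'v \<Rightarrow> 'k" where
  "tr d n x = inverse (d ^ n) * scalar_of (Z (trace_tangle n) [x])"

definition planar_subalgebra :: "(colour \<Rightarrow> 'v set) \<Rightarrow> bool" where
  "planar_subalgebra Q \<longleftrightarrow> (\<forall>c. subspace (Q c) \<and> Q c \<subseteq> P c) \<and>
     (\<forall>T xs. tangle T \<and> xs \<in> inputs Q T \<longrightarrow> Z T xs \<in> Q (ext_colour T))"

text \<open>The smallest planar subalgebra containing the vector \<open>z\<close> of colour \<open>c\<close>.\<close>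

definition generated :: "colour \<Rightarrow> 'v \<Rightarrow> colour \<Rightarrow> 'v set" where
  "generated c z n = \<Inter>{Q n | Q. planar_subalgebra Q \<and> z \<in> Q c}"

text \<open>\<open>P\<^sub>k\<^sub>+\<^sub>1 = P\<^sub>k E\<^sub>k\<^sub>+\<^sub>1 P\<^sub>k\<close>\<close>

definition depth_condition :: "nat \<Rightarrow> bool" where
  "depth_condition k \<longleftrightarrow>
     P (Col (Suc k)) =
     span {mult (Col (Suc k)) (mult (Col (Suc k)) (incl k x) (E (Suc k))) (incl k y) | x y.
             x \<in> P (Col k) \<and> y \<in> P (Col k)}"

definition finite_depth :: bool where
  "finite_depth \<longleftrightarrow> (\<exists>k>0. depth_condition k)"

text \<open>Only meaningful if \<open>finite_depth\<close> holds.\<close>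

definition depth :: nat where
  "depth = (LEAST k. k > 0 \<and> depth_condition k)"

end

locale subfactor_planar_algebra = planar_algebra scale P Z
  for scale :: "complex \<Rightarrow> 'v::ab_group_add \<Rightarrow> 'v"
    and P :: "colour \<Rightarrow> 'v set"
    and Z :: "tangle \<Rightarrow> 'v list \<Rightarrow> 'v" +
  fixes adj :: "colour \<Rightarrow> 'v \<Rightarrow> 'v"
    and \<delta> :: real
  assumes finite_dimensional: "\<exists>B. finite B \<and> span B = P c"
    and dim_zero_plus: "dim (P (Col 0)) = 1"
    and dim_zero_minus: "dim (P Zero_minus) = 1"
    and modulus_pos: "\<delta> > 0"
    and modulus: "tangle T \<Longrightarrow> contractible_loop T L \<Longrightarrow> xs \<in> inputs P T \<Longrightarrow>
       Z T xs = scale (complex_of_real \<delta>) (Z (remove_loop T L) xs)"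
    and spherical: "tangle T \<Longrightarrow> tangle T' \<Longrightarrow> ext_colour T = Col 0 \<Longrightarrow> ext_colour T' = Col 0 \<Longrightarrow>
       sphere_isotopic T T' \<Longrightarrow> xs \<in> inputs P T \<Longrightarrow> Z T' xs = Z T xs"
    and cstar: "\<exists>N. cstar_algebra scale (P c) (mult c) (unit c) (adj c) N"
    and adj_Z: "tangle T \<Longrightarrow> xs \<in> inputs P T \<Longrightarrow>
       adj (ext_colour T) (Z T xs) =
       Z (reflect T) (map2 (\<lambda>b x. adj (box_colour T b) x) (int_boxes T) xs)"
    and trace_normalised: "tr (complex_of_real \<delta>) n (unit (Col n)) = 1"
    and trace_commute: "x \<in> P (Col n) \<Longrightarrow> y \<in> P (Col n) \<Longrightarrow>
       tr (complex_of_real \<delta>) n (mult (Col n) x y) = tr (complex_of_real \<delta>) n (mult (Col n) y x)"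
    and trace_positive: "x \<in> P (Col n) \<Longrightarrow>
       \<exists>r\<ge>0. tr (complex_of_real \<delta>) n (mult (Col n) (adj (Col n) x) x) = complex_of_real r"
    and trace_faithful: "x \<in> P (Col n) \<Longrightarrow>
       tr (complex_of_real \<delta>) n (mult (Col n) (adj (Col n) x) x) = 0 \<Longrightarrow> x = 0"

end

theory Submission
  imports Defs
begin

text \<open>
  If \<open>b\<^sub>0 = 1, b\<^sub>1, \<dots>\<close> is a basis of \<open>P\<^sub>k\<close> and \<open>f\<^sub>0, f\<^sub>1, \<dots>\<close> is the dual basis for the trace form, then
  contracting \<open>w \<in> P\<^sub>k\<close> against the \<open>2k\<close>-box \<open>z = \<Sum>\<^sub>i f\<^sub>i \<otimes> b\<^sub>i\<^sub>+\<^sub>1\<close> gives \<open>\<Sum>\<^sub>i tr (w f\<^sub>i) b\<^sub>i\<^sub>+\<^sub>1\<close>, so that the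
  planar subalgebra generated by \<open>z\<close> contains all of \<open>P\<^sub>k\<close>. For \<open>x \<in> P\<^sub>n\<close> with \<open>n < k\<close>, the same
  contraction recovers a nonzero multiple of \<open>x\<close> from the \<open>k\<close>-box \<open>1 \<otimes> x\<close>. If the depth condition holds at
  \<open>l \<le> n\<close>, the identity of \<open>P\<^sub>l\<^sub>+\<^sub>1\<close> is a sum of elements \<open>a E b\<close>, and inserting it above \<open>x \<in> P\<^sub>n\<^sub>+\<^sub>1\<close> writes
  \<open>x\<close> through \<open>E b x\<close>, in which the cap of \<open>E\<close> together with \<open>b x\<close> is an element of \<open>P\<^sub>n\<close>.

  All tangles are drawn with rectangular boxes, the curves being the frontiers of closed convex regions. Such a
  frontier is a simple loop (after cutting off the region far away), which crosses the boxes transversally and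
  so is cut by them into finitely many arcs. Drawings with the same regions substitute into each other literally,
  and the only isotopies needed are products of two increasing homeomorphisms of the line.
\<close>

section \<open>Curves cut by rectangles\<close>

text \<open>The definitions treat a tangle as a set of points in the plane: the strings must be
  shown to be finitely many disjoint arcs and loops, and both colours to approach every point of
  them. Substitution asks for literal equality of the common box, of its \<open>*\<close>, and of
  the curves and shading on its edges. Hence each computation fixes one list of regions of the whole
  plane and varies only the rectangles; identities between values of \<open>Z\<close> come from
  grouping the same boxes in two ways. Keeping the left side of every box outside all regions makes
  each \<open>*\<close> white and gives each box a colour \<open>Col n\<close>; the colour
  \<open>Zero_minus\<close> enters only through its unit.

  The dual basis exists because the trace is faithful. The index shift in the generator lets
  contraction turn each basis vector into the next, and the start of this chain, the unit, lies in
  every planar subalgebra.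

  The depth condition is applied at the depth itself, which may be smaller than \<open>k\<close>; so
  the spaces of lower colour have to be recovered before the induction to higher colours can
  begin.\<close>

lemma frontier_simple_loop:
  fixes R :: "complex set"
  assumes "compact R" "convex R" "interior R \<noteq> {}"
  obtains g where "simple_path g" "pathfinish g = pathstart g" "path_image g = frontier R"
proof -
  let ?B = "cbox 0 (Complex 1 1)" and ?g = "rectpath 0 (Complex 1 1)"
  have "Complex (1/2) (1/2) \<in> box 0 (Complex 1 1)"
    by (simp add: in_box_complex_iff)
  then have B: "interior ?B \<noteq> {}"
    by auto
  have "R homeomorphic ?B"
    using assms B by (intro homeomorphic_convex_compact_sets) (auto simp: aff_dim_nonempty_interior)
  \<comment> \<open>Homeomorphic closed sets with nonempty interior have homeomorphic frontiers, so
    the boundary path of the square can be transported to \<open>R\<close>.\<close>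
  then have "frontier ?B homeomorphic frontier R"
    using assms B homeomorphic_frontiers[of ?B R] homeomorphic_sym[of R ?B] compact_imp_closed[of R]
    by (metis closed_cbox)
  then obtain f f' where f: "homeomorphism (frontier ?B) (frontier R) f f'"
    unfolding homeomorphic_def by blast
  have g: "simple_path ?g" "pathfinish ?g = pathstart ?g"
    by (auto intro!: simple_path_rectpath)
  have im: "path_image ?g = frontier ?B"
    by (subst path_image_rectpath_cbox_minus_box) (auto simp: frontier_cbox)
  show thesis
  proof
    show "simple_path (f \<circ> ?g)"
      using f g(1) unfolding homeomorphism_def
      by (intro simple_path_continuous_image) (auto simp: im intro: inj_on_inverseI[where g=f'])
    show "pathfinish (f \<circ> ?g) = pathstart (f \<circ> ?g)"
      using g(2) by (simp add: pathfinish_compose pathstart_compose)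
    show "path_image (f \<circ> ?g) = frontier R"
      using f by (simp add: path_image_compose im homeomorphism_image1)
  qed
qed

lemma frontier_line_segment:
  fixes R :: "complex set"
  assumes "closed R" "convex R" "q \<in> interior R" "v \<in> frontier R" "u \<in> open_segment q v"
  shows "u \<notin> frontier R"
  using assms in_interior_closure_convex_segment[of R q v]
  by (auto simp: frontier_def)

lemma Im_eq_open_segment:
  assumes "Im q = y" "Im u = y" "Im v = y" "Re q < Re u \<and> Re u < Re v \<or> Re v < Re u \<and> Re u < Re q"
  shows "u \<in> open_segment q v"
proof -
  have "u = (1 - t) *\<^sub>R q + t *\<^sub>R v" if t: "t = (Re u - Re q) / (Re v - Re q)" for t
    using assms t by (auto simp: complex_eq_iff divide_simps) (simp_all add: algebra_simps)
  moreover have "(Re u - Re q) / (Re v - Re q) \<in> {0<..<1}"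
    using assms by (auto simp: divide_simps)
  ultimately show ?thesis
    using assms unfolding in_segment by (metis greaterThanLessThan_iff less_irrefl order_less_asym)
qed

text \<open>Seen from \<open>q\<close>, each of the two horizontal directions leaves the convex set
  at most once: of two frontier points on the same side, the nearer one would lie on the open
  segment from \<open>q\<close> to the farther one, hence in the interior.\<close>

lemma finite_frontier_line:
  fixes R :: "complex set"
  assumes "closed R" "convex R" and q: "q \<in> interior R"
  shows "finite {z \<in> frontier R. Im z = Im q}"
proof -
  have one: "u = v" if "u \<in> frontier R" "v \<in> frontier R" "Im u = Im q" "Im v = Im q"
      "Re q < Re u \<and> Re q < Re v \<or> Re u < Re q \<and> Re v < Re q" for u v
  proof (rule ccontr)
    assume "u \<noteq> v"
    then have "Re u < Re v \<or> Re v < Re u"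
      using that by (auto simp: complex_eq_iff)
    then have "u \<in> open_segment q v \<or> v \<in> open_segment q u"
      using that by (auto intro!: Im_eq_open_segment[where y="Im q"])
    then show False
      using frontier_line_segment[OF assms] that by blast
  qed
  have "q \<notin> frontier R"
    using q by (simp add: frontier_def)
  let ?A = "{z \<in> frontier R. Im z = Im q \<and> Re q < Re z}"
  let ?B = "{z \<in> frontier R. Im z = Im q \<and> Re z < Re q}"
  have sub: "finite S" if "\<And>u v. u \<in> S \<Longrightarrow> v \<in> S \<Longrightarrow> u = v" for S :: "complex set"
  proof (cases "S = {}")
    case False
    then obtain x where "x \<in> S" by blast
    then have "S \<subseteq> {x}" using that by blast
    then show ?thesis by (rule finite_subset) simp
  qed simp
  have "finite ?A" "finite ?B"
    by (rule sub, use one in blast)+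
  moreover have "{z \<in> frontier R. Im z = Im q} = ?A \<union> ?B"
  proof -
    have "Re z \<noteq> Re q" if "z \<in> frontier R" "Im z = Im q" for z
      using that \<open>q \<notin> frontier R\<close> complex_eqI[of z q] by auto
    then show ?thesis
      by (auto simp: neq_iff)
  qed
  ultimately show ?thesis
    by simp
qed

text \<open>Near a point whose horizontal line meets the interior, the frontier of a convex set is a graph over the
  vertical axis; this makes the crossing of a horizontal edge transversal.\<close>

lemma frontier_locally_graph:
  fixes R :: "complex set"
  assumes "closed R" "convex R" and q: "q \<in> interior R" and p: "p \<in> frontier R" "Im p = Im q"
  obtains e where "e > 0" "inj_on Im (frontier R \<inter> ball p e)"
proof -
  obtain r where r: "r > 0" "ball q r \<subseteq> R"
    using q by (auto simp: mem_interior)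
  have "p \<noteq> q"
    using p q by (auto simp: frontier_def)
  then have ne: "Re p \<noteq> Re q"
    using p(2) by (auto simp: complex_eq_iff)
  \<comment> \<open>The bound \<open>r\<close> keeps the point below or above \<open>q\<close> at a
    nearby height in the interior; the bound by the horizontal distance keeps all nearby points on
    the same side of \<open>q\<close> as \<open>p\<close>.\<close>
  define e where "e = min r (\<bar>Re p - Re q\<bar>)"
  have "inj_on Im (frontier R \<inter> ball p e)"
  proof (rule inj_onI, rule ccontr)
    fix u v assume uv: "u \<in> frontier R \<inter> ball p e" "v \<in> frontier R \<inter> ball p e" "Im u = Im v" "u \<noteq> v"
    define q' where "q' = Complex (Re q) (Im u)"
    have close: "\<bar>Re w - Re p\<bar> < e" "\<bar>Im w - Im p\<bar> < e" if "w \<in> ball p e" for w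
      using that abs_Re_le_cmod[of "w - p"] abs_Im_le_cmod[of "w - p"]
      by (auto simp: dist_norm norm_minus_commute)
    have "q' - q = \<i> * complex_of_real (Im u - Im p)"
      by (simp add: q'_def p(2) complex_eq_iff)
    then have "norm (q' - q) = \<bar>Im u - Im p\<bar>"
      by (metis norm_mult norm_ii mult_1 norm_of_real)
    then have "q' \<in> ball q r"
      using close(2)[of u] uv(1) by (auto simp: dist_norm e_def norm_minus_commute)
    then have q': "q' \<in> interior R"
      using r(2) interior_maximal open_ball by blast
    have R: "Re u \<noteq> Re v"
      using uv by (auto simp: complex_eq_iff)
    have "\<bar>Re u - Re p\<bar> < \<bar>Re p - Re q\<bar>" "\<bar>Re v - Re p\<bar> < \<bar>Re p - Re q\<bar>"
      using close(1)[of u] close(1)[of v] uv by (auto simp: e_def)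
    then have "(Re q < Re u \<and> Re q < Re v) \<or> (Re u < Re q \<and> Re v < Re q)"
      by linarith
    then have "Re q < Re u \<and> Re u < Re v \<or> Re v < Re u \<and> Re u < Re q \<or>
        Re q < Re v \<and> Re v < Re u \<or> Re u < Re v \<and> Re v < Re q"
      using R by linarith
    then have "u \<in> open_segment q' v \<or> v \<in> open_segment q' u"
    proof -
      have "Im q' = Im u" "Re q' = Re q"
        by (simp_all add: q'_def)
      then show ?thesis if "Re q < Re u \<and> Re u < Re v \<or> Re v < Re u \<and> Re u < Re q \<or>
        Re q < Re v \<and> Re v < Re u \<or> Re u < Re v \<and> Re v < Re q"
        using that Im_eq_open_segment[of q' "Im u" u v] Im_eq_open_segment[of q' "Im u" v u] uv(3)
        by metis
    qed
    then show False
      using frontier_line_segment[OF assms(1,2) q'] uv by blast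
  qed
  moreover have "e > 0"
    using r ne by (simp add: e_def)
  ultimately show thesis
    using that by blast
qed

text \<open>On a short interval of times \<open>Im \<circ> g\<close> is continuous and injective,
  hence strictly monotone. So the path passes from one side of the horizontal line through
  \<open>g t\<close> to the other and does not merely touch it.\<close>

lemma graph_crossing:
  fixes g :: "real \<Rightarrow> complex"
  assumes g: "continuous_on {0..1} g" "inj_on g {0<..<1}" and t: "0 < t" "t < 1"
    and graph: "e > 0" "inj_on Im (g ` {0..1} \<inter> ball (g t) e)"
  obtains d where "d > 0" "t - d > 0" "t + d < 1" "g ` {t-d..t+d} \<subseteq> ball (g t) e"
    "(\<forall>s\<in>{t-d..<t}. Im (g s) < Im (g t)) \<and> (\<forall>s\<in>{t<..t+d}. Im (g s) > Im (g t)) \<or>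
     (\<forall>s\<in>{t-d..<t}. Im (g s) > Im (g t)) \<and> (\<forall>s\<in>{t<..t+d}. Im (g s) < Im (g t))"
proof -
  have "isCont g t"
    using g(1) t by (auto intro: continuous_on_interior)
  then obtain d0 where d0: "d0 > 0" "\<And>s. dist s t < d0 \<Longrightarrow> dist (g s) (g t) < e"
    using graph(1) unfolding continuous_at_eps_delta by (metis dist_norm)
  define d where "d = min (d0/2) (min (t/2) ((1-t)/2))"
  have dle: "d \<le> t/2" "d \<le> (1-t)/2" "d \<le> d0/2"
    unfolding d_def by linarith+
  moreover have "d > 0"
    using d0 t by (simp add: d_def)
  ultimately have d: "d > 0" "t - d > 0" "t + d < 1"
    using t by auto
  have im: "g ` {t-d..t+d} \<subseteq> ball (g t) e"
  proof safe
    fix s assume "s \<in> {t-d..t+d}"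
    then have "dist s t < d0"
      using d0(1) dle(3) by (auto simp: dist_real_def)
    then show "g s \<in> ball (g t) e"
      using d0(2) by (simp add: dist_commute)
  qed
  have inj: "inj_on (Im \<circ> g) {t-d..t+d}"
  proof (rule comp_inj_on)
    show "inj_on g {t-d..t+d}"
      using g(2) d by (elim inj_on_subset) auto
    show "inj_on Im (g ` {t-d..t+d})"
      using graph(2) im d by (elim inj_on_subset) auto
  qed
  have cont: "continuous_on {t-d..t+d} (Im \<circ> g)"
    using d by (auto intro!: continuous_intros continuous_on_subset[OF g(1)] simp: o_def)
  have alt: "Im (g a) < Im (g t) \<and> Im (g t) < Im (g b) \<or> Im (g b) < Im (g t) \<and> Im (g t) < Im (g a)"
    if "t - d \<le> a" "a < t" "t < b" "b \<le> t + d" for a b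
    using continuous_inj_imp_mono[of a t b "Im \<circ> g"] that inj_on_subset[OF inj, of "{a..b}"]
      continuous_on_subset[OF cont, of "{a..b}"] by auto
  have "(\<forall>s\<in>{t-d..<t}. Im (g s) < Im (g t)) \<and> (\<forall>s\<in>{t<..t+d}. Im (g s) > Im (g t)) \<or>
     (\<forall>s\<in>{t-d..<t}. Im (g s) > Im (g t)) \<and> (\<forall>s\<in>{t<..t+d}. Im (g s) < Im (g t))"
  proof (cases "Im (g (t+d)) > Im (g t)")
    case True
    then have a: "Im (g s) < Im (g t)" if "s \<in> {t-d..<t}" for s
      using alt[of s "t+d"] that d by auto
    then have "Im (g s) > Im (g t)" if "s \<in> {t<..t+d}" for s
    proof -
      have "t - d \<in> {t-d..<t}" using d by auto
      from a[OF this] alt[of "t-d" s] that d show ?thesis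
        by (metis greaterThanAtMost_iff order.refl order_less_asym diff_less_eq less_add_same_cancel1)
    qed
    then show ?thesis using a by blast
  next
    case False
    then have a: "Im (g s) > Im (g t)" if "s \<in> {t-d..<t}" for s
      using alt[of s "t+d"] that d by auto
    then have "Im (g s) < Im (g t)" if "s \<in> {t<..t+d}" for s
    proof -
      have "t - d \<in> {t-d..<t}" using d by auto
      from a[OF this] alt[of "t-d" s] that d show ?thesis
        by (metis greaterThanAtMost_iff order.refl order_less_asym diff_less_eq less_add_same_cancel1)
    qed
    then show ?thesis using a by blast
  qed
  then show thesis
    using that d im by blast
qed

text \<open>\<open>U\<close> plays the role of the open body of a tangle, \<open>F\<close> that of the union of the frontiers of its boxes.\<close>

lemma path_pieces:
  fixes g :: "real \<Rightarrow> complex"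
  assumes g: "path g" "g 0 \<notin> U \<union> F" "g 1 \<notin> U \<union> F"
    and inj: "inj_on g {t\<in>{0..1}. g t \<in> U \<union> F}"
    and op: "open U" "closed (U \<union> F)" "U \<inter> F = {}"
    and fin: "finite (path_image g \<inter> F)"
    and trans: "\<And>t. t \<in> {0<..<1} \<Longrightarrow> g t \<in> F \<Longrightarrow>
      \<exists>d>0. t - d > 0 \<and> t + d < 1 \<and> ((\<forall>s\<in>{t-d..<t}. g s \<in> U) \<and> (\<forall>s\<in>{t<..t+d}. g s \<notin> U \<union> F) \<or>
        (\<forall>s\<in>{t-d..<t}. g s \<notin> U \<union> F) \<and> (\<forall>s\<in>{t<..t+d}. g s \<in> U))"
  obtains C where "finite C" "pairwise disjnt C" "\<Union>C = path_image g \<inter> (U \<union> F)"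
    "\<And>c. c \<in> C \<Longrightarrow> \<exists>h. arc h \<and> c = path_image h \<and> {pathstart h, pathfinish h} \<subseteq> F \<and>
       c - {pathstart h, pathfinish h} \<subseteq> U"
proof -
  \<comment> \<open>The times spent on the boundary. They are finitely many, since \<open>g\<close>
    is injective on them and meets \<open>F\<close> in a finite set.\<close>
  define TF where "TF = {t\<in>{0..1}. g t \<in> F}"
  have TF01: "TF \<subseteq> {0<..<1}"
  proof
    fix t assume "t \<in> TF"
    then have "t \<noteq> 0" "t \<noteq> 1" "0 \<le> t" "t \<le> 1"
      using g by (auto simp: TF_def)
    then show "t \<in> {0<..<1}"
      by simp
  qed
  have "inj_on g TF"
    using inj by (rule inj_on_subset) (auto simp: TF_def)
  moreover have "finite (g ` TF)"
    using fin by (rule finite_subset[rotated]) (auto simp: TF_def path_image_def)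
  ultimately have finTF: "finite TF"
    by (simp add: finite_image_iff)
  have cont: "continuous_on {0..1} g"
    using g(1) by (simp add: path_def)
  \<comment> \<open>\<open>U\<close> and the complement of \<open>U \<union> F\<close> are disjoint
    open sets, so a connected set of times that avoids \<open>TF\<close> cannot visit both.\<close>
  have conn: "g ` I \<subseteq> U" if "connected I" "I \<subseteq> {0..1}" "I \<inter> TF = {}" "t \<in> I" "g t \<in> U" for I t
  proof -
    have c: "connected (g ` I)"
      using that cont by (intro connected_continuous_image) (auto elim: continuous_on_subset)
    have "g ` I \<subseteq> U \<union> (- (U \<union> F))"
      using that(2,3) unfolding TF_def by fastforce
    moreover have "open (- (U \<union> F))"
      using op(2) by (simp only: open_Compl)
    ultimately have "U \<inter> g ` I = {} \<or> - (U \<union> F) \<inter> g ` I = {}"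
      using connectedD[OF c op(1), of "- (U \<union> F)"] by blast
    then show ?thesis
      using that \<open>g ` I \<subseteq> U \<union> (- (U \<union> F))\<close> by blast
  qed
  \<comment> \<open>The future arcs: pairs of consecutive times in \<open>TF\<close> between which
    the path runs inside \<open>U\<close>.\<close>
  define Q where "Q = {(a,b). a \<in> TF \<and> b \<in> TF \<and> a < b \<and> (\<forall>s. a < s \<and> s < b \<longrightarrow> g s \<in> U)}"
  have ex: "\<exists>(a,b)\<in>Q. a < t \<and> t < b" if t: "t \<in> {0..1}" "g t \<in> U" for t
  proof -
    have 0: "\<exists>s\<in>TF. s < t"
    proof (rule ccontr)
      assume "\<not> ?thesis"
      then have "{0..t} \<inter> TF = {}"
        using t op(3) by (auto simp: TF_def order_le_less)
      then have "g ` {0..t} \<subseteq> U"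
        using conn[of "{0..t}" t] t by auto
      moreover have "0 \<in> {0..t}" using t by simp
      ultimately show False
        using g(2) by blast
    qed
    have 1: "\<exists>s\<in>TF. t < s"
    proof (rule ccontr)
      assume "\<not> ?thesis"
      then have "{t..1} \<inter> TF = {}"
        using t op(3) by (auto simp: TF_def order_le_less)
      then have "g ` {t..1} \<subseteq> U"
        using conn[of "{t..1}" t] t by auto
      moreover have "1 \<in> {t..1}" using t by simp
      ultimately show False
        using g(3) by blast
    qed
    define a b where "a = Max {s\<in>TF. s < t}" and "b = Min {s\<in>TF. t < s}"
    have a: "a \<in> TF" "a < t" "\<And>s. s \<in> TF \<Longrightarrow> s < t \<Longrightarrow> s \<le> a"
    proof -
      have "finite {s\<in>TF. s < t}" "{s\<in>TF. s < t} \<noteq> {}"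
        using finTF 0 by auto
      from Max_in[OF this] Max_ge[OF this(1)]
      show "a \<in> TF" "a < t" "\<And>s. s \<in> TF \<Longrightarrow> s < t \<Longrightarrow> s \<le> a"
        unfolding a_def by blast+
    qed
    have b: "b \<in> TF" "t < b" "\<And>s. s \<in> TF \<Longrightarrow> t < s \<Longrightarrow> b \<le> s"
    proof -
      have "finite {s\<in>TF. t < s}" "{s\<in>TF. t < s} \<noteq> {}"
        using finTF 1 by auto
      from Min_in[OF this] Min_le[OF this(1)]
      show "b \<in> TF" "t < b" "\<And>s. s \<in> TF \<Longrightarrow> t < s \<Longrightarrow> b \<le> s"
        unfolding b_def by blast+
    qed
    have "t \<notin> TF"
      using t op(3) by (auto simp: TF_def)
    have "{a<..<b} \<inter> TF = {}"
    proof -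
      have "s \<le> a \<or> b \<le> s" if "s \<in> TF" for s
        using a(3)[OF that] b(3)[OF that] that \<open>t \<notin> TF\<close> by (metis linorder_neqE_linordered_idom)
      then show ?thesis by fastforce
    qed
    moreover have "{a<..<b} \<subseteq> {0..1}"
      using a b TF01 by force
    ultimately have "g ` {a<..<b} \<subseteq> U"
      using conn[of "{a<..<b}" t] a b t by auto
    then have "(a,b) \<in> Q"
      using a(1,2) b(1,2) unfolding Q_def by (auto simp: image_subset_iff)
    then show ?thesis
      using a(2) b(2) by (intro bexI[of _ "(a,b)"]) auto
  qed
  have TFU: "t \<notin> TF" if "(a,b) \<in> Q" "a < t" "t < b" for a b t
    using that op(3) by (auto simp: Q_def TF_def)
  \<comment> \<open>By \<open>trans\<close> a boundary time has times in \<open>U\<close> directly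
    on one side of it, so it is an endpoint of an interval of \<open>Q\<close>; no boundary point is
    left isolated.\<close>
  have cover: "\<exists>(a,b)\<in>Q. t \<in> {a..b}" if t: "t \<in> {0..1}" "g t \<in> U \<union> F" for t
  proof (cases "g t \<in> U")
    case True
    then obtain a b where "(a,b) \<in> Q" "a < t" "t < b" using ex[OF t(1)] by blast
    then show ?thesis by (intro bexI[of _ "(a,b)"]) auto
  next
    case False
    then have tTF: "t \<in> TF" "g t \<in> F" "t \<in> {0<..<1}"
      using t TF01 by (auto simp: TF_def)
    from trans[OF tTF(3,2)] obtain d where d: "d > 0" "t - d > 0" "t + d < 1"
      "(\<forall>s\<in>{t-d..<t}. g s \<in> U) \<or> (\<forall>s\<in>{t<..t+d}. g s \<in> U)" by blast
    have "\<exists>u. (u = t - d \<or> u = t + d) \<and> (\<forall>s. min u t \<le> s \<and> s \<le> max u t \<and> s \<noteq> t \<longrightarrow> g s \<in> U)"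
      using d(4)
    proof
      assume "\<forall>s\<in>{t-d..<t}. g s \<in> U"
      then show ?thesis using d(1) by (intro exI[of _ "t - d"]) auto
    next
      assume "\<forall>s\<in>{t<..t+d}. g s \<in> U"
      then show ?thesis using d(1) by (intro exI[of _ "t + d"]) auto
    qed
    then obtain u where u: "u = t - d \<or> u = t + d" "\<And>s. min u t \<le> s \<Longrightarrow> s \<le> max u t \<Longrightarrow> s \<noteq> t \<Longrightarrow> g s \<in> U"
      by blast
    then have "u \<in> {0..1}" "u \<noteq> t" using d by auto
    then obtain a b where ab: "(a,b) \<in> Q" "a < u" "u < b"
      using ex[of u] u(2)[of u] by auto
    have "g a \<notin> U" "g b \<notin> U" using ab(1) op(3) by (auto simp: Q_def TF_def)
    then have "t \<in> {a..b}" using u(2)[of a] u(2)[of b] ab(2,3) by (cases "a \<le> t"; cases "t \<le> b") auto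
    then show ?thesis using ab(1) by (intro bexI[of _ "(a,b)"]) auto
  qed
  \<comment> \<open>Two intervals sharing an endpoint would put the path in \<open>U\<close> on both
    sides of a crossing, against \<open>trans\<close>.\<close>
  have disj: "{a..b} \<inter> {a'..b'} = {}" if Q: "(a,b) \<in> Q" "(a',b') \<in> Q" "a < a' \<or> a = a' \<and> b < b'" for a b a' b'
  proof -
    have in': "a < b" "a' < b'" "a \<in> TF" "a' \<in> TF" "b \<in> TF" "b' \<in> TF"
      using Q by (auto simp: Q_def)
    have "b \<le> a'"
      using TFU[OF Q(1), of a'] TFU[OF Q(2), of b] Q(3) in' by force
    moreover have "b \<noteq> a'"
    proof
      assume "b = a'"
      have "b \<in> {0<..<1}" "g b \<in> F"
        using in'(5) TF01 by (blast, simp add: TF_def)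
      from trans[OF this] obtain d where d: "d > 0"
        "(\<forall>s\<in>{b<..b+d}. g s \<notin> U) \<or> (\<forall>s\<in>{b-d..<b}. g s \<notin> U)" by blast
      have "b + min d ((b'-b)/2) \<in> {a'<..<b'}" "b - min d ((b-a)/2) \<in> {a<..<b}"
        using \<open>b = a'\<close> d(1) in' by (auto simp: min_def field_simps)
      then have "g (b + min d ((b'-b)/2)) \<in> U" "g (b - min d ((b-a)/2)) \<in> U"
        using Q(1,2) unfolding Q_def by auto
      moreover have "b + min d ((b'-b)/2) \<in> {b<..b+d}" "b - min d ((b-a)/2) \<in> {b-d..<b}"
        using d(1) in' \<open>b = a'\<close> by auto
      ultimately show False using d(2) by blast
    qed
    ultimately show ?thesis by auto
  qed
  have sub: "{a..b} \<subseteq> {t\<in>{0..1}. g t \<in> U \<union> F}" if "(a,b) \<in> Q" for a b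
  proof
    fix t assume t: "t \<in> {a..b}"
    have ab: "a \<in> TF" "b \<in> TF" "\<And>s. a < s \<and> s < b \<Longrightarrow> g s \<in> U" using that by (auto simp: Q_def)
    have "0 \<le> t" "t \<le> 1" using t ab TF01 by force+
    moreover have "g t \<in> U \<union> F"
    proof (cases "t = a \<or> t = b")
      case True then show ?thesis using ab by (auto simp: TF_def)
    next
      case False
      then show ?thesis using ab(3)[of t] t by auto
    qed
    ultimately show "t \<in> {t\<in>{0..1}. g t \<in> U \<union> F}" by simp
  qed
  show thesis
  proof
    have "Q \<subseteq> TF \<times> TF" by (auto simp: Q_def)
    then show "finite ((\<lambda>(a,b). g ` {a..b}) ` Q)"
      using finTF by (meson finite_SigmaI finite_imageI finite_subset)
    show "pairwise disjnt ((\<lambda>(a,b). g ` {a..b}) ` Q)"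
    proof (rule pairwise_imageI)
      fix x y assume xy: "x \<in> Q" "y \<in> Q" "x \<noteq> y"
      obtain a b a' b' where eq: "x = (a,b)" "y = (a',b')" by (cases x, cases y)
      have "{a..b} \<inter> {a'..b'} = {}"
        using disj[of a b a' b'] disj[of a' b' a b] xy unfolding eq
        by (metis inf_commute linorder_neqE_linordered_idom)
      then have "g ` {a..b} \<inter> g ` {a'..b'} = {}"
        using inj_on_image_Int[OF inj sub sub, of a b a' b'] xy unfolding eq by simp
      then show "disjnt (case x of (a,b) \<Rightarrow> g ` {a..b}) (case y of (a,b) \<Rightarrow> g ` {a..b})"
        by (simp add: eq disjnt_def)
    qed
    show "\<Union> ((\<lambda>(a,b). g ` {a..b}) ` Q) = path_image g \<inter> (U \<union> F)"
    proof (intro equalityI subsetI)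
      fix z assume "z \<in> \<Union> ((\<lambda>(a,b). g ` {a..b}) ` Q)"
      then obtain a b t where "(a,b) \<in> Q" "t \<in> {a..b}" "z = g t" by auto
      then show "z \<in> path_image g \<inter> (U \<union> F)"
        using sub[of a b] unfolding path_image_def by blast
    next
      fix z assume "z \<in> path_image g \<inter> (U \<union> F)"
      then obtain t where t: "t \<in> {0..1}" "z = g t" "g t \<in> U \<union> F"
        unfolding path_image_def by blast
      then obtain a b where "(a,b) \<in> Q" "t \<in> {a..b}" using cover[of t] by blast
      then show "z \<in> \<Union> ((\<lambda>(a,b). g ` {a..b}) ` Q)"
        using t by (intro UN_I[of "(a,b)"]) auto
    qed
    fix c assume "c \<in> (\<lambda>(a,b). g ` {a..b}) ` Q"
    then obtain a b where ab: "(a,b) \<in> Q" "c = g ` {a..b}" by auto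
    then have a: "a < b" "a \<in> TF" "b \<in> TF" "\<And>s. a < s \<and> s < b \<Longrightarrow> g s \<in> U" by (auto simp: Q_def)
    have s: "{a..b} \<subseteq> {0..1}" using sub[OF ab(1)] by blast
    have arc: "arc (subpath a b g)"
    proof (rule simple_path_imp_arc)
      have "inj_on g {a..b}" using inj sub[OF ab(1)] by (rule inj_on_subset)
      then show "simple_path (subpath a b g)"
        unfolding simple_path_subpath_eq using a s g(1)
        by (auto simp: closed_segment_eq_real_ivl inj_on_def intro!: path_subpath)
      show "pathfinish (subpath a b g) \<noteq> pathstart (subpath a b g)"
        using inj_onD[OF \<open>inj_on g {a..b}\<close>, of b a] a(1) by auto
    qed
    have "path_image (subpath a b g) = c"
      using a by (simp add: path_image_subpath ab(2))
    moreover have "c - {g a, g b} \<subseteq> U"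
      using a(4) unfolding ab(2) by (auto simp: image_subset_iff order_le_less)
    ultimately show "\<exists>h. arc h \<and> c = path_image h \<and> {pathstart h, pathfinish h} \<subseteq> F \<and>
       c - {pathstart h, pathfinish h} \<subseteq> U"
      using arc a by (intro exI[of _ "subpath a b g"]) (auto simp: TF_def)
  qed
qed

section \<open>Drawings\<close>

type_synonym rectangle = "complex \<times> complex"

abbreviation rect :: "rectangle \<Rightarrow> complex set" where
  "rect B \<equiv> cbox (fst B) (snd B)"

abbreviation lft :: "rectangle \<Rightarrow> real" where "lft B \<equiv> Re (fst B)"
abbreviation rgt :: "rectangle \<Rightarrow> real" where "rgt B \<equiv> Re (snd B)"
abbreviation lo :: "rectangle \<Rightarrow> real" where "lo B \<equiv> Im (fst B)"
abbreviation hi :: "rectangle \<Rightarrow> real" where "hi B \<equiv> Im (snd B)"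

definition proper :: "rectangle \<Rightarrow> bool" where
  "proper B \<longleftrightarrow> lft B < rgt B \<and> lo B < hi B"

definition nested :: "rectangle \<Rightarrow> rectangle \<Rightarrow> bool" where
  "nested B A \<longleftrightarrow> lft A < lft B \<and> rgt B < rgt A \<and> lo A < lo B \<and> hi B < hi A"

definition apart :: "rectangle \<Rightarrow> rectangle \<Rightarrow> bool" where
  "apart B B' \<longleftrightarrow> rgt B < lft B' \<or> rgt B' < lft B \<or> hi B < lo B' \<or> hi B' < lo B"

definition layout :: "rectangle \<Rightarrow> rectangle list \<Rightarrow> bool" where
  "layout A Bs \<longleftrightarrow> proper A \<and> (\<forall>B\<in>set Bs. proper B \<and> nested B A) \<and> sorted_wrt apart Bs"

text \<open>Disjoint frontiers keep the curves of different regions apart. The nonempty interior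
  makes a convex region approach each of its frontier points from its interior, as needed for a
  chequerboard shading.\<close>

definition regions :: "complex set list \<Rightarrow> bool" where
  "regions Rs \<longleftrightarrow> (\<forall>R\<in>set Rs. closed R \<and> convex R \<and> interior R \<noteq> {}) \<and>
     sorted_wrt (\<lambda>R R'. frontier R \<inter> frontier R' = {}) Rs"

text \<open>The curve of \<open>R\<close> may meet a box only in its horizontal sides, and only at a
  height whose horizontal line meets the interior of \<open>R\<close>, which makes the crossing
  transversal. The left side must avoid even \<open>R\<close> itself, so that the interval marked
  \<open>*\<close> is white.\<close>

definition crosses :: "complex set \<Rightarrow> rectangle \<Rightarrow> bool" where
  "crosses R B \<longleftrightarrow>
     (\<forall>y\<in>{lo B..hi B}. Complex (lft B) y \<notin> R \<and> Complex (rgt B) y \<notin> frontier R) \<and>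
     (\<forall>y\<in>{lo B, hi B}. (\<exists>x. Complex x y \<in> interior R) \<or>
        (\<forall>x\<in>{lft B..rgt B}. Complex x y \<notin> frontier R))"

definition curves :: "complex set list \<Rightarrow> complex set" where
  "curves Rs = (\<Union>R\<in>set Rs. frontier R)"

definition shaded :: "complex set list \<Rightarrow> complex set" where
  "shaded Rs = {z. odd (length (filter (\<lambda>R. z \<in> R) Rs))}"

abbreviation edges :: "rectangle \<Rightarrow> complex set" where
  "edges B \<equiv> frontier (rect B)"

definition drawing_body :: "rectangle \<Rightarrow> rectangle list \<Rightarrow> complex set" where
  "drawing_body A Bs = rect A - (\<Union>B\<in>set Bs. box (fst B) (snd B))"

definition drawing_interior :: "rectangle \<Rightarrow> rectangle list \<Rightarrow> complex set" where
  "drawing_interior A Bs = box (fst A) (snd A) - (\<Union>B\<in>set Bs. rect B)"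

definition drawing_edges :: "rectangle \<Rightarrow> rectangle list \<Rightarrow> complex set" where
  "drawing_edges A Bs = (\<Union>B\<in>insert A (set Bs). edges B)"

lemma edges_eq: "edges B = rect B - box (fst B) (snd B)"
  by (simp add: frontier_cbox)

lemma in_edges_iff:
  "proper B \<Longrightarrow> z \<in> edges B \<longleftrightarrow>
     (Re z = lft B \<or> Re z = rgt B) \<and> Im z \<in> {lo B..hi B} \<or>
     (Im z = lo B \<or> Im z = hi B) \<and> Re z \<in> {lft B..rgt B}"
  by (auto simp: edges_eq in_cbox_complex_iff in_box_complex_iff proper_def)

lemma layout_rects:
  assumes "layout A Bs"
  shows "proper A" "B \<in> set Bs \<Longrightarrow> proper B" "B \<in> set Bs \<Longrightarrow> rect B \<subseteq> box (fst A) (snd A)"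
    "i < j \<Longrightarrow> j < length Bs \<Longrightarrow> rect (Bs ! i) \<inter> rect (Bs ! j) = {}"
proof -
  show "proper A" "B \<in> set Bs \<Longrightarrow> proper B" "B \<in> set Bs \<Longrightarrow> rect B \<subseteq> box (fst A) (snd A)"
    using assms by (auto simp: layout_def nested_def in_cbox_complex_iff in_box_complex_iff)
  assume "i < j" "j < length Bs"
  then have "apart (Bs!i) (Bs!j)"
    using assms by (simp add: layout_def sorted_wrt_iff_nth_less)
  then show "rect (Bs ! i) \<inter> rect (Bs ! j) = {}"
    by (auto simp: apart_def in_cbox_complex_iff)
qed

lemma layout_disjoint:
  assumes "layout A Bs" "B \<in> set Bs" "B' \<in> set Bs" "z \<in> rect B" "z \<in> rect B'"
  shows "B = B'"
proof -
  obtain i j where ij: "i < length Bs" "j < length Bs" "B = Bs!i" "B' = Bs!j"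
    using assms by (metis in_set_conv_nth)
  then have "i = j"
    using layout_rects(4)[OF assms(1), of i j] layout_rects(4)[OF assms(1), of j i] assms(4,5)
    by (metis IntI emptyE linorder_neqE_nat)
  then show ?thesis using ij by simp
qed

lemma edges_subset_body:
  assumes "layout A Bs" "B \<in> insert A (set Bs)"
  shows "edges B \<subseteq> drawing_body A Bs"
proof
  fix z assume z: "z \<in> edges B"
  have "box (fst B) (snd B) \<subseteq> rect B" for B :: rectangle
    by (rule box_subset_cbox)
  then show "z \<in> drawing_body A Bs"
    using assms z layout_rects(3)[OF assms(1)] layout_disjoint[OF assms(1)]
    unfolding drawing_body_def edges_eq by blast
qed

lemma body_decomposition:
  assumes "layout A Bs"
  shows "drawing_body A Bs = drawing_interior A Bs \<union> drawing_edges A Bs"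
    "drawing_interior A Bs \<inter> drawing_edges A Bs = {}"
    "open (drawing_interior A Bs)" "closed (drawing_body A Bs)"
proof -
  have sub: "box (fst B) (snd B) \<subseteq> rect B" for B :: rectangle
    by (rule box_subset_cbox)
  show "drawing_body A Bs = drawing_interior A Bs \<union> drawing_edges A Bs"
  proof
    show "drawing_body A Bs \<subseteq> drawing_interior A Bs \<union> drawing_edges A Bs"
      unfolding drawing_body_def drawing_interior_def drawing_edges_def edges_eq by blast
    have "drawing_interior A Bs \<subseteq> drawing_body A Bs"
      using sub unfolding drawing_body_def drawing_interior_def by blast
    then show "drawing_interior A Bs \<union> drawing_edges A Bs \<subseteq> drawing_body A Bs"
      using edges_subset_body[OF assms] unfolding drawing_edges_def by blast
  qed
  show "drawing_interior A Bs \<inter> drawing_edges A Bs = {}"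
    unfolding drawing_interior_def drawing_edges_def edges_eq by blast
  show "open (drawing_interior A Bs)"
    unfolding drawing_interior_def by (intro open_Diff closed_UN) auto
  show "closed (drawing_body A Bs)"
    unfolding drawing_body_def by (intro closed_Diff open_UN) auto
qed

text \<open>\<open>S\<close> and \<open>K\<close> are sets in the whole plane and are cut down to
  the body only here. Two drawings with the same \<open>S\<close> and \<open>K\<close> therefore
  agree automatically along a common box.\<close>

definition drawing :: "rectangle \<Rightarrow> rectangle list \<Rightarrow> complex set \<Rightarrow> complex set \<Rightarrow> tangle" where
  "drawing A Bs S K = Tangle (rectangle_box S A) (map (rectangle_box S) Bs)
     (drawing_body A Bs \<inter> S) (drawing_body A Bs \<inter> K - S)"

lemma rectangle_box_cong:
  assumes "edges B \<inter> S = edges B \<inter> S'"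
  shows "rectangle_box S B = rectangle_box S' B"
proof -
  have "edges B - S = edges B - S'" using assms by blast
  then show ?thesis by (simp add: rectangle_box_def split_def)
qed

lemma draw_eq_drawing:
  assumes "layout A Bs"
  shows "draw A Bs Rs = drawing A Bs (curves Rs) (shaded Rs)"
proof -
  let ?D = "drawing_body A Bs"
  have D: "(case A of (a, b) \<Rightarrow> cbox a b) - (\<Union>(a, b)\<in>set Bs. interior (cbox a b)) = ?D"
    by (simp add: drawing_body_def split_def)
  have "rectangle_box (?D \<inter> curves Rs) B = rectangle_box (curves Rs) B" if "B \<in> insert A (set Bs)" for B
    using edges_subset_body[OF assms that] by (intro rectangle_box_cong) blast
  then show ?thesis
    unfolding draw_def D drawing_def Let_def curves_def[symmetric]
    by (auto simp: shaded_def)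
qed

lemma drawing_cong:
  assumes "layout A Bs" "drawing_body A Bs \<inter> S = drawing_body A Bs \<inter> S'"
    "drawing_body A Bs \<inter> K - S = drawing_body A Bs \<inter> K' - S"
  shows "drawing A Bs S K = drawing A Bs S' K'"
proof -
  have "rectangle_box S B = rectangle_box S' B" if "B \<in> insert A (set Bs)" for B
    using edges_subset_body[OF assms(1) that] assms(2) by (intro rectangle_box_cong) blast
  moreover have "drawing_body A Bs \<inter> K - S = drawing_body A Bs \<inter> K' - S'"
    using assms by blast
  ultimately show ?thesis
    using assms unfolding drawing_def by auto
qed

lemma disc_rectangle_box [simp]: "disc (rectangle_box S B) = rect B"
  by (simp add: rectangle_box_def split_def)

lemma starred_rectangle_box:
  "starred (rectangle_box S B) =
     connected_component_set (edges B - S) (Complex (lft B) ((lo B + hi B) / 2))"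
  by (simp add: rectangle_box_def split_def)

lemma drawing_sel [simp]:
  "ext_box (drawing A Bs S K) = rectangle_box S A"
  "int_boxes (drawing A Bs S K) = map (rectangle_box S) Bs"
  "strings (drawing A Bs S K) = drawing_body A Bs \<inter> S"
  "black (drawing A Bs S K) = drawing_body A Bs \<inter> K - S"
  by (simp_all add: drawing_def)

lemma body_drawing [simp]: "body (drawing A Bs S K) = drawing_body A Bs"
  by (simp add: body_def drawing_body_def)

lemma open_body_drawing [simp]: "open_body (drawing A Bs S K) = drawing_interior A Bs"
  by (simp add: open_body_def drawing_interior_def)

lemma boxes_drawing: "boxes (drawing A Bs S K) = rectangle_box S ` insert A (set Bs)"
  by (simp add: boxes_def)

lemma marks_drawing:
  assumes "layout A Bs" "B \<in> insert A (set Bs)"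
  shows "marks (drawing A Bs S K) (rectangle_box S' B) = S \<inter> edges B"
  using edges_subset_body[OF assms] by (auto simp: marks_def)

subsection \<open>Substitution\<close>

text \<open>The bodies of the outer and the inner drawing overlap exactly in \<open>edges B\<close>,
  and their union is the body in which \<open>B\<close> has been replaced by \<open>Cs\<close>.
  Curves and shading are restrictions of the same two sets, so they agree on the overlap and unite
  to the restrictions to the new body.\<close>

lemma substitute_drawing:
  assumes "layout A (Bs @ B # Bs')" "layout B Cs"
  shows "layout A (Bs @ Cs @ Bs')"
    and "fits (drawing A (Bs @ B # Bs') S K) (length Bs) (drawing B Cs S K)"
    and "substitute (drawing A (Bs @ B # Bs') S K) (length Bs) (drawing B Cs S K) =
      drawing A (Bs @ Cs @ Bs') S K"
proof -
  have C: "nested C B" if "C \<in> set Cs" for C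
    using assms that by (auto simp: layout_def)
  have B: "nested B A"
    using assms by (auto simp: layout_def)
  show L: "layout A (Bs @ Cs @ Bs')"
  proof -
    have "nested C A" if "C \<in> set Cs" for C
      using C[OF that] B by (auto simp: nested_def)
    moreover have "apart B' C" if "apart B' B" "C \<in> set Cs" for B' C
      using C[OF that(2)] that(1) by (auto simp: nested_def apart_def)
    moreover have "apart C B'" if "apart B B'" "C \<in> set Cs" for B' C
      using C[OF that(2)] that(1) by (auto simp: nested_def apart_def)
    ultimately show ?thesis
      using assms unfolding layout_def sorted_wrt_append set_append list.set sorted_wrt.simps by blast
  qed
  have e: "edges B \<subseteq> drawing_body B Cs" "edges B \<subseteq> drawing_body A (Bs @ B # Bs')"
    using edges_subset_body assms by auto
  show "fits (drawing A (Bs @ B # Bs') S K) (length Bs) (drawing B Cs S K)"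
  proof -
    have "map (rectangle_box S) (Bs @ B # Bs') ! length Bs = rectangle_box S B"
      by (simp add: nth_append)
    then show ?thesis
      unfolding fits_def using e by (simp del: map_append) blast
  qed
  have "rect B \<inter> box (fst B') (snd B') = {}" if "B' \<in> set Bs \<union> set Bs'" for B'
  proof -
    have "apart B B' \<or> apart B' B"
      using assms(1) that by (auto simp: layout_def sorted_wrt_append)
    then show ?thesis
      by (auto simp: apart_def in_cbox_complex_iff in_box_complex_iff)
  qed
  moreover have "rect B \<subseteq> rect A" "box (fst B) (snd B) \<subseteq> rect B"
    using B by (auto simp: nested_def in_cbox_complex_iff in_box_complex_iff)
  moreover have "box (fst C) (snd C) \<subseteq> box (fst B) (snd B)" if "C \<in> set Cs" for C
    using C[OF that] by (auto simp: nested_def in_box_complex_iff)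
  ultimately have "drawing_body A (Bs @ B # Bs') \<union> drawing_body B Cs = drawing_body A (Bs @ Cs @ Bs')"
  proof -
    let ?X = "\<Union>B'\<in>set Bs \<union> set Bs'. box (fst B') (snd B')" and ?c = "\<Union>C\<in>set Cs. box (fst C) (snd C)"
    assume *: "\<And>B'. B' \<in> set Bs \<union> set Bs' \<Longrightarrow> rect B \<inter> box (fst B') (snd B') = {}"
      "rect B \<subseteq> rect A" "box (fst B) (snd B) \<subseteq> rect B"
      "\<And>C. C \<in> set Cs \<Longrightarrow> box (fst C) (snd C) \<subseteq> box (fst B) (snd B)"
    have "rect B \<inter> ?X = {}" "?c \<subseteq> box (fst B) (snd B)"
      using *(1,4) by blast+
    moreover have "(a - (X \<union> b)) \<union> (r - c) = a - (X \<union> c)"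
      if "r \<inter> X = {}" "r \<subseteq> a" "b \<subseteq> r" "c \<subseteq> b" for r X a b c :: "complex set"
      using that by blast
    ultimately have "(rect A - (?X \<union> box (fst B) (snd B))) \<union> (rect B - ?c) = rect A - (?X \<union> ?c)"
      using *(2,3) by presburger
    moreover have "(\<Union>B\<in>set (Bs @ B # Bs'). box (fst B) (snd B)) = ?X \<union> box (fst B) (snd B)"
      "(\<Union>B\<in>set (Bs @ Cs @ Bs'). box (fst B) (snd B)) = ?X \<union> ?c"
      by auto
    ultimately show ?thesis
      unfolding drawing_body_def by simp
  qed
  then have "drawing_body A (Bs @ Cs @ Bs') \<inter> X = drawing_body A (Bs @ B # Bs') \<inter> X \<union> drawing_body B Cs \<inter> X" for X
    by blast
  then show "substitute (drawing A (Bs @ B # Bs') S K) (length Bs) (drawing B Cs S K) =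
      drawing A (Bs @ Cs @ Bs') S K"
    unfolding substitute_def by (simp add: drawing_def Un_Diff)
qed

subsection \<open>Drawings are tangles\<close>

lemma near_edge:
  assumes L: "layout A Bs" and B: "B \<in> insert A (set Bs)"
    and p: "Im p = lo B \<or> Im p = hi B" "lft B < Re p" "Re p < rgt B"
  obtains e s where "e > 0" "s = 1 \<or> s = - 1"
    "\<And>z. z \<in> ball p e \<Longrightarrow> s * (Im z - Im p) > 0 \<Longrightarrow> z \<in> drawing_interior A Bs"
    "\<And>z. z \<in> ball p e \<Longrightarrow> s * (Im z - Im p) < 0 \<Longrightarrow> z \<notin> drawing_body A Bs"
proof -
  \<comment> \<open>A neighbourhood of \<open>p\<close> in which only the edge through
    \<open>p\<close> is visible: it lies strictly between the vertical sides of \<open>B\<close>,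
    stops before the opposite horizontal edge, avoids all other internal boxes, and stays inside
    \<open>A\<close> if \<open>B\<close> is internal.\<close>
  define V where "V = {z. lft B < Re z} \<inter> {z. Re z < rgt B} \<inter> {z. Im z < Im p + (hi B - lo B)} \<inter>
    {z. Im p - (hi B - lo B) < Im z} \<inter> - (\<Union>C\<in>set Bs - {B}. rect C) \<inter>
    (if B = A then UNIV else box (fst A) (snd A))"
  have pr: "proper A" "proper B"
    using B layout_rects(1,2)[OF L] by blast+
  then have pe: "p \<in> rect B"
    using p by (auto simp: in_cbox_complex_iff proper_def)
  have "open V"
    unfolding V_def
    by (intro open_Int open_Compl closed_UN open_halfspace_Re_lt open_halfspace_Re_gt
        open_halfspace_Im_lt open_halfspace_Im_gt) auto
  moreover have "p \<in> V"
  proof -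
    have "p \<notin> rect C" if "C \<in> set Bs" "C \<noteq> B" for C
    proof (cases "B = A")
      case True
      then have "p \<notin> box (fst A) (snd A)"
        using p by (auto simp: in_box_complex_iff)
      then show ?thesis using layout_rects(3)[OF L that(1)] by blast
    next
      case False
      then show ?thesis using layout_disjoint[OF L that(1), of B p] that B pe by blast
    qed
    moreover have "B \<noteq> A \<Longrightarrow> p \<in> box (fst A) (snd A)"
      using layout_rects(3)[OF L, of B] B pe by blast
    ultimately show ?thesis
      using p pr unfolding V_def by (auto simp: proper_def)
  qed
  ultimately obtain e where e: "e > 0" "ball p e \<subseteq> V"
    by (meson openE)
  have V: "lft B < Re z" "Re z < rgt B" "Im z < Im p + (hi B - lo B)" "Im p - (hi B - lo B) < Im z"
    "\<And>C. C \<in> set Bs \<Longrightarrow> C \<noteq> B \<Longrightarrow> z \<notin> rect C" "B \<noteq> A \<Longrightarrow> z \<in> box (fst A) (snd A)"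
    if "z \<in> ball p e" for z
    using that e(2) unfolding V_def by (auto split: if_splits)
  have A: "A \<notin> set Bs"
    using L by (auto simp: layout_def nested_def)
  \<comment> \<open>The direction in which the body lies: upwards from the lower edge of the
    external box or the upper edge of an internal one, downwards in the other two cases.\<close>
  define s :: real where "s = (if (Im p = lo B) = (B = A) then 1 else - 1)"
  have side: "Im z \<in> {lo B<..<hi B} \<longleftrightarrow> (B = A) = (s * (Im z - Im p) > 0)" "Im z \<notin> {lo B, hi B}"
    if "z \<in> ball p e" "s * (Im z - Im p) \<noteq> 0" for z
    using V(3,4)[OF that(1)] that(2) p(1) pr(2) by (auto simp: s_def proper_def)
  show thesis
  proof (rule that[OF e(1)])
    show "s = 1 \<or> s = - 1" by (simp add: s_def)
    fix z assume z: "z \<in> ball p e"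
    have box: "z \<in> box (fst B) (snd B) \<longleftrightarrow> Im z \<in> {lo B<..<hi B}"
      using V(1,2)[OF z] by (auto simp: in_box_complex_iff)
    note side = side[OF z]
    show "z \<in> drawing_interior A Bs" if sgn: "s * (Im z - Im p) > 0"
    proof (cases "B = A")
      case True
      then show ?thesis
        using box side[OF less_imp_neq[OF sgn, symmetric]] sgn V(5)[OF z] A unfolding drawing_interior_def by auto
    next
      case False
      then have "Im z \<notin> {lo B..hi B}" using side[OF less_imp_neq[OF sgn, symmetric]] sgn by auto
      then have "z \<notin> rect B" by (auto simp: in_cbox_complex_iff)
      then show ?thesis using V(5,6)[OF z] False unfolding drawing_interior_def by blast
    qed
    show "z \<notin> drawing_body A Bs" if sgn: "s * (Im z - Im p) < 0"
    proof (cases "B = A")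
      case True
      then have "Im z \<notin> {lo A..hi A}" using side[OF less_imp_neq[OF sgn]] sgn by auto
      then show ?thesis unfolding drawing_body_def by (auto simp: in_cbox_complex_iff)
    next
      case False
      then have "B \<in> set Bs" "z \<in> box (fst B) (snd B)" using B box side[OF less_imp_neq[OF sgn]] sgn False by auto
      then show ?thesis unfolding drawing_body_def by blast
    qed
  qed
qed

lemma crosses_edges:
  assumes "closed R" "crosses R B" "proper B" "z \<in> frontier R" "z \<in> edges B"
  shows "Im z = lo B \<or> Im z = hi B" "lft B < Re z" "Re z < rgt B"
    "\<exists>q\<in>interior R. Im q = Im z"
proof -
  have "z \<in> R" using assms by (simp add: frontier_def)
  have z: "z = Complex (Re z) (Im z)" by simp
  have y: "Im z \<in> {lo B..hi B}" "Re z \<in> {lft B..rgt B}"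
    using assms(5) by (auto simp: edges_eq in_cbox_complex_iff)
  have "Re z \<noteq> lft B" "Re z \<noteq> rgt B"
    using assms(2) y(1) \<open>z \<in> R\<close> assms(4) z unfolding crosses_def by metis+
  then show x: "Im z = lo B \<or> Im z = hi B" "lft B < Re z" "Re z < rgt B"
    using assms(3,5) y by (auto simp: in_edges_iff)
  then have "\<exists>x. Complex x (Im z) \<in> interior R"
    using assms(2,4) y(2) z unfolding crosses_def by (metis insertCI)
  then show "\<exists>q\<in>interior R. Im q = Im z"
    by (metis complex.sel(2))
qed

lemma frontier_local:
  fixes S T :: "'a::metric_space set"
  assumes "open U" "S \<inter> U = T \<inter> U" "x \<in> U"
  shows "x \<in> frontier S \<longleftrightarrow> x \<in> frontier T"
proof -
  have *: "x \<in> frontier T" if h: "S \<inter> U = T \<inter> U" "x \<in> frontier S" for S T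
    unfolding frontier_straddle
  proof (intro allI impI)
    fix e :: real assume "e > 0"
    obtain d where d: "d > 0" "ball x d \<subseteq> U"
      using assms by (meson openE)
    have "min d e > 0" using d \<open>e > 0\<close> by simp
    then obtain y y' where y: "y \<in> S" "dist x y < min d e" "y' \<notin> S" "dist x y' < min d e"
      using h(2) unfolding frontier_straddle by blast
    then have "y \<in> U" "y' \<in> U" using d by auto
    then show "(\<exists>y\<in>T. dist x y < e) \<and> (\<exists>y. y \<notin> T \<and> dist x y < e)"
      using y h(1) by (metis IntI IntD1 min_less_iff_conj)
  qed
  show ?thesis using *[OF assms(2)] *[OF assms(2)[symmetric]] by blast
qed

text \<open>Cutting a loop into arcs by \<open>path_pieces\<close> requires a base point outside the
  body; \<open>shiftpath\<close> moves the base point to wherever it is wanted.\<close>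

lemma loop_start_elsewhere:
  assumes "simple_path g" "pathfinish g = pathstart g" "q \<in> path_image g"
  obtains g' where "simple_path g'" "pathfinish g' = pathstart g'" "path_image g' = path_image g" "g' 0 = q" "g' 1 = q"
proof -
  obtain a where a: "a \<in> {0..1}" "q = g a"
    using assms(3) by (auto simp: path_image_def)
  show thesis
  proof
    show "simple_path (shiftpath a g)" "path_image (shiftpath a g) = path_image g"
      using a assms by (auto simp: simple_path_shiftpath path_image_shiftpath)
    show "pathfinish (shiftpath a g) = pathstart (shiftpath a g)" "shiftpath a g 0 = q" "shiftpath a g 1 = q"
      using a assms pathfinish_shiftpath[of a g] pathstart_shiftpath[of a g]
      by (auto simp: pathstart_def pathfinish_def)
  qed
qed

definition curve_piece :: "rectangle \<Rightarrow> rectangle list \<Rightarrow> complex set \<Rightarrow> bool" where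
  "curve_piece A Bs c \<longleftrightarrow>
     (\<exists>g. simple_path g \<and> pathfinish g = pathstart g \<and> c = path_image g \<and> c \<subseteq> drawing_interior A Bs) \<or>
     (\<exists>g. arc g \<and> c = path_image g \<and> {pathstart g, pathfinish g} \<subseteq> drawing_edges A Bs \<and>
        c - {pathstart g, pathfinish g} \<subseteq> drawing_interior A Bs)"

text \<open>Three facts are combined on a common ball around the crossing: the frontier is a graph
  over the vertical axis, so the path changes height monotonically, and the open part of the body is
  exactly one of the two sides of the edge. The path has to agree with the frontier of
  \<open>R\<close> only inside \<open>W\<close>, because an unbounded region is truncated far away
  before its frontier is parametrised.\<close>

lemma loop_crossing:
  assumes L: "layout A Bs" and R: "closed R" "convex R" "\<forall>B\<in>insert A (set Bs). crosses R B"
    and W: "open W" "rect A \<subseteq> W"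
    and g: "simple_path g" "path_image g \<inter> W = frontier R \<inter> W" and t: "t \<in> {0<..<1}" "g t \<in> drawing_edges A Bs"
  shows "\<exists>d>0. t - d > 0 \<and> t + d < 1 \<and>
       ((\<forall>s\<in>{t-d..<t}. g s \<in> drawing_interior A Bs) \<and> (\<forall>s\<in>{t<..t+d}. g s \<notin> drawing_body A Bs) \<or>
        (\<forall>s\<in>{t-d..<t}. g s \<notin> drawing_body A Bs) \<and> (\<forall>s\<in>{t<..t+d}. g s \<in> drawing_interior A Bs))"
proof -
  obtain B where B: "B \<in> insert A (set Bs)" "g t \<in> edges B"
    using t unfolding drawing_edges_def by blast
  have "drawing_body A Bs \<subseteq> rect A" by (auto simp: drawing_body_def)
  then have pW: "g t \<in> W"
    using edges_subset_body[OF L B(1)] B(2) W(2) by blast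
  have "g t \<in> path_image g" using t by (auto simp: path_image_def)
  then have p: "g t \<in> frontier R" using g pW by blast
  have "proper B" using B layout_rects(1,2)[OF L] by blast
  note edge = crosses_edges[OF R(1) bspec[OF R(3) B(1)] this p B(2)]
  then obtain q where q: "q \<in> interior R" "Im (g t) = Im q" by metis
  obtain e1 where e1: "e1 > 0" "inj_on Im (frontier R \<inter> ball (g t) e1)"
    using frontier_locally_graph[OF R(1,2) q(1) p q(2)] by blast
  obtain e2 \<sigma> where e2: "e2 > 0" and \<sigma>: "\<sigma> = 1 \<or> \<sigma> = - 1"
    "\<And>z. z \<in> ball (g t) e2 \<Longrightarrow> \<sigma> * (Im z - Im (g t)) > 0 \<Longrightarrow> z \<in> drawing_interior A Bs"
    "\<And>z. z \<in> ball (g t) e2 \<Longrightarrow> \<sigma> * (Im z - Im (g t)) < 0 \<Longrightarrow> z \<notin> drawing_body A Bs"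
    using near_edge[OF L B(1) edge(1,2,3)] by blast
  obtain e3 where e3: "e3 > 0" "ball (g t) e3 \<subseteq> W"
    using W(1) pW by (meson openE)
  define e where "e = min e1 (min e2 e3)"
  have e: "e > 0" "ball (g t) e \<subseteq> ball (g t) e1" "ball (g t) e \<subseteq> ball (g t) e2" "ball (g t) e \<subseteq> W"
    using e1 e2 e3 by (auto simp: e_def)
  have "inj_on Im (g ` {0..1} \<inter> ball (g t) e)"
    using e1(2) by (rule inj_on_subset) (use e g(2) in \<open>auto simp: path_image_def\<close>)
  moreover have "continuous_on {0..1} g"
    using g(1) by (simp add: simple_path_def path_def)
  moreover have "inj_on g {0<..<1}"
    using g(1) unfolding simple_path_def loop_free_def inj_on_def by fastforce
  moreover have "0 < t" "t < 1" using t by auto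
  ultimately obtain d where d: "d > 0" "t - d > 0" "t + d < 1" "g ` {t-d..t+d} \<subseteq> ball (g t) e"
    "(\<forall>s\<in>{t-d..<t}. Im (g s) < Im (g t)) \<and> (\<forall>s\<in>{t<..t+d}. Im (g s) > Im (g t)) \<or>
     (\<forall>s\<in>{t-d..<t}. Im (g s) > Im (g t)) \<and> (\<forall>s\<in>{t<..t+d}. Im (g s) < Im (g t))"
    using graph_crossing[of g t e] e(1) by blast
  have in2: "g s \<in> ball (g t) e2" if "s \<in> {t-d..t+d}" for s
    using d(4) e(3) that by blast
  have "(\<forall>s\<in>{t-d..<t}. \<sigma> * (Im (g s) - Im (g t)) > 0) \<and> (\<forall>s\<in>{t<..t+d}. \<sigma> * (Im (g s) - Im (g t)) < 0) \<or>
      (\<forall>s\<in>{t-d..<t}. \<sigma> * (Im (g s) - Im (g t)) < 0) \<and> (\<forall>s\<in>{t<..t+d}. \<sigma> * (Im (g s) - Im (g t)) > 0)"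
    using d(5) \<sigma>(1) by auto
  then show ?thesis
  proof (elim disjE conjE, goal_cases)
    case 1
    then show ?case
      using d(1) by (intro exI[of _ d] conjI d(1,2,3) disjI1 ballI \<sigma>(2,3) in2) auto
  next
    case 2
    then show ?case
      using d(1) by (intro exI[of _ d] conjI d(1,2,3) disjI2 ballI \<sigma>(2,3) in2) auto
  qed
qed

text \<open>Truncation by a large ball turns \<open>R\<close> into a compact convex set with the
  same frontier near the body, and this frontier is a loop. A loop that avoids all edges lies, being
  connected, either in the open part of the body or outside the body. A loop that meets an edge
  leaves the body there, so its base point can be moved outside and \<open>path_pieces\<close>
  applies.\<close>

lemma region_pieces:
  assumes L: "layout A Bs" and R: "closed R" "convex R" "interior R \<noteq> {}" "\<forall>B\<in>insert A (set Bs). crosses R B"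
  obtains C where "finite C" "pairwise disjnt C" "\<Union>C = frontier R \<inter> drawing_body A Bs"
    "\<And>c. c \<in> C \<Longrightarrow> curve_piece A Bs c"
proof -
  let ?I = "drawing_interior A Bs" and ?E = "drawing_edges A Bs" and ?D = "drawing_body A Bs"
  note D = body_decomposition[OF L]
  obtain o' where o: "o' \<in> interior R" using R(3) by blast
  have "bounded (insert o' (rect A))" by simp
  then obtain r where r: "insert o' (rect A) \<subseteq> ball 0 r"
    using bounded_subset_ballD by blast
  let ?W = "ball (0::complex) r"
  define R' where "R' = R \<inter> cball 0 r"
  have W: "open ?W" "rect A \<subseteq> ?W" using r by auto
  have R': "compact R'" "convex R'" "interior R' \<noteq> {}"
    using R o r by (auto simp: R'_def closed_Int_compact convex_Int)
  have "R' \<inter> ?W = R \<inter> ?W" by (auto simp: R'_def)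
  then have fr: "frontier R' \<inter> ?W = frontier R \<inter> ?W"
    using frontier_local[OF W(1)] by blast
  have DW: "?D \<subseteq> ?W" using W(2) by (auto simp: drawing_body_def)
  then have frD: "frontier R' \<inter> ?D = frontier R \<inter> ?D" using fr by blast
  obtain g0 where g0: "simple_path g0" "pathfinish g0 = pathstart g0" "path_image g0 = frontier R'"
    using frontier_simple_loop[OF R'] .
  show thesis
  proof (cases "frontier R' \<inter> ?E = {}")
    case True
    have "connected (frontier R')"
      using connected_path_image[OF simple_path_imp_path[OF g0(1)]] g0(3) by simp
    moreover have "frontier R' \<subseteq> ?I \<union> - ?D" using True D(1) by blast
    moreover have "open (- ?D)" using D(4) by (simp only: open_Compl)
    moreover have "?I \<inter> - ?D = {}" using D(1) by blast
    ultimately have "?I \<inter> frontier R' = {} \<or> - ?D \<inter> frontier R' = {}"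
      using connectedD[of "frontier R'" ?I "- ?D"] D(3) by blast
    then show thesis
    proof
      assume "?I \<inter> frontier R' = {}"
      then have "frontier R' \<inter> ?D = {}" using True D(1) by blast
      then show thesis using that[of "{}"] frD by simp
    next
      assume "- ?D \<inter> frontier R' = {}"
      then have "frontier R' \<subseteq> ?I" using True D(1) by blast
      moreover have "curve_piece A Bs (frontier R')"
        using calculation g0 unfolding curve_piece_def by blast
      moreover have "\<Union>{frontier R'} = frontier R \<inter> ?D" using calculation(1) frD D(1) by blast
      ultimately show thesis using that[of "{frontier R'}"] by (simp add: pairwise_def)
    qed
  next
    case False
    then obtain p where p: "p \<in> frontier R'" "p \<in> ?E" by blast
    \<comment> \<open>With the base point at some \<open>q\<close> other than \<open>p\<close>, the
      crossing at \<open>p\<close> happens at a time strictly between 0 and 1, as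
      \<open>loop_crossing\<close> demands.\<close>
    have "\<exists>q\<in>path_image g0. q \<noteq> p"
      using g0(1) connected_simple_path_image[OF g0(1)] simple_path_image_uncountable[OF g0(1)]
      by (metis countable_empty countable_insert countable_subset insertI1 subsetI)
    then obtain q where q: "q \<in> path_image g0" "q \<noteq> p" by blast
    obtain g1 where g1: "simple_path g1" "pathfinish g1 = pathstart g1" "path_image g1 = frontier R'" "g1 0 = q" "g1 1 = q"
      using loop_start_elsewhere[OF g0(1,2) q(1)] g0(3) by metis
    obtain t where t: "t \<in> {0..1}" "p = g1 t"
      using p(1) unfolding g1(3)[symmetric] path_image_def by blast
    have "t \<noteq> 0" "t \<noteq> 1"
      using t(2) q(2) g1(4,5) by auto
    then have "t \<in> {0<..<1}" using t(1) by auto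
    from loop_crossing[OF L R(1,2,4) W g1(1) _ this] t(2) p(2) fr g1(3)
    obtain d where d: "d > 0" "t - d > 0" "t + d < 1"
      "(\<forall>s\<in>{t-d..<t}. g1 s \<notin> ?D) \<or> (\<forall>s\<in>{t<..t+d}. g1 s \<notin> ?D)"
      by blast
    then have "g1 (t - d) \<notin> ?D \<or> g1 (t + d) \<notin> ?D"
      by auto
    moreover have "g1 (t - d) \<in> frontier R'" "g1 (t + d) \<in> frontier R'"
      using g1(3) d by (auto simp: path_image_def)
    ultimately obtain q' where q': "q' \<in> path_image g1" "q' \<notin> ?D"
      using g1(3) by blast
    obtain g where g: "simple_path g" "path_image g = frontier R'" "g 0 = q'" "g 1 = q'"
      using loop_start_elsewhere[OF g1(1,2) q'(1)] g1(3) by metis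
    have fin: "finite (path_image g \<inter> ?E)"
    proof -
      have "finite (frontier R \<inter> edges B)" if B: "B \<in> insert A (set Bs)" for B
      proof -
        have pr: "proper B" using B layout_rects(1,2)[OF L] by blast
        have "finite {z \<in> frontier R \<inter> edges B. Im z = y}" for y
        proof (cases "{z \<in> frontier R \<inter> edges B. Im z = y} = {}")
          case False
          then obtain z where z: "z \<in> frontier R" "z \<in> edges B" "Im z = y" by blast
          from crosses_edges(4)[OF R(1) bspec[OF R(4) B] pr z(1,2)]
          obtain u where "u \<in> interior R" "Im u = y" using z by auto
          then show ?thesis
            using finite_frontier_line[OF R(1,2), of u] by (auto elim: rev_finite_subset)
        qed (simp only: finite.emptyI)
        from this[of "lo B"] this[of "hi B"]
        have "finite ({z \<in> frontier R \<inter> edges B. Im z = lo B} \<union> {z \<in> frontier R \<inter> edges B. Im z = hi B})"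
          by (rule finite_UnI)
        then show ?thesis
          by (rule rev_finite_subset) (use crosses_edges(1)[OF R(1) bspec[OF R(4) B] pr] in blast)
      qed
      then have "finite (\<Union>B\<in>insert A (set Bs). frontier R \<inter> edges B)"
        by (intro finite_UN_I) auto
      moreover have "path_image g \<inter> ?E \<subseteq> (\<Union>B\<in>insert A (set Bs). frontier R \<inter> edges B)"
        using frD D(1) unfolding g(2) drawing_edges_def by blast
      ultimately show ?thesis by (rule rev_finite_subset)
    qed
    \<comment> \<open>A simple loop repeats only its base point, which now lies outside the
      body.\<close>
    have inj: "inj_on g {t\<in>{0..1}. g t \<in> ?I \<union> ?E}"
    proof (rule inj_onI)
      fix x y assume xy: "x \<in> {t\<in>{0..1}. g t \<in> ?I \<union> ?E}" "y \<in> {t\<in>{0..1}. g t \<in> ?I \<union> ?E}" "g x = g y"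
      then have "g x \<in> ?D" "g y \<in> ?D" using D(1) by blast+
      then have "x \<noteq> 0" "y \<noteq> 0" using g(3) q'(2) by metis+
      then show "x = y"
        using g(1) xy unfolding simple_path_def loop_free_def by fastforce
    qed
    obtain C where C: "finite C" "pairwise disjnt C" "\<Union>C = path_image g \<inter> (?I \<union> ?E)"
      "\<And>c. c \<in> C \<Longrightarrow> \<exists>h. arc h \<and> c = path_image h \<and> {pathstart h, pathfinish h} \<subseteq> ?E \<and>
       c - {pathstart h, pathfinish h} \<subseteq> ?I"
    proof (rule path_pieces[of g ?I ?E])
      show "path g" using g(1) by (simp add: simple_path_imp_path)
      show "g 0 \<notin> ?I \<union> ?E" "g 1 \<notin> ?I \<union> ?E" using g(3,4) q'(2) D(1) by auto
      show "open ?I" "closed (?I \<union> ?E)" "?I \<inter> ?E = {}" using D by auto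
      show "inj_on g {t\<in>{0..1}. g t \<in> ?I \<union> ?E}" by (rule inj)
      show "finite (path_image g \<inter> ?E)" by (rule fin)
      show "\<exists>d>0. t - d > 0 \<and> t + d < 1 \<and> ((\<forall>s\<in>{t-d..<t}. g s \<in> ?I) \<and> (\<forall>s\<in>{t<..t+d}. g s \<notin> ?I \<union> ?E) \<or>
        (\<forall>s\<in>{t-d..<t}. g s \<notin> ?I \<union> ?E) \<and> (\<forall>s\<in>{t<..t+d}. g s \<in> ?I))"
        if "t \<in> {0<..<1}" "g t \<in> ?E" for t
        using loop_crossing[OF L R(1,2,4) W g(1) _ that] fr unfolding g(2) D(1) by blast
    qed blast
    show thesis
    proof (rule that[OF C(1,2)])
      show "\<Union> C = frontier R \<inter> ?D" using C(3) frD unfolding g(2) D(1) by simp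
      show "curve_piece A Bs c" if "c \<in> C" for c
        using C(4)[OF that] unfolding curve_piece_def by blast
    qed
  qed
qed

text \<open>An arc is connected with more than one point and so has no isolated points; removing its
  two endpoints does not shrink its closure.\<close>

lemma curve_piece_closure:
  assumes "curve_piece A Bs c"
  shows "c \<subseteq> closure (c \<inter> drawing_interior A Bs)"
  using assms unfolding curve_piece_def
proof (elim disjE exE conjE)
  fix g assume "c \<subseteq> drawing_interior A Bs"
  then show ?thesis by (simp add: closure_subset Int_absorb2)
next
  fix g assume g: "arc g" "c = path_image g" "c - {pathstart g, pathfinish g} \<subseteq> drawing_interior A Bs"
  show ?thesis
  proof
    fix x assume x: "x \<in> c"
    have "connected c" using g by (simp add: connected_arc_image)
    moreover have "c \<noteq> {y}" for y
      using g arc_distinct_ends[OF g(1)] pathstart_in_path_image[of g] pathfinish_in_path_image[of g] by auto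
    ultimately have "x islimpt c" using x by (simp add: connected_imp_perfect)
    moreover have "c \<subseteq> {pathstart g, pathfinish g} \<union> (c - {pathstart g, pathfinish g})" by blast
    ultimately have "x islimpt ({pathstart g, pathfinish g} \<union> (c - {pathstart g, pathfinish g}))"
      by (rule islimpt_subset)
    then have "x islimpt (c - {pathstart g, pathfinish g})"
      using islimpt_Un_finite[of "{pathstart g, pathfinish g}"] by blast
    then have "x islimpt (c \<inter> drawing_interior A Bs)"
      by (rule islimpt_subset) (use g(3) in blast)
    then show "x \<in> closure (c \<inter> drawing_interior A Bs)"
      by (simp add: closure_def)
  qed
qed

section \<open>Local behaviour of the shading\<close>

lemma closed_curves: "closed (curves Rs)"
  unfolding curves_def by (intro closed_UN) auto

lemma ball_same_side:
  fixes R :: "complex set"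
  assumes "ball z e \<inter> frontier R = {}" "w \<in> ball z e" "w' \<in> ball z e"
  shows "w \<in> R \<longleftrightarrow> w' \<in> R"
  using connected_Int_frontier[of "ball z e" R] assms by blast

lemma shaded_locally_constant:
  assumes "ball z e \<inter> curves Rs = {}" "w \<in> ball z e" "w' \<in> ball z e"
  shows "w \<in> shaded Rs \<longleftrightarrow> w' \<in> shaded Rs"
proof -
  have "filter (\<lambda>R. w \<in> R) Rs = filter (\<lambda>R. w' \<in> R) Rs"
    using ball_same_side[OF _ assms(2,3)] assms(1) by (intro filter_cong) (auto simp: curves_def)
  then show ?thesis by (simp add: shaded_def)
qed

lemma open_shaded: "open (shaded Rs - curves Rs)" "open (- shaded Rs - curves Rs)"
proof -
  have "\<exists>e>0. ball z e \<inter> curves Rs = {}" if z: "z \<notin> curves Rs" for z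
  proof -
    have "open (- curves Rs)" using closed_curves by (simp only: open_Compl)
    moreover have "z \<in> - curves Rs" using z by simp
    ultimately obtain e where "e > 0" "ball z e \<subseteq> - curves Rs" by (rule openE)
    then show ?thesis by blast
  qed
  then have *: "\<exists>e>0. \<forall>w\<in>ball z e. w \<notin> curves Rs \<and> (w \<in> shaded Rs \<longleftrightarrow> z \<in> shaded Rs)"
    if z: "z \<notin> curves Rs" for z
  proof -
    obtain e where e: "e > 0" "ball z e \<inter> curves Rs = {}"
      using \<open>\<And>z. z \<notin> curves Rs \<Longrightarrow> \<exists>e>0. ball z e \<inter> curves Rs = {}\<close> z by blast
    then have "z \<in> ball z e" by simp
    then show ?thesis
      using e shaded_locally_constant[OF e(2)] by blast
  qed
  show "open (shaded Rs - curves Rs)" "open (- shaded Rs - curves Rs)"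
    unfolding open_contains_ball subset_eq
    by (metis (no_types, lifting) * DiffD1 DiffD2 DiffI,
        metis (no_types, lifting) * DiffD1 DiffD2 DiffI ComplD ComplI)
qed

text \<open>The frontiers are disjoint, so near \<open>p\<close> only the frontier of one region
  \<open>R\<close> is visible and membership in every other region is constant. Passing from the
  interior of \<open>R\<close> to its complement changes the number of regions containing the point
  by one, hence its parity.\<close>

lemma curves_both_sides:
  assumes "regions Rs" "p \<in> curves Rs"
  shows "p \<in> closure (shaded Rs - curves Rs)" "p \<in> closure (- shaded Rs - curves Rs)"
proof -
  obtain R where R: "R \<in> set Rs" "p \<in> frontier R" using assms(2) by (auto simp: curves_def)
  then obtain xs ys where Rs: "Rs = xs @ R # ys" by (meson split_list)
  have cl: "closed R" "convex R" "interior R \<noteq> {}" using assms(1) R(1) by (auto simp: regions_def)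
  have "closed (curves (xs @ ys))" by (rule closed_curves)
  then have "open (- curves (xs @ ys))" by (simp only: open_Compl)
  moreover have "p \<notin> curves (xs @ ys)"
    using assms(1) R(2) unfolding Rs regions_def sorted_wrt_append curves_def by auto
  ultimately obtain d where d: "d > 0" "ball p d \<subseteq> - curves (xs @ ys)" by (auto elim: openE)
  have *: "\<exists>u v. u \<in> ball p e \<and> v \<in> ball p e \<and> u \<in> shaded Rs - curves Rs \<and> v \<in> - shaded Rs - curves Rs"
    if e: "e > 0" "e \<le> d" for e
  proof -
    have be: "ball p e \<inter> curves (xs @ ys) = {}" using d(2) e by (metis (no_types) disjoint_eq_subset_Compl subset_ball subset_trans)
    have "p \<in> closure (interior R)"
      using R(2) cl convex_closure_interior[OF cl(2,3)] by (simp add: frontier_def)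
    then obtain u where u: "u \<in> interior R" "u \<in> ball p e"
      using e(1) unfolding closure_approachable by (metis dist_commute mem_ball)
    obtain v where v: "v \<notin> R" "v \<in> ball p e"
      using R(2) e(1) unfolding frontier_straddle by (metis mem_ball)
    have "u \<notin> curves Rs" "v \<notin> curves Rs"
      using u v be cl(1) unfolding Rs curves_def by (auto simp: frontier_def)
    moreover have "u \<in> R'  \<longleftrightarrow> v \<in> R'" if "R' \<in> set xs \<union> set ys" for R'
      by (rule ball_same_side[of p e]) (use be that u v in \<open>auto simp: curves_def\<close>)
    then have "filter (\<lambda>R. u \<in> R) xs = filter (\<lambda>R. v \<in> R) xs" "filter (\<lambda>R. u \<in> R) ys = filter (\<lambda>R. v \<in> R) ys"
      by (auto intro!: filter_cong)
    then have "u \<in> shaded Rs \<longleftrightarrow> v \<notin> shaded Rs"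
      using u(1) v(1) interior_subset[of R] by (auto simp: shaded_def Rs)
    ultimately show ?thesis using u(2) v(2) by blast
  qed
  show "p \<in> closure (shaded Rs - curves Rs)" "p \<in> closure (- shaded Rs - curves Rs)"
    unfolding closure_approachable using *[of "min d _"] d(1)
    by (metis dist_commute mem_ball min.cobounded1 min_less_iff_conj)+
qed

lemma tangle_drawing:
  assumes L: "layout A Bs" and Rs: "regions Rs" and cr: "\<forall>B\<in>insert A (set Bs). \<forall>R\<in>set Rs. crosses R B"
    and ev: "\<forall>B\<in>insert A (set Bs). even (card (curves Rs \<inter> edges B))"
  shows "tangle (drawing A Bs (curves Rs) (shaded Rs))"
proof -
  let ?S = "curves Rs" and ?K = "shaded Rs" and ?D = "drawing_body A Bs" and ?I = "drawing_interior A Bs"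
  let ?T = "drawing A Bs ?S ?K"
  note D = body_decomposition[OF L]
  have pr: "proper B" if "B \<in> insert A (set Bs)" for B
    using that layout_rects(1,2)[OF L] by blast
  have "\<exists>C. finite C \<and> pairwise disjnt C \<and> \<Union>C = frontier R \<inter> ?D \<and> (\<forall>c\<in>C. curve_piece A Bs c)"
    if "R \<in> set Rs" for R
    using region_pieces[OF L, of R] Rs cr that unfolding regions_def by metis
  then obtain C where C: "\<And>R. R \<in> set Rs \<Longrightarrow> finite (C R)" "\<And>R. R \<in> set Rs \<Longrightarrow> pairwise disjnt (C R)"
    "\<And>R. R \<in> set Rs \<Longrightarrow> \<Union>(C R) = frontier R \<inter> ?D"
    "\<And>R c. R \<in> set Rs \<Longrightarrow> c \<in> C R \<Longrightarrow> curve_piece A Bs c" by metis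
  let ?C = "\<Union>R\<in>set Rs. C R"
  have CS: "\<Union>?C = ?D \<inter> ?S"
    using C(3) unfolding curves_def by blast
  have "pairwise disjnt ?C"
  proof (rule pairwiseI)
    fix c c' assume c: "c \<in> ?C" "c' \<in> ?C" "c \<noteq> c'"
    then obtain R R' where R: "R \<in> set Rs" "c \<in> C R" "R' \<in> set Rs" "c' \<in> C R'" by blast
    show "disjnt c c'"
    proof (cases "R = R'")
      case True
      then show ?thesis using C(2)[OF R(1)] R c(3) by (auto simp: pairwise_def)
    next
      case False
      then have "frontier R \<inter> frontier R' = {}"
        using Rs R(1,3) unfolding regions_def sorted_wrt_iff_nth_less in_set_conv_nth
        by (metis inf_commute linorder_neqE_nat)
      moreover have "c \<subseteq> frontier R" "c' \<subseteq> frontier R'" using C(3)[OF R(1)] C(3)[OF R(3)] R by blast+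
      ultimately show ?thesis by (auto simp: disjnt_def)
    qed
  qed
  moreover have "finite ?C" using C(1) by blast
  moreover have "closed_curve_in ?T c \<or> arc_in ?T c" if "c \<in> ?C" for c
  proof -
    have "curve_piece A Bs c" using that C(4) by blast
    then show ?thesis
      unfolding curve_piece_def closed_curve_in_def arc_in_def boxes_drawing drawing_edges_def by simp
  qed
  ultimately have curves: "\<exists>C. finite C \<and> pairwise disjnt C \<and> \<Union>C = strings ?T \<and>
        (\<forall>c\<in>C. closed_curve_in ?T c \<or> arc_in ?T c)"
    using CS by (intro exI[of _ ?C]) auto
  \<comment> \<open>The body is not open along the edges. Since every point of the strings is a
    limit of points of the strings in the open part, it is enough to approach the latter, and near
    these, approaching in the plane and approaching within the body are the same.\<close>
  have dense: "?D \<inter> ?S \<subseteq> closure (?I \<inter> ?S)"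
  proof -
    have "c \<subseteq> closure (?I \<inter> ?S)" if "c \<in> ?C" for c
    proof -
      have "c \<subseteq> ?S" using CS that by blast
      then have "closure (c \<inter> ?I) \<subseteq> closure (?I \<inter> ?S)" by (intro closure_mono) blast
      moreover have "c \<subseteq> closure (c \<inter> ?I)" using that C(4) curve_piece_closure by blast
      ultimately show ?thesis by blast
    qed
    then show ?thesis using CS by blast
  qed
  have white: "white ?T = ?D \<inter> (- ?K - ?S)"
    by (auto simp: white_def)
  have "?I \<subseteq> ?D" using D(1) by blast
  have sides: "?D \<inter> ?S \<subseteq> closure (?D \<inter> X)" if "?S \<subseteq> closure X" for X
  proof -
    have "?I \<inter> ?S \<subseteq> closure (?I \<inter> X)"
      using open_Int_closure_subset[OF D(3), of X] that by blast
    also have "\<dots> \<subseteq> closure (?D \<inter> X)" using \<open>?I \<subseteq> ?D\<close> by (intro closure_mono) blast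
    finally have "closure (?I \<inter> ?S) \<subseteq> closure (?D \<inter> X)" by (rule closure_minimal) simp
    then show ?thesis using dense by blast
  qed
  have "?S \<subseteq> closure (?K - ?S)" "?S \<subseteq> closure (- ?K - ?S)"
    using curves_both_sides[OF Rs] by blast+
  then have chequer: "strings ?T \<subseteq> closure (black ?T) \<inter> closure (white ?T)"
    using sides[of "?K - ?S"] sides[of "- ?K - ?S"] unfolding white by (simp add: Diff_eq Int_assoc)
  have op: "openin (top_of_set (body ?T - strings ?T)) (black ?T)"
  proof -
    have "black ?T = (body ?T - strings ?T) \<inter> (?K - ?S)" by auto
    then show ?thesis using open_shaded(1) openin_open_Int by metis
  qed
  have clo: "closedin (top_of_set (body ?T - strings ?T)) (black ?T)"
  proof -
    have "black ?T = (body ?T - strings ?T) \<inter> - (- ?K - ?S)" by auto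
    moreover have "closed (- (- ?K - ?S))" using open_shaded(2) by (simp only: closed_Compl)
    ultimately show ?thesis using closedin_closed_Int by metis
  qed
  \<comment> \<open>The midpoint of the left side lies in no region, hence is white, and a connected
    set without points of the curves cannot change colour.\<close>
  have star: "starred (rectangle_box ?S B) \<in> components (edges B - strings ?T) \<and>
      starred (rectangle_box ?S B) \<subseteq> white ?T" if B: "B \<in> insert A (set Bs)" for B
  proof
    let ?m = "Complex (lft B) ((lo B + hi B) / 2)"
    have "?m \<notin> R" if "R \<in> set Rs" for R
    proof -
      have "crosses R B" using cr B that by blast
      then show ?thesis using pr[OF B] unfolding crosses_def proper_def by simp
    qed
    then have m: "?m \<notin> ?S" "?m \<notin> ?K"
      using Rs frontier_subset_closed unfolding curves_def shaded_def regions_def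
      by (blast, simp add: filter_False)
    have "?m \<in> edges B" using pr[OF B] by (auto simp: in_edges_iff proper_def)
    moreover have eq: "edges B - strings ?T = edges B - ?S" using edges_subset_body[OF L B] by auto
    ultimately show "starred (rectangle_box ?S B) \<in> components (edges B - strings ?T)"
      unfolding starred_rectangle_box eq using m by (intro componentsI) auto
    let ?X = "connected_component_set (edges B - ?S) ?m"
    have X: "?X \<subseteq> edges B - ?S" "connected ?X" "?m \<in> ?X"
      using \<open>?m \<in> edges B\<close> m by (auto simp: connected_component_subset connected_component_refl_eq)
    have "?X \<subseteq> (?K - ?S) \<union> (- ?K - ?S)" "(?K - ?S) \<inter> (- ?K - ?S) \<inter> ?X = {}" using X(1) by blast+
    then have "(?K - ?S) \<inter> ?X = {}"
      using connectedD[OF X(2) open_shaded(1) open_shaded(2)] X(3) m by blast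
    then show "starred (rectangle_box ?S B) \<subseteq> white ?T"
      unfolding starred_rectangle_box white using X(1) edges_subset_body[OF L B] by blast
  qed
  show ?thesis
    unfolding tangle_def
  proof (intro conjI)
    show "\<forall>b\<in>boxes ?T. disc b homeomorphic cball (0::complex) 1"
    proof
      fix b assume "b \<in> boxes ?T"
      then obtain B where B: "B \<in> insert A (set Bs)" "b = rectangle_box ?S B" unfolding boxes_drawing by blast
      have "Complex ((lft B + rgt B)/2) ((lo B + hi B)/2) \<in> box (fst B) (snd B)"
        using pr[OF B(1)] by (auto simp: in_box_complex_iff proper_def)
      then have "interior (rect B) \<noteq> {}" by auto
      then show "disc b homeomorphic cball (0::complex) 1"
        unfolding B(2) disc_rectangle_box
        by (intro homeomorphic_convex_compact_cball) auto
    qed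
    show "\<forall>b\<in>set (int_boxes ?T). disc b \<subseteq> interior (disc (ext_box ?T))"
      using layout_rects(3)[OF L] by auto
    show "\<forall>i j. i < j \<and> j < length (int_boxes ?T) \<longrightarrow> disc (int_boxes ?T ! i) \<inter> disc (int_boxes ?T ! j) = {}"
      using layout_rects(4)[OF L] by simp
    show "\<forall>b\<in>boxes ?T. even (card (marks ?T b))"
      unfolding boxes_drawing using ev marks_drawing[OF L] by (metis (no_types, lifting) imageE)
    show "strings ?T \<subseteq> closure (black ?T) \<inter> closure (white ?T)" by (rule chequer)
    show "\<forall>b\<in>boxes ?T. starred b \<in> components (frontier (disc b) - strings ?T) \<and>
        (marks ?T b \<noteq> {} \<longrightarrow> starred b \<subseteq> white ?T)"
      unfolding boxes_drawing using star by auto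
  qed (use curves op clo in blast)+
qed

text \<open>The midpoint of the left side lies in no region and is not black, so the case
  \<open>Zero_minus\<close> of \<open>box_colour\<close> cannot occur, even for a box without marked
  points.\<close>

lemma box_colour_drawing:
  assumes L: "layout A Bs" and Rs: "regions Rs" and cr: "\<forall>R\<in>set Rs. crosses R B" and B: "B \<in> insert A (set Bs)"
    and n: "card (curves Rs \<inter> edges B) = 2 * n"
  shows "box_colour (drawing A Bs (curves Rs) (shaded Rs)) (rectangle_box S B) = Col n"
proof -
  let ?m = "Complex (lft B) ((lo B + hi B) / 2)"
  have pr: "proper B" using B layout_rects(1,2)[OF L] by blast
  have "?m \<notin> R" if "R \<in> set Rs" for R
    using cr that pr unfolding crosses_def proper_def by simp
  then have "?m \<notin> shaded Rs" by (simp add: shaded_def filter_False)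
  moreover have "?m \<in> edges B" using pr by (auto simp: in_edges_iff proper_def)
  ultimately have "\<not> edges B \<subseteq> black (drawing A Bs (curves Rs) (shaded Rs))" by auto
  then show ?thesis
    unfolding box_colour_def marks_drawing[OF L B] using n by simp
qed

section \<open>Grid isotopies\<close>

definition increasing_homeo :: "(real \<Rightarrow> real) \<Rightarrow> bool" where
  "increasing_homeo f \<longleftrightarrow> strict_mono f \<and> continuous_on UNIV f \<and> surj f"

definition grid_map :: "(real \<Rightarrow> real) \<Rightarrow> (real \<Rightarrow> real) \<Rightarrow> complex \<Rightarrow> complex" where
  "grid_map f g z = Complex (f (Re z)) (g (Im z))"

abbreviation grid_rect :: "(real \<Rightarrow> real) \<Rightarrow> (real \<Rightarrow> real) \<Rightarrow> rectangle \<Rightarrow> rectangle" where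
  "grid_rect f g B \<equiv> (grid_map f g (fst B), grid_map f g (snd B))"

lemma grid_map_sel [simp]: "Re (grid_map f g z) = f (Re z)" "Im (grid_map f g z) = g (Im z)"
  by (simp_all add: grid_map_def)

lemma increasing_homeo_less:
  assumes "increasing_homeo f"
  shows "f x < f y \<longleftrightarrow> x < y" "f x \<le> f y \<longleftrightarrow> x \<le> y" "f x = f y \<longleftrightarrow> x = y"
  using assms by (auto simp: increasing_homeo_def strict_mono_less strict_mono_less_eq strict_mono_eq)

lemma increasing_homeo_affine:
  assumes "c > 0"
  shows "increasing_homeo (\<lambda>x. c * x + d)"
proof -
  have "\<exists>x. y = c * x + d" for y
    using assms by (intro exI[of _ "(y - d) / c"]) simp
  then show ?thesis
    using assms by (auto simp: increasing_homeo_def strict_mono_def surj_def intro!: continuous_intros)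
qed

lemma increasing_homeo_glue:
  assumes "increasing_homeo f" "increasing_homeo g" "f p = g p"
  shows "increasing_homeo (\<lambda>x. if x \<le> p then f x else g x)"
  unfolding increasing_homeo_def
proof (intro conjI)
  note f = increasing_homeo_less[OF assms(1)] and g = increasing_homeo_less[OF assms(2)]
  show "strict_mono (\<lambda>x. if x \<le> p then f x else g x)"
  proof (rule strict_monoI)
    fix x y :: real assume "x < y"
    then show "(if x \<le> p then f x else g x) < (if y \<le> p then f y else g y)"
      using f(1)[of x y] g(1)[of x y] f(2)[of x p] g(1)[of p y] assms(3) by auto
  qed
  have "continuous_on ({..p} \<union> {p..}) (\<lambda>x. if x \<le> p then f x else g x)"
    using assms unfolding increasing_homeo_def
    by (intro continuous_on_cases) (auto elim: continuous_on_subset)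
  moreover have "{..p} \<union> {p..} = (UNIV :: real set)" by auto
  ultimately show "continuous_on UNIV (\<lambda>x. if x \<le> p then f x else g x)" by simp
  show "surj (\<lambda>x. if x \<le> p then f x else g x)"
    unfolding surj_def
  proof
    fix y
    obtain a b where "y = f a" "y = g b"
      using assms unfolding increasing_homeo_def surj_def by metis
    then show "\<exists>x. y = (if x \<le> p then f x else g x)"
      using f(2)[of a p] g(2)[of b p] assms(3) by (cases "y \<le> f p") force+
  qed
qed

text \<open>Piecewise affine interpolation: the induction glues the affine piece through the first
  two points to the function found for the remaining ones.\<close>

lemma increasing_homeo_through:
  assumes "xs \<noteq> []" "length xs = length ys" "sorted_wrt (<) xs" "sorted_wrt (<) ys"
  obtains f where "increasing_homeo f" "map f xs = ys"
proof -
  have "\<exists>f. increasing_homeo f \<and> map f xs = ys"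
    using assms
  proof (induction xs arbitrary: ys rule: induct_list012)
    case (2 x)
    then obtain y where "ys = [y]" by (metis length_0_conv length_Suc_conv)
    then show ?case
      using increasing_homeo_affine[of 1 "y - x"] by (intro exI[of _ "\<lambda>t. 1 * t + (y - x)"]) simp
  next
    case (3 x x' xs)
    then obtain y y' zs where ys: "ys = y # y' # zs"
      by (metis length_Suc_conv)
    have "\<exists>f. increasing_homeo f \<and> map f (x' # xs) = y' # zs"
      by (rule "3.IH"(2)) (use "3.prems" ys in simp_all)
    then obtain f where "increasing_homeo f \<and> map f (x' # xs) = y' # zs" ..
    note f = conjunct1[OF this] conjunct2[OF this]
    have less: "x < x'" "y < y'" using "3.prems" unfolding ys by simp_all
    define c where "c = (y' - y) / (x' - x)"
    have c: "c > 0" "c * (x' - x) = y' - y" using less by (auto simp: c_def)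
    define g where "g = (\<lambda>t. if t \<le> x' then c * t + (y' - c * x') else f t)"
    have "increasing_homeo g"
      unfolding g_def using f c(1) by (intro increasing_homeo_glue increasing_homeo_affine) auto
    moreover have "g x = y" "g x' = y'"
      using less c by (auto simp: algebra_simps g_def)
    moreover have "map g xs = map f xs"
      using "3.prems"(3) by (intro map_cong) (auto simp: g_def)
    ultimately show ?case
      using f(2) unfolding ys list.map by (metis list.inject)
  qed simp
  then show thesis using that by blast
qed

text \<open>The straight path from the identity to \<open>f\<close>. It stays among the increasing
  homeomorphisms, which makes every grid map the end of an ambient isotopy.\<close>

definition blend :: "real \<Rightarrow> (real \<Rightarrow> real) \<Rightarrow> real \<Rightarrow> real" where
  "blend t f x = (1 - t) * x + t * f x"

lemma increasing_homeo_blend: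
  assumes f: "increasing_homeo f" and t: "0 \<le> t" "t \<le> 1"
  shows "increasing_homeo (blend t f)"
  unfolding increasing_homeo_def
proof (intro conjI)
  have fc: "continuous_on UNIV f" using f by (simp add: increasing_homeo_def)
  show mono: "strict_mono (blend t f)"
  proof (rule strict_monoI)
    fix x y :: real assume xy: "x < y"
    then have fxy: "f x < f y" using increasing_homeo_less(1)[OF f] by simp
    show "blend t f x < blend t f y"
    proof (cases "t = 0")
      case False
      then have "t * f x < t * f y" using fxy t by simp
      moreover have "(1 - t) * x \<le> (1 - t) * y" using xy t by (intro mult_left_mono) auto
      ultimately show ?thesis unfolding blend_def by linarith
    qed (use xy in \<open>simp add: blend_def\<close>)
  qed
  show cont: "continuous_on UNIV (blend t f)"
    unfolding blend_def by (intro continuous_intros fc)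
  show "surj (blend t f)"
    unfolding surj_def
  proof
    fix y
    obtain x where x: "f x = y" using f unfolding increasing_homeo_def surj_def by metis
    \<comment> \<open>At \<open>a\<close> both the identity and \<open>f\<close> are at most
      \<open>y\<close>, at \<open>b\<close> both are at least \<open>y\<close>, so the same holds
      for their convex combination; the intermediate value theorem gives the preimage.\<close>
    define a b where "a = min x y" and "b = max x y"
    have "f a \<le> y" "a \<le> y" "y \<le> f b" "y \<le> b"
      using x increasing_homeo_less(2)[OF f] by (auto simp: a_def b_def)
    then have "(1 - t) * a + t * f a \<le> (1 - t) * y + t * y" "(1 - t) * y + t * y \<le> (1 - t) * b + t * f b"
      using t by (intro add_mono mult_left_mono; simp)+
    then have "blend t f a \<le> y" "y \<le> blend t f b"
      by (auto simp: blend_def algebra_simps)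
    moreover have "a \<le> b" by (auto simp: a_def b_def)
    ultimately show "\<exists>x. y = blend t f x"
      using IVT'[of "blend t f" a y b] cont continuous_on_subset by (metis subset_UNIV)
  qed
qed

lemma grid_map_homeomorphism:
  assumes "increasing_homeo f" "increasing_homeo g"
  obtains h where "homeomorphism UNIV UNIV (grid_map f g) h"
proof -
  have "f x = f y \<longleftrightarrow> x = y" "g x = g y \<longleftrightarrow> x = y" for x y
    using assms by (auto simp: increasing_homeo_less)
  then have "inj (grid_map f g)" by (auto simp: inj_on_def complex_eq_iff)
  moreover have cf: "continuous_on UNIV f" "continuous_on UNIV g"
    using assms by (auto simp: increasing_homeo_def)
  have "continuous_on UNIV (\<lambda>z. Complex (f (Re z)) (g (Im z)))"
    by (intro continuous_intros continuous_on_compose2[OF cf(1)] continuous_on_compose2[OF cf(2)]) auto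
  then have "continuous_on UNIV (grid_map f g)"
    unfolding grid_map_def[abs_def] .
  moreover have "range (grid_map f g) = UNIV"
  proof (intro equalityI subsetI UNIV_I)
    fix z :: complex
    obtain x y where "f x = Re z" "g y = Im z"
      using assms unfolding increasing_homeo_def surj_def by metis
    then have "z = grid_map f g (Complex x y)" by (simp add: complex_eq_iff)
    then show "z \<in> range (grid_map f g)" by blast
  qed
  ultimately show thesis
    using invariance_of_domain_homeomorphism[of UNIV "grid_map f g"] that by auto
qed

lemma isotopic_grid_map:
  assumes f: "increasing_homeo f" and g: "increasing_homeo g"
  shows "isotopic T (transform (grid_map f g) T)"
proof -
  let ?h = "\<lambda>t. grid_map (blend t f) (blend t g)"
  have cf: "continuous_on UNIV f" "continuous_on UNIV g"
    using assms by (auto simp: increasing_homeo_def)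
  have "continuous_on ({0..1} \<times> UNIV) (\<lambda>p. Complex ((1 - fst p) * Re (snd p) + fst p * f (Re (snd p)))
     ((1 - fst p) * Im (snd p) + fst p * g (Im (snd p))))"
    by (intro continuous_intros continuous_on_compose2[OF cf(1)] continuous_on_compose2[OF cf(2)]) auto
  then have "continuous_on ({0..1} \<times> UNIV) (\<lambda>(t, x). ?h t x)"
    by (simp add: grid_map_def blend_def split_def)
  moreover have "\<exists>h'. homeomorphism UNIV UNIV (?h t) h'" if "t \<in> {0..1}" for t
    using grid_map_homeomorphism[of "blend t f" "blend t g"] that increasing_homeo_blend f g
    by (metis atLeastAtMost_iff)
  moreover have "?h 0 x = x" for x by (simp add: blend_def complex_eq_iff)
  ultimately have "ambient_isotopy UNIV ?h" by (simp add: ambient_isotopy_def)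
  moreover have "blend 1 h = h" for h by (simp add: blend_def fun_eq_iff)
  then have "?h 1 = grid_map f g" by simp
  ultimately show ?thesis unfolding isotopic_def by metis
qed

section \<open>Images of frontiers, components and drawings\<close>

lemma homeomorphism_image_frontier:
  fixes h :: "'a::topological_space \<Rightarrow> 'b::topological_space"
  assumes "homeomorphism UNIV UNIV h k"
  shows "frontier (h ` S) = h ` frontier S"
proof -
  have hk: "h ` S = k -` S" "h ` closure S = k -` closure S" for S
    using assms unfolding homeomorphism_def by (auto simp: image_iff) (metis UNIV_I)+
  have c: "continuous_on UNIV h" "continuous_on UNIV k" and inv: "\<And>x. k (h x) = x" "\<And>y. h (k y) = y"
    using assms by (auto simp: homeomorphism_def)
  have cl: "closure (h ` S) = h ` closure S" for S
  proof
    show "h ` closure S \<subseteq> closure (h ` S)"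
    proof (rule image_closure_subset)
      show "continuous_on (closure S) h" using c(1) by (rule continuous_on_subset) simp
      show "h ` S \<subseteq> closure (h ` S)" by (rule closure_subset)
    qed simp
    have "closed (h ` closure S)"
      unfolding hk by (rule closed_vimage) (use c(2) in auto)
    then show "closure (h ` S) \<subseteq> h ` closure S"
      by (intro closure_minimal) (use closure_subset in blast)
  qed
  have inj: "inj h" using inv by (metis injI)
  have "surj h" using inv by (metis surjI)
  then have "- (h ` S) = h ` (- S)" using inj by (simp add: bij_image_Compl_eq bij_def)
  then show ?thesis
    by (simp add: frontier_closures cl image_Int[OF inj])
qed

lemma homeomorphism_image_component:
  assumes h: "homeomorphism UNIV UNIV h k" and x: "x \<in> S"
  shows "connected_component_set (h ` S) (h x) = h ` connected_component_set S x"
proof -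
  have c: "continuous_on UNIV h" "continuous_on UNIV k" and inv: "\<And>x. k (h x) = x" "\<And>y. h (k y) = y"
    using h by (auto simp: homeomorphism_def)
  have sub: "f ` connected_component_set S x \<subseteq> connected_component_set (f ` S) (f x)"
    if "continuous_on UNIV f" "x \<in> S" for f :: "'c::topological_space \<Rightarrow> 'd::topological_space" and S x
    using that connected_component_subset[of S x]
    by (intro connected_component_maximal connected_continuous_image imageI)
      (auto elim: continuous_on_subset simp: connected_component_refl_eq)
  show ?thesis
  proof
    have "k ` connected_component_set (h ` S) (h x) \<subseteq> connected_component_set (k ` h ` S) (k (h x))"
      using x c by (intro sub) auto
    also have "k ` h ` S = S" using inv by (auto simp: image_iff)
    finally show "connected_component_set (h ` S) (h x) \<subseteq> h ` connected_component_set S x"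
      using inv by (metis (no_types, lifting) image_iff subset_iff)
  qed (use sub c x in blast)
qed

lemma grid_map_cbox:
  assumes "increasing_homeo f" "increasing_homeo g"
  shows "grid_map f g ` cbox a b = cbox (grid_map f g a) (grid_map f g b)"
    "grid_map f g ` box a b = box (grid_map f g a) (grid_map f g b)"
proof -
  have *: "\<exists>w. z = grid_map f g w" for z
  proof -
    obtain x y where "f x = Re z" "g y = Im z"
      using assms unfolding increasing_homeo_def surj_def by metis
    then have "z = grid_map f g (Complex x y)" by (simp add: complex_eq_iff)
    then show ?thesis by blast
  qed
  note less = increasing_homeo_less[OF assms(1)] increasing_homeo_less[OF assms(2)]
  show "grid_map f g ` cbox a b = cbox (grid_map f g a) (grid_map f g b)"
  proof (intro equalityI subsetI)
    fix z assume "z \<in> cbox (grid_map f g a) (grid_map f g b)"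
    moreover obtain w where "z = grid_map f g w" using * by blast
    ultimately show "z \<in> grid_map f g ` cbox a b" using less by (auto simp: in_cbox_complex_iff)
  qed (use less in \<open>auto simp: in_cbox_complex_iff\<close>)
  show "grid_map f g ` box a b = box (grid_map f g a) (grid_map f g b)"
  proof (intro equalityI subsetI)
    fix z assume "z \<in> box (grid_map f g a) (grid_map f g b)"
    moreover obtain w where "z = grid_map f g w" using * by blast
    ultimately show "z \<in> grid_map f g ` box a b" using less by (auto simp: in_box_complex_iff)
  qed (use less in \<open>auto simp: in_box_complex_iff\<close>)
qed

lemma layout_grid:
  assumes "increasing_homeo f" "increasing_homeo g"
  shows "layout (grid_rect f g A) (map (grid_rect f g) Bs) \<longleftrightarrow> layout A Bs"
  using increasing_homeo_less[OF assms(1)] increasing_homeo_less[OF assms(2)]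
  by (simp add: layout_def proper_def nested_def apart_def[abs_def] sorted_wrt_map)

text \<open>The difficulty is \<open>*\<close>: the starred interval is the component of the
  midpoint of the left side, and a grid map need not preserve midpoints. Since left sides avoid
  \<open>S\<close>, each lies in one component, in which any of its points can replace the
  midpoint.\<close>

lemma transform_drawing:
  assumes f: "increasing_homeo f" and g: "increasing_homeo g" and L: "layout A Bs"
    and left: "\<forall>B\<in>insert A (set Bs). \<forall>y\<in>{lo B..hi B}. Complex (lft B) y \<notin> S"
  shows "transform (grid_map f g) (drawing A Bs S K) =
    drawing (grid_rect f g A) (map (grid_rect f g) Bs) (grid_map f g ` S) (grid_map f g ` K)"
proof -
  let ?h = "grid_map f g"
  obtain k where k: "homeomorphism UNIV UNIV ?h k" using grid_map_homeomorphism[OF f g] .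
  have inj: "inj ?h" using k unfolding homeomorphism_def by (metis UNIV_I injI)
  have body: "?h ` drawing_body A Bs = drawing_body (grid_rect f g A) (map (grid_rect f g) Bs)"
    unfolding drawing_body_def using grid_map_cbox[OF f g]
    by (simp add: image_set_diff[OF inj] image_UN)
  have box: "map_box ?h (rectangle_box S B) = rectangle_box (?h ` S) (grid_rect f g B)"
    if B: "B \<in> insert A (set Bs)" for B
  proof -
    let ?m = "Complex (lft B) ((lo B + hi B) / 2)"
    let ?m' = "Complex (f (lft B)) ((g (lo B) + g (hi B)) / 2)"
    have pr: "proper B" using B layout_rects(1,2)[OF L] by blast
    have lo: "lo B \<le> hi B" using pr by (simp add: proper_def)
    have side: "Complex (lft B) y \<in> edges B - S" if "y \<in> {lo B..hi B}" for y
      using that left B pr by (auto simp: in_edges_iff proper_def)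
    have m: "?m \<in> edges B - S" using side lo by auto
    have ed: "edges (grid_rect f g B) - ?h ` S = ?h ` (edges B - S)"
      using homeomorphism_image_frontier[OF k, of "rect B"] grid_map_cbox(1)[OF f g]
      by (simp add: image_set_diff[OF inj])
    obtain y where y: "y \<in> {lo B..hi B}" "g y = (g (lo B) + g (hi B)) / 2"
    proof -
      obtain y where y: "g y = (g (lo B) + g (hi B)) / 2"
        using g unfolding increasing_homeo_def surj_def by metis
      have "g (lo B) \<le> g (hi B)" using increasing_homeo_less(2)[OF g] lo by simp
      then have "g (lo B) \<le> g y" "g y \<le> g (hi B)" using y by auto
      then have "y \<in> {lo B..hi B}" using increasing_homeo_less(2)[OF g] by simp
      then show thesis using that y by blast
    qed
    have m': "?m' = ?h (Complex (lft B) y)" using y by (simp add: complex_eq_iff)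
    have "connected_component (edges B - S) ?m (Complex (lft B) y)"
      unfolding connected_component_def
    proof (intro exI conjI)
      have "continuous_on {lo B..hi B} (Complex (lft B))"
        unfolding Complex_eq[abs_def] by (intro continuous_intros)
      then show "connected (Complex (lft B) ` {lo B..hi B})"
        by (rule connected_continuous_image) auto
      show "Complex (lft B) ` {lo B..hi B} \<subseteq> edges B - S" using side by blast
      show "?m \<in> Complex (lft B) ` {lo B..hi B}" using lo by auto
      show "Complex (lft B) y \<in> Complex (lft B) ` {lo B..hi B}" using y by blast
    qed
    then have "connected_component_set (edges B - S) ?m = connected_component_set (edges B - S) (Complex (lft B) y)"
      by (simp add: connected_component_eq)
    then have "?h ` connected_component_set (edges B - S) ?m =
        connected_component_set (edges (grid_rect f g B) - ?h ` S) ?m'"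
      unfolding ed m' using homeomorphism_image_component[OF k] side[OF y(1)] by metis
    then show ?thesis
      unfolding map_box_def using grid_map_cbox(1)[OF f g]
      by (intro planar_box.expand) (simp add: starred_rectangle_box)
  qed
  show ?thesis
    unfolding transform_def drawing_sel
    using box body unfolding drawing_def
    by (simp add: image_Int[OF inj] image_set_diff[OF inj])
qed

lemma curves_image:
  assumes "homeomorphism UNIV UNIV h k"
  shows "curves (map ((`) h) Rs) = h ` curves Rs"
  using homeomorphism_image_frontier[OF assms] by (simp add: curves_def image_UN)

lemma shaded_image:
  assumes "homeomorphism UNIV UNIV h k"
  shows "shaded (map ((`) h) Rs) = h ` shaded Rs"
proof -
  have inv: "\<And>x. k (h x) = x" "\<And>y. h (k y) = y" using assms by (auto simp: homeomorphism_def)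
  have im: "z \<in> h ` R \<longleftrightarrow> k z \<in> R" for z R using inv by (metis image_iff)
  show ?thesis
    unfolding set_eq_iff im by (simp add: shaded_def filter_map im o_def)
qed

section \<open>Diagrams in a planar algebra\<close>

text \<open>\<open>n\<close> and \<open>ns\<close> are the colours: with white left sides, half the
  number of marked points determines the colour, which is always of the form
  \<open>Col n\<close>.\<close>

definition diagram :: "rectangle \<Rightarrow> rectangle list \<Rightarrow> complex set list \<Rightarrow> nat \<Rightarrow> nat list \<Rightarrow> bool" where
  "diagram A Bs Rs n ns \<longleftrightarrow> layout A Bs \<and> regions Rs \<and>
     (\<forall>B\<in>insert A (set Bs). \<forall>R\<in>set Rs. crosses R B) \<and>
     card (curves Rs \<inter> edges A) = 2 * n \<and>
     list_all2 (\<lambda>B m. card (curves Rs \<inter> edges B) = 2 * m) Bs ns"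

lemma card_marks:
  assumes "proper B" "\<forall>R\<in>set Rs. closed R \<and> crosses R B"
    and "{x \<in> {lft B..rgt B}. Complex x (lo B) \<in> curves Rs} = X"
    and "{x \<in> {lft B..rgt B}. Complex x (hi B) \<in> curves Rs} = Y"
    and "finite X" "finite Y"
  shows "card (curves Rs \<inter> edges B) = card X + card Y"
proof -
  have "curves Rs \<inter> edges B = (\<lambda>x. Complex x (lo B)) ` X \<union> (\<lambda>x. Complex x (hi B)) ` Y"
  proof (intro equalityI subsetI)
    fix z assume z: "z \<in> curves Rs \<inter> edges B"
    then obtain R where R: "R \<in> set Rs" "z \<in> frontier R" by (auto simp: curves_def)
    have "Im z = lo B \<or> Im z = hi B" "Re z \<in> {lft B..rgt B}"
      using crosses_edges[of R B z] assms(1,2) R z by force+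
    then show "z \<in> (\<lambda>x. Complex x (lo B)) ` X \<union> (\<lambda>x. Complex x (hi B)) ` Y"
      using z unfolding assms(3,4)[symmetric] by (cases z) auto
  next
    fix z assume "z \<in> (\<lambda>x. Complex x (lo B)) ` X \<union> (\<lambda>x. Complex x (hi B)) ` Y"
    then show "z \<in> curves Rs \<inter> edges B"
      using assms(1) unfolding assms(3,4)[symmetric] by (auto simp: in_edges_iff proper_def)
  qed
  moreover have "(\<lambda>x. Complex x (lo B)) ` X \<inter> (\<lambda>x. Complex x (hi B)) ` Y = {}"
    using assms(1) by (auto simp: proper_def)
  moreover have "inj_on (\<lambda>x. Complex x y) S" for y S by (simp add: inj_on_def)
  ultimately show ?thesis
    using assms(5,6) by (simp add: card_Un_disjoint card_image)
qed

lemma diagram_tangle: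
  assumes "diagram A Bs Rs n ns"
  shows "tangle (draw A Bs Rs)" "ext_colour (draw A Bs Rs) = Col n"
    "inputs P (draw A Bs Rs) = {xs. list_all2 (\<lambda>x m. x \<in> P (Col m)) xs ns}"
proof -
  have L: "layout A Bs" and Rs: "regions Rs" and cr: "\<forall>B\<in>insert A (set Bs). \<forall>R\<in>set Rs. crosses R B"
    and ns: "card (curves Rs \<inter> edges A) = 2 * n" "list_all2 (\<lambda>B m. card (curves Rs \<inter> edges B) = 2 * m) Bs ns"
    using assms by (auto simp: diagram_def)
  note dr = draw_eq_drawing[OF L]
  have "\<forall>B\<in>set Bs. even (card (curves Rs \<inter> edges B))"
    using ns(2) unfolding list_all2_conv_all_nth by (metis dvd_triv_left in_set_conv_nth)
  then show "tangle (draw A Bs Rs)"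
    unfolding dr using ns(1) by (intro tangle_drawing L Rs cr) simp
  show "ext_colour (draw A Bs Rs) = Col n"
    unfolding dr drawing_sel by (rule box_colour_drawing[OF L Rs]) (use cr ns in auto)
  have "box_colour (draw A Bs Rs) (rectangle_box (curves Rs) (Bs ! i)) = Col (ns ! i)" if "i < length Bs" for i
    unfolding dr using that ns(2) cr
    by (intro box_colour_drawing[OF L Rs]) (auto simp: list_all2_conv_all_nth)
  then show "inputs P (draw A Bs Rs) = {xs. list_all2 (\<lambda>x m. x \<in> P (Col m)) xs ns}"
    using ns(2) unfolding inputs_def by (auto simp: dr list_all2_conv_all_nth)
qed

section \<open>Values of diagrams: substitution, isotopy and linearity\<close>

context planar_algebra
begin

lemma Z_diagram_closed:
  assumes "diagram A Bs Rs n ns" "list_all2 (\<lambda>x m. x \<in> P (Col m)) xs ns"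
  shows "Z (draw A Bs Rs) xs \<in> P (Col n)"
  using Z_closed[of "draw A Bs Rs" xs] diagram_tangle(1,2)[OF assms(1)] diagram_tangle(3)[OF assms(1), of P]
    assms(2) by simp

lemma subalgebra_diagram_closed:
  assumes "planar_subalgebra Q" "diagram A Bs Rs n ns" "list_all2 (\<lambda>x m. x \<in> Q (Col m)) xs ns"
  shows "Z (draw A Bs Rs) xs \<in> Q (Col n)"
proof -
  have "xs \<in> inputs Q (draw A Bs Rs)" using diagram_tangle(3)[OF assms(2), of Q] assms(3) by simp
  then show ?thesis
    using assms(1) diagram_tangle(1,2)[OF assms(2)] unfolding planar_subalgebra_def by metis
qed

lemma Z_diagram_substitute:
  assumes "diagram A (Bs @ B # Bs') Rs n (ns @ m # ns')" "diagram B Cs Rs m ms" "length Bs = length ns"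
    and "list_all2 (\<lambda>x m. x \<in> P (Col m)) xs ns" "list_all2 (\<lambda>x m. x \<in> P (Col m)) ys ms"
      "list_all2 (\<lambda>x m. x \<in> P (Col m)) xs' ns'"
  shows "Z (draw A (Bs @ Cs @ Bs') Rs) (xs @ ys @ xs') =
    Z (draw A (Bs @ B # Bs') Rs) (xs @ Z (draw B Cs Rs) ys # xs')"
proof -
  have L: "layout A (Bs @ B # Bs')" "layout B Cs" using assms by (auto simp: diagram_def)
  note sub = substitute_drawing(1)[OF L] substitute_drawing(2,3)[OF L, of "curves Rs" "shaded Rs"]
  have len: "length Bs = length xs" using assms(3,4) by (simp add: list_all2_lengthD)
  have "xs @ Z (draw B Cs Rs) ys # xs' \<in> inputs P (draw A (Bs @ B # Bs') Rs)"
    unfolding diagram_tangle(3)[OF assms(1)]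
    using assms Z_diagram_closed[OF assms(2,5)] by (auto intro!: list_all2_appendI)
  moreover have "ys \<in> inputs P (draw B Cs Rs)" unfolding diagram_tangle(3)[OF assms(2)] using assms by simp
  ultimately show ?thesis
    using Z_substitute[of "draw A (Bs @ B # Bs') Rs" "draw B Cs Rs" xs ys xs']
      diagram_tangle(1)[OF assms(1)] diagram_tangle(1)[OF assms(2)] sub
    unfolding draw_eq_drawing[OF L(1)] draw_eq_drawing[OF L(2)] draw_eq_drawing[OF sub(1)] len by simp
qed

lemma Z_substitute_first:
  assumes "diagram A (B # Bs) Rs n (m # ns)" "diagram B Cs Rs m ms"
    and "list_all2 (\<lambda>x m. x \<in> P (Col m)) ys ms" "list_all2 (\<lambda>x m. x \<in> P (Col m)) xs ns"
  shows "Z (draw A (B # Bs) Rs) (Z (draw B Cs Rs) ys # xs) = Z (draw A (Cs @ Bs) Rs) (ys @ xs)"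
  using Z_diagram_substitute[of A "[]" B Bs Rs n "[]" m ns Cs ms "[]" ys xs] assms by simp

lemma Z_substitute_second:
  assumes "diagram A [B', B] Rs n [m', m]" "diagram B Cs Rs m ms"
    and "list_all2 (\<lambda>x m. x \<in> P (Col m)) ys ms" "x \<in> P (Col m')"
  shows "Z (draw A [B', B] Rs) [x, Z (draw B Cs Rs) ys] = Z (draw A (B' # Cs) Rs) (x # ys)"
  using Z_diagram_substitute[of A "[B']" B "[]" Rs n "[m']" m "[]" Cs ms "[x]" ys "[]"] assms by simp

lemma Z_diagram_grid:
  assumes "diagram A Bs Rs n ns" "list_all2 (\<lambda>x m. x \<in> P (Col m)) xs ns"
    and f: "increasing_homeo f" and g: "increasing_homeo g"
  shows "Z (draw (grid_rect f g A) (map (grid_rect f g) Bs) (map ((`) (grid_map f g)) Rs)) xs = Z (draw A Bs Rs) xs"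
proof -
  have L: "layout A Bs" and Rs: "regions Rs" and cr: "\<forall>B\<in>insert A (set Bs). \<forall>R\<in>set Rs. crosses R B"
    using assms by (auto simp: diagram_def)
  obtain k where k: "homeomorphism UNIV UNIV (grid_map f g) k" using grid_map_homeomorphism[OF f g] .
  have "Complex (lft B) y \<notin> curves Rs" if "B \<in> insert A (set Bs)" "y \<in> {lo B..hi B}" for B y
  proof
    assume "Complex (lft B) y \<in> curves Rs"
    then obtain R where R: "R \<in> set Rs" "Complex (lft B) y \<in> frontier R" by (auto simp: curves_def)
    then have "Complex (lft B) y \<in> R" using Rs frontier_subset_closed unfolding regions_def by blast
    then show False using cr R(1) that unfolding crosses_def by blast
  qed
  then have "transform (grid_map f g) (draw A Bs Rs) =
      draw (grid_rect f g A) (map (grid_rect f g) Bs) (map ((`) (grid_map f g)) Rs)"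
    using L layout_grid[OF f g, of A Bs] transform_drawing[OF f g L]
    by (simp add: draw_eq_drawing curves_image[OF k] shaded_image[OF k])
  then show ?thesis
    using Z_isotopic[OF diagram_tangle(1)[OF assms(1)] isotopic_grid_map[OF f g]] assms(2)
      diagram_tangle(3)[OF assms(1), of P] by simp
qed

lemma Z_diagram_add:
  assumes "diagram A Bs Rs n ns" "list_all2 (\<lambda>x m. x \<in> P (Col m)) (us @ x # vs) ns"
    "list_all2 (\<lambda>x m. x \<in> P (Col m)) (us @ y # vs) ns"
  shows "Z (draw A Bs Rs) (us @ (x + y) # vs) = Z (draw A Bs Rs) (us @ x # vs) + Z (draw A Bs Rs) (us @ y # vs)"
  by (rule Z_add) (use diagram_tangle(1)[OF assms(1)] diagram_tangle(3)[OF assms(1), of P] assms in auto)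

lemma Z_diagram_scale:
  assumes "diagram A Bs Rs n ns" "list_all2 (\<lambda>x m. x \<in> P (Col m)) (us @ x # vs) ns"
  shows "Z (draw A Bs Rs) (us @ scale a x # vs) = scale a (Z (draw A Bs Rs) (us @ x # vs))"
  by (rule Z_scale) (use diagram_tangle(1)[OF assms(1)] diagram_tangle(3)[OF assms(1), of P] assms in auto)

end

section \<open>Vertical strands\<close>

declare upt_Suc [simp del]

abbreviation half_plane :: "real \<Rightarrow> complex set" where
  "half_plane c \<equiv> {z. c \<le> Re z}"

definition strands :: "real list \<Rightarrow> complex set list" where
  "strands cs = map half_plane cs"

abbreviation reals :: "nat \<Rightarrow> nat \<Rightarrow> real list" where
  "reals i j \<equiv> map real [i..<Suc j]"

lemma vertical_strands_eq: "vertical_strands n = strands (reals 1 n)"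
  by (simp add: vertical_strands_def strands_def)

lemma strands_append: "strands (cs @ ds) = strands cs @ strands ds"
  by (simp add: strands_def)

lemma frontier_half_plane: "frontier (half_plane c) = {z. Re z = c}"
  using frontier_halfspace_ge[of "1::complex" c]
  by (simp add: inner_complex_def)

lemma interior_half_plane: "interior (half_plane c) = {z. c < Re z}"
  using interior_halfspace_ge[of "1::complex" c]
  by (simp add: inner_complex_def)

lemma closed_convex_half_plane: "closed (half_plane c)" "convex (half_plane c)" "interior (half_plane c) \<noteq> {}"
proof -
  show "closed (half_plane c)" by (rule closed_halfspace_Re_ge)
  show "convex (half_plane c)"
    using convex_halfspace_ge[of c "1::complex"] by (simp add: inner_complex_def)
  have "Complex (c + 1) 0 \<in> interior (half_plane c)" by (simp add: interior_half_plane)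
  then show "interior (half_plane c) \<noteq> {}" by blast
qed

lemma crosses_half_plane:
  assumes "lft B < c" "c \<noteq> rgt B"
  shows "crosses (half_plane c) B"
proof -
  have "Complex (c + 1) y \<in> interior (half_plane c)" for y by (simp add: interior_half_plane)
  then show ?thesis
    using assms unfolding crosses_def frontier_half_plane by fastforce
qed

lemma curves_append [simp]: "curves (Rs @ Rs') = curves Rs \<union> curves Rs'"
  by (auto simp: curves_def)

lemma curves_strands [simp]: "Complex x y \<in> curves (strands cs) \<longleftrightarrow> x \<in> set cs"
  by (auto simp: curves_def strands_def frontier_half_plane)

lemma curves_Cons: "curves (R # Rs) = frontier R \<union> curves Rs"
  by (simp add: curves_def)

lemma curves_Nil [simp]: "curves [] = {}"
  by (simp add: curves_def)

lemma shaded_append: "z \<in> shaded (Rs @ Rs') \<longleftrightarrow> (z \<in> shaded Rs \<longleftrightarrow> z \<notin> shaded Rs')"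
  by (auto simp: shaded_def)

lemma shaded_Cons: "z \<in> shaded (R # Rs) \<longleftrightarrow> (z \<in> R \<longleftrightarrow> z \<notin> shaded Rs)"
  by (auto simp: shaded_def)

lemma shaded_Nil: "z \<notin> shaded []"
  by (simp add: shaded_def)

lemma set_reals: "set (reals i j) = real ` {i..j}"
  by (simp add: atLeastLessThanSuc_atLeastAtMost)

lemma set_strands: "set (strands (reals i j)) = (\<lambda>j. half_plane (real j)) ` {i..j}"
  unfolding strands_def set_map set_upt atLeastLessThanSuc_atLeastAtMost image_image ..

lemma reals_split: "i \<le> Suc m \<Longrightarrow> m \<le> n \<Longrightarrow> reals i n = reals i m @ reals (Suc m) n"
  by (metis Suc_le_mono le_iff_add map_append upt_add_eq_append)

lemma curves_strands_iff: "z \<in> curves (strands cs) \<longleftrightarrow> Re z \<in> set cs"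
  by (metis complex.collapse curves_strands)

lemma regions_append:
  "regions (Rs @ Rs') \<longleftrightarrow> regions Rs \<and> regions Rs' \<and>
    (\<forall>R\<in>set Rs. \<forall>R'\<in>set Rs'. frontier R \<inter> frontier R' = {})"
  by (auto simp: regions_def sorted_wrt_append)

lemma regions_strands: "distinct cs \<Longrightarrow> regions (strands cs)"
  using closed_convex_half_plane
  by (induction cs) (auto simp: regions_def strands_def frontier_half_plane)

text \<open>No strand is ever allowed to the left of a box, so the strands to the left of its right
  side are those that pass through it. Each gives one marked point above and one below; the number
  is therefore the colour.\<close>

definition strand_number :: "real list \<Rightarrow> rectangle \<Rightarrow> nat" where
  "strand_number cs B = length (filter (\<lambda>c. c < rgt B) cs)"

lemma strand_number_append [simp]:
  "strand_number (cs @ ds) B = strand_number cs B + strand_number ds B"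
  by (simp add: strand_number_def)

lemma strand_number_all: "\<forall>c\<in>set cs. c < rgt B \<Longrightarrow> strand_number cs B = length cs"
  by (simp add: strand_number_def)

lemma strand_number_none: "\<forall>c\<in>set cs. \<not> c < rgt B \<Longrightarrow> strand_number cs B = 0"
  by (simp add: strand_number_def filter_empty_conv)

lemma strand_diagram:
  assumes "layout A Bs" "distinct cs" "\<forall>B\<in>insert A (set Bs). \<forall>c\<in>set cs. lft B < c \<and> c \<noteq> rgt B"
  shows "diagram A Bs (strands cs) (strand_number cs A) (map (strand_number cs) Bs)"
proof -
  have cr: "\<forall>R\<in>set (strands cs). crosses R B" if "B \<in> insert A (set Bs)" for B
    using assms(3) that crosses_half_plane[of B] unfolding strands_def by auto
  have "card (curves (strands cs) \<inter> edges B) = 2 * strand_number cs B" if B: "B \<in> insert A (set Bs)" for B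
  proof -
    let ?X = "set (filter (\<lambda>c. c < rgt B) cs)"
    have pr: "proper B" using B layout_rects(1,2)[OF assms(1)] by blast
    have X: "{x \<in> {lft B..rgt B}. Complex x y \<in> curves (strands cs)} = ?X" for y
      using assms(3) B by (auto simp: less_eq_real_def)
    have "\<forall>R\<in>set (strands cs). closed R \<and> crosses R B"
      using cr[OF B] closed_convex_half_plane(1) unfolding strands_def by auto
    from card_marks[OF pr this X X] show ?thesis
      using assms(2) distinct_card[of "filter (\<lambda>c. c < rgt B) cs"] unfolding strand_number_def by simp
  qed
  then show ?thesis
    using assms cr regions_strands[OF assms(2)]
    unfolding diagram_def by (auto simp: list_all2_map2 intro!: list.rel_refl_strong)
qed

lemma grid_map_half_plane:
  assumes "increasing_homeo f" "increasing_homeo g"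
  shows "grid_map f g ` half_plane c = half_plane (f c)"
proof (intro equalityI subsetI)
  fix z assume z: "z \<in> half_plane (f c)"
  obtain x y where "f x = Re z" "g y = Im z"
    using assms unfolding increasing_homeo_def surj_def by metis
  then have "z = grid_map f g (Complex x y)" "c \<le> x"
    using z increasing_homeo_less(2)[OF assms(1), of c x] by (auto simp: complex_eq_iff)
  then show "z \<in> grid_map f g ` half_plane c" by auto
qed (use increasing_homeo_less(2)[OF assms(1)] in auto)

lemma strands_grid:
  assumes "increasing_homeo f" "increasing_homeo g"
  shows "map ((`) (grid_map f g)) (strands cs) = strands (map f cs)"
  using grid_map_half_plane[OF assms] by (simp add: strands_def)

lemma draw_cong:
  assumes "layout A Bs" "drawing_body A Bs \<inter> curves Rs = drawing_body A Bs \<inter> curves Rs'"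
    "\<And>z. z \<in> drawing_body A Bs \<Longrightarrow> z \<notin> curves Rs \<Longrightarrow> z \<in> shaded Rs \<longleftrightarrow> z \<in> shaded Rs'"
  shows "draw A Bs Rs = draw A Bs Rs'"
  unfolding draw_eq_drawing[OF assms(1)] using assms(2,3) by (intro drawing_cong assms(1)) blast+

text \<open>A region that misses the body contributes neither a curve nor shading. Read backwards,
  this gives a drawing inside a small box the full list of regions of a larger drawing, as literal
  substitution requires.\<close>

lemma draw_remove:
  assumes L: "layout A Bs" and R: "\<forall>R\<in>set Rs'. closed R \<and> R \<inter> drawing_body A Bs = {}"
  shows "draw A Bs (Rs @ Rs' @ Rs'') = draw A Bs (Rs @ Rs'')"
proof (rule draw_cong[OF L])
  have "frontier R \<inter> drawing_body A Bs = {}" if "R \<in> set Rs'" for R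
    using R that frontier_subset_closed by blast
  then show "drawing_body A Bs \<inter> curves (Rs @ Rs' @ Rs'') = drawing_body A Bs \<inter> curves (Rs @ Rs'')"
    unfolding curves_append by (auto simp: curves_def)
  fix z assume "z \<in> drawing_body A Bs"
  then have "filter (\<lambda>R. z \<in> R) Rs' = []" using R by (auto simp: filter_empty_conv)
  then show "z \<in> shaded (Rs @ Rs' @ Rs'') \<longleftrightarrow> z \<in> shaded (Rs @ Rs'')"
    by (simp add: shaded_def)
qed

lemma sorted_wrt_reals [simp]:
  "sorted_wrt (<) (map real [i..<j])" "sorted_wrt (<) (map (\<lambda>j. p + real j) [i..<j])"
  using sorted_wrt_upt[of i j] by (simp_all add: sorted_wrt_map)

context planar_algebra
begin

text \<open>\<open>us\<close> and \<open>vs\<close> are meant to list the abscissae and ordinates of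
  all corners and strands, \<open>us'\<close> and \<open>vs'\<close> their targets. Interpolation
  yields a grid map, and the last assumption only has to compare the coordinates of the two
  drawings.\<close>

lemma Z_strands_isotopic:
  assumes "diagram A Bs (strands cs) n ns" "list_all2 (\<lambda>x m. x \<in> P (Col m)) xs ns"
    and "us \<noteq> []" "length us = length us'" "sorted_wrt (<) us" "sorted_wrt (<) us'"
    and "vs \<noteq> []" "length vs = length vs'" "sorted_wrt (<) vs" "sorted_wrt (<) vs'"
    and "\<And>f g. map f us = us' \<Longrightarrow> map g vs = vs' \<Longrightarrow>
      grid_rect f g A = A' \<and> map (grid_rect f g) Bs = Bs' \<and> map f cs = cs'"
  shows "Z (draw A' Bs' (strands cs')) xs = Z (draw A Bs (strands cs)) xs"
proof -
  obtain f where f: "increasing_homeo f" "map f us = us'"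
    using increasing_homeo_through assms(3-6) by blast
  obtain g where g: "increasing_homeo g" "map g vs = vs'"
    using increasing_homeo_through assms(7-10) by blast
  show ?thesis
    using Z_diagram_grid[OF assms(1,2) f(1) g(1)] strands_grid[OF f(1) g(1)] assms(11)[OF f(2) g(2)] by simp
qed

text \<open>The offset \<open>p\<close> admits boxes placed far to the right; by a grid isotopy only
  the order of the coordinates matters.\<close>

lemma Z_identity_strands:
  assumes "x \<in> P (Col n)" "layout A [X]" "lft X < p + 1" "p + real n < rgt X"
  shows "Z (draw A [X] (strands (map (\<lambda>j. p + real j) [1..<Suc n]))) [x] = x"
proof -
  let ?A = "(Complex (-1) (-2), Complex (real n + 2) 2)" and ?X = "(Complex 0 (-1), Complex (real n + 1) 1)"
  let ?us = "[-1, 0] @ reals 1 n @ [real n + 1, real n + 2]"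
  let ?us' = "[lft A, lft X] @ map (\<lambda>j. p + real j) [1..<Suc n] @ [rgt X, rgt A]"
  have lay: "lft A < lft X" "rgt X < rgt A" "lo A < lo X" "hi X < hi A" "lo X < hi X" "lft X < rgt X"
    using assms(2) by (auto simp: layout_def nested_def proper_def)
  have "diagram ?A [?X] (strands (reals 1 n)) (strand_number (reals 1 n) ?A) (map (strand_number (reals 1 n)) [?X])"
    by (rule strand_diagram) (auto simp: layout_def nested_def proper_def distinct_map)
  moreover have "strand_number (reals 1 n) ?X = n"
    by (subst strand_number_all) auto
  ultimately have d: "diagram ?A [?X] (strands (reals 1 n)) (strand_number (reals 1 n) ?A) [n]"
    by simp
  have "Z (draw A [X] (strands (map (\<lambda>j. p + real j) [1..<Suc n]))) [x] =
      Z (draw ?A [?X] (strands (reals 1 n))) [x]"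
  proof (rule Z_strands_isotopic[OF d, where us="?us" and us'="?us'" and
        vs="[-2,-1,1,2]" and vs'="[lo A, lo X, hi X, hi A]"])
    show "sorted_wrt (<) ?us" by (auto simp: sorted_wrt_append)
    show "sorted_wrt (<) ?us'"
      using lay assms(3,4) by (auto simp: sorted_wrt_append)
    show "sorted_wrt (<) [lo A, lo X, hi X, hi A]" using lay by simp
    fix f g :: "real \<Rightarrow> real" assume fg: "map f ?us = ?us'" "map g [-2,-1,1,2] = [lo A, lo X, hi X, hi A]"
    then have "f (-1) = lft A" "f 0 = lft X" "map f (reals 1 n) = map (\<lambda>j. p + real j) [1..<Suc n]"
      "f (real n + 1) = rgt X" "f (real n + 2) = rgt A"
      by simp_all
    then show "grid_rect f g ?A = A \<and> map (grid_rect f g) [?X] = [X] \<and>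
        map f (reals 1 n) = map (\<lambda>j. p + real j) [1..<Suc n]"
      using fg(2) by (auto simp: prod_eq_iff complex_eq_iff)
  qed (use assms(1) in auto)
  also have "draw ?A [?X] (strands (reals 1 n)) = identity_tangle (Col n)"
    by (simp add: identity_tangle_def vertical_strands_eq Let_def)
  finally show ?thesis using Z_identity[OF assms(1)] by simp
qed

lemma unit_eq_strands:
  assumes "proper Y" "lft Y < 1" "real m < rgt Y"
  shows "unit (Col m) = Z (draw Y [] (strands (reals 1 m))) []"
proof -
  let ?Y = "(Complex 0 (-1), Complex (real m + 1) 1)"
  let ?us = "[lft Y] @ reals 1 m @ [rgt Y]"
  let ?us' = "[0] @ reals 1 m @ [real m + 1]"
  have d: "diagram Y [] (strands (reals 1 m)) (strand_number (reals 1 m) Y) (map (strand_number (reals 1 m)) [])"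
    by (rule strand_diagram) (use assms in \<open>auto simp: layout_def distinct_map\<close>)
  have "Z (draw ?Y [] (strands (reals 1 m))) [] = Z (draw Y [] (strands (reals 1 m))) []"
  proof (rule Z_strands_isotopic[OF d, where us="?us" and us'="?us'" and vs="[lo Y, hi Y]" and vs'="[-1,1]"])
    show "sorted_wrt (<) ?us" using assms by (auto simp: sorted_wrt_append proper_def)
    show "sorted_wrt (<) ?us'" by (auto simp: sorted_wrt_append)
    fix f g :: "real \<Rightarrow> real" assume "map f ?us = ?us'" "map g [lo Y, hi Y] = [-1,1]"
    then show "grid_rect f g Y = ?Y \<and> map (grid_rect f g) [] = [] \<and> map f (reals 1 m) = reals 1 m"
      by (auto simp: prod_eq_iff complex_eq_iff)
  qed (use assms in \<open>auto simp: proper_def\<close>)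
  then show ?thesis
    by (simp add: unit_def unit_tangle_def vertical_strands_eq Let_def)
qed

text \<open>The product does not depend on the size of the rectangles, only on their relative
  position, so it can be read off from whatever boxes a larger drawing provides.\<close>

lemma mult_eq_strands:
  assumes "x \<in> P (Col m)" "y \<in> P (Col m)" "layout Y [Y1, Y2]"
    and "lft Y1 = lft Y2" "lft Y1 < 1" "rgt Y1 = rgt Y2" "real m < rgt Y1" "hi Y2 < lo Y1"
  shows "mult (Col m) x y = Z (draw Y [Y1, Y2] (strands (reals 1 m))) [x, y]"
proof -
  let ?Y = "(Complex (-1) (-3), Complex (real m + 2) 3)" and ?Y1 = "(Complex 0 1, Complex (real m + 1) 2)"
    and ?Y2 = "(Complex 0 (-2), Complex (real m + 1) (-1))"
  let ?us = "[lft Y, lft Y1] @ reals 1 m @ [rgt Y1, rgt Y]"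
  let ?us' = "[-1, 0] @ reals 1 m @ [real m + 1, real m + 2]"
  let ?vs = "[lo Y, lo Y2, hi Y2, lo Y1, hi Y1, hi Y]"
  have lay: "lft Y < lft Y1" "rgt Y1 < rgt Y" "lo Y < lo Y2" "hi Y1 < hi Y" "lo Y1 < hi Y1" "lo Y2 < hi Y2" "lft Y1 < rgt Y1"
    using assms(3) by (auto simp: layout_def nested_def proper_def)
  have "diagram Y [Y1, Y2] (strands (reals 1 m)) (strand_number (reals 1 m) Y) (map (strand_number (reals 1 m)) [Y1, Y2])"
    by (rule strand_diagram) (use assms lay in \<open>auto simp: distinct_map\<close>)
  moreover have "strand_number (reals 1 m) Y1 = m" "strand_number (reals 1 m) Y2 = m"
    by (subst strand_number_all; use assms in auto)+
  ultimately have d: "diagram Y [Y1, Y2] (strands (reals 1 m)) (strand_number (reals 1 m) Y) [m, m]"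
    by simp
  have "Z (draw ?Y [?Y1, ?Y2] (strands (reals 1 m))) [x, y] = Z (draw Y [Y1, Y2] (strands (reals 1 m))) [x, y]"
  proof (rule Z_strands_isotopic[OF d, where us="?us" and us'="?us'" and vs="?vs" and vs'="[-3,-2,-1,1,2,3]"])
    show "sorted_wrt (<) ?us" using lay assms by (auto simp: sorted_wrt_append)
    show "sorted_wrt (<) ?us'" by (auto simp: sorted_wrt_append)
    show "sorted_wrt (<) ?vs" using lay assms by auto
    fix f g :: "real \<Rightarrow> real" assume fg: "map f ?us = ?us'" "map g ?vs = [-3,-2,-1,1,2,3]"
    then have "f (lft Y) = -1" "f (lft Y1) = 0" "map f (reals 1 m) = reals 1 m"
      "f (rgt Y1) = real m + 1" "f (rgt Y) = real m + 2"
      by simp_all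
    then show "grid_rect f g Y = ?Y \<and> map (grid_rect f g) [Y1, Y2] = [?Y1, ?Y2] \<and> map f (reals 1 m) = reals 1 m"
      using fg(2) assms(4,6) by (auto simp: prod_eq_iff complex_eq_iff)
  qed (use assms in auto)
  then show ?thesis
    by (simp add: mult_def mult_tangle_def vertical_strands_eq Let_def)
qed

end

section \<open>Contracting with the trace form\<close>

definition marked :: "complex set list \<Rightarrow> rectangle \<Rightarrow> nat \<Rightarrow> bool" where
  "marked Rs B n \<longleftrightarrow> (\<forall>R\<in>set Rs. crosses R B) \<and> card (curves Rs \<inter> edges B) = 2 * n"

lemma diagramI:
  assumes "layout A Bs" "regions Rs" "marked Rs A n" "list_all2 (marked Rs) Bs ns"
  shows "diagram A Bs Rs n ns"
proof -
  have "\<exists>n. marked Rs B n" if "B \<in> set Bs" for B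
    using that assms(4) unfolding list_all2_conv_all_nth by (metis in_set_conv_nth)
  moreover have "list_all2 (\<lambda>B m. card (curves Rs \<inter> edges B) = 2 * m) Bs ns"
    using assms(4) by (rule list_all2_mono) (simp add: marked_def)
  ultimately show ?thesis
    using assms(1-3) unfolding diagram_def marked_def by blast
qed

lemma markedI:
  assumes "proper B" "regions Rs" "\<And>R. R \<in> set Rs \<Longrightarrow> crosses R B"
    and "\<And>x. lft B \<le> x \<Longrightarrow> x \<le> rgt B \<Longrightarrow> Complex x (lo B) \<in> curves Rs \<longleftrightarrow> x \<in> X"
    and "\<And>x. lft B \<le> x \<Longrightarrow> x \<le> rgt B \<Longrightarrow> Complex x (hi B) \<in> curves Rs \<longleftrightarrow> x \<in> Y"
    and "X \<subseteq> {lft B..rgt B}" "Y \<subseteq> {lft B..rgt B}" "finite X" "finite Y" "card X + card Y = 2 * n"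
  shows "marked Rs B n"
proof -
  have "{x \<in> {lft B..rgt B}. Complex x (lo B) \<in> curves Rs} = X"
    "{x \<in> {lft B..rgt B}. Complex x (hi B) \<in> curves Rs} = Y"
    using assms(4-7) by auto
  from card_marks[OF assms(1) _ this assms(8,9)] show ?thesis
    using assms(2,3,10) by (auto simp: marked_def regions_def)
qed

text \<open>The last alternative for the right side lets it run through the inside of
  \<open>C\<close>. This is the situation of the boxes under the closing arcs: an arc enters such a
  box from above and below and returns beyond its right side.\<close>

lemma crosses_rect:
  assumes "proper C" "proper B"
    and "lft B < lft C \<or> rgt C < lft B \<or> hi B < lo C \<or> hi C < lo B"
    and "rgt B < lft C \<or> rgt C < rgt B \<or> hi B < lo C \<or> hi C < lo B \<or>
      lft C < rgt B \<and> rgt B < rgt C \<and> lo C < lo B \<and> hi B < hi C"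
    and "lo B \<noteq> lo C" "lo B \<noteq> hi C" "hi B \<noteq> lo C" "hi B \<noteq> hi C"
  shows "crosses (rect C) B"
proof -
  have "(\<exists>x. Complex x y \<in> interior (rect C)) \<or> (\<forall>x\<in>{lft B..rgt B}. Complex x y \<notin> edges C)"
    if "y \<noteq> lo C" "y \<noteq> hi C" for y
  proof (cases "lo C < y \<and> y < hi C")
    case True
    then have "Complex ((lft C + rgt C) / 2) y \<in> interior (rect C)"
      using assms(1) by (simp add: in_box_complex_iff proper_def)
    then show ?thesis by blast
  next
    case False
    then show ?thesis using that assms(1) by (auto simp: in_edges_iff)
  qed
  moreover have "Complex (lft B) y \<notin> rect C" if "y \<in> {lo B..hi B}" for y
    using assms(3) that by (auto simp: in_cbox_complex_iff)
  moreover have "Complex (rgt B) y \<notin> edges C" if "y \<in> {lo B..hi B}" for y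
    using assms(1,4) that unfolding in_edges_iff[OF assms(1)] proper_def by auto
  ultimately show ?thesis
    using assms(5-8) unfolding crosses_def by auto
qed

text \<open>Frontiers are compared separately because at the boundary of the body the part of a
  region inside the body does not determine its frontier.\<close>

lemma draw_cong_list:
  assumes L: "layout A Bs"
    and "list_all2 (\<lambda>R R'. drawing_body A Bs \<inter> R = drawing_body A Bs \<inter> R' \<and>
      drawing_body A Bs \<inter> frontier R = drawing_body A Bs \<inter> frontier R') Rs Rs'"
  shows "draw A Bs Rs = draw A Bs Rs'"
proof (rule draw_cong[OF L])
  show "drawing_body A Bs \<inter> curves Rs = drawing_body A Bs \<inter> curves Rs'"
    using assms(2) by (induction rule: list_all2_induct) (auto simp: curves_def)
  fix z assume z: "z \<in> drawing_body A Bs"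
  have "length (filter (\<lambda>R. z \<in> R) Rs) = length (filter (\<lambda>R. z \<in> R) Rs')"
    using assms(2) z by (induction rule: list_all2_induct) auto
  then show "z \<in> shaded Rs \<longleftrightarrow> z \<in> shaded Rs'" by (simp add: shaded_def)
qed

lemma regions_rect:
  assumes "proper B"
  shows "closed (rect B)" "convex (rect B)" "interior (rect B) \<noteq> {}"
proof -
  have "Complex ((lft B + rgt B)/2) ((lo B + hi B)/2) \<in> box (fst B) (snd B)"
    using assms by (auto simp: in_box_complex_iff proper_def)
  then show "closed (rect B)" "convex (rect B)" "interior (rect B) \<noteq> {}" by auto
qed

definition arc_rect :: "nat \<Rightarrow> nat \<Rightarrow> rectangle" where
  "arc_rect k j = (Complex (real j) (- (real k + 2 - real j)),
     Complex (2 * real k + 2 - real j) (real k + 2 - real j))"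

definition trace_arcs :: "nat \<Rightarrow> complex set list" where
  "trace_arcs k = map (\<lambda>j. rect (arc_rect k j)) [1..<Suc k]"

text \<open>The offset puts all these strands to the right of \<open>trace_box\<close>, which ends
  at the abscissa \<open>2 * real k + 2\<close>, and just to the right of the left side of
  \<open>far_box\<close>.\<close>

definition far_strands :: "nat \<Rightarrow> nat \<Rightarrow> complex set list" where
  "far_strands k n = strands (map (\<lambda>j. (2 * real k + 4) + real j) [1..<Suc n])"

abbreviation contraction_regions :: "nat \<Rightarrow> nat \<Rightarrow> complex set list" where
  "contraction_regions k n \<equiv> trace_arcs k @ far_strands k n"

text \<open>\<open>trace_box\<close>, \<open>mult_box\<close> and the arcs are those of \<open>trace_tangle k\<close>; the two factors of a product sit in
  \<open>upper_box\<close> and \<open>lower_box\<close>, and an \<open>n\<close>-box sits in \<open>far_box\<close> to the right of them, so that the regions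
  to the left of all boxes are white. Cutting along \<open>pair_box\<close>, which contains \<open>lower_box\<close> and \<open>far_box\<close> but not
  \<open>upper_box\<close>, exhibits the drawing as a contraction with a \<open>(k + n)\<close>-box.\<close>

definition trace_box :: "nat \<Rightarrow> rectangle" where
  "trace_box k = (Complex (-1) (- real k - 2), Complex (2 * real k + 2) (real k + 2))"

definition mult_box :: "nat \<Rightarrow> rectangle" where
  "mult_box k = (Complex 0 (-1), Complex (real k + 1) 1)"

definition upper_box :: "nat \<Rightarrow> rectangle" where
  "upper_box k = (Complex (1/2) (1/3), Complex (real k + 3/4) (2/3))"

definition lower_box :: "nat \<Rightarrow> rectangle" where
  "lower_box k = (Complex (1/2) (-2/3), Complex (real k + 3/4) (-1/3))"

definition far_box :: "nat \<Rightarrow> nat \<Rightarrow> rectangle" where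
  "far_box k n = (Complex (2 * real k + 4) (-2/3), Complex (2 * real k + real n + 5) (-1/3))"

definition pair_box :: "nat \<Rightarrow> nat \<Rightarrow> rectangle" where
  "pair_box k n = (Complex (-3/2) (- real k - 3), Complex (2 * real k + real n + 6) 0)"

definition frame_box :: "nat \<Rightarrow> nat \<Rightarrow> rectangle" where
  "frame_box k n = (Complex (-2) (- real k - 4), Complex (2 * real k + real n + 7) (real k + 4))"

lemmas contraction_box_defs = trace_box_def mult_box_def upper_box_def lower_box_def far_box_def
  pair_box_def frame_box_def

lemma proper_arc_rect: "j \<le> k \<Longrightarrow> proper (arc_rect k j)"
  by (simp add: proper_def arc_rect_def)

lemma arc_rect_edges:
  assumes "j \<le> k"
  shows "Complex x y \<in> edges (arc_rect k j) \<longleftrightarrow>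
    (x = real j \<or> x = 2 * real k + 2 - real j) \<and> \<bar>y\<bar> \<le> real k + 2 - real j \<or>
    \<bar>y\<bar> = real k + 2 - real j \<and> real j \<le> x \<and> x \<le> 2 * real k + 2 - real j"
  using assms unfolding in_edges_iff[OF proper_arc_rect[OF assms]] by (auto simp: arc_rect_def abs_if)

lemma regions_contraction: "regions (contraction_regions k n)" "regions (trace_arcs k)"
proof -
  have "edges (arc_rect k i) \<inter> edges (arc_rect k j) = {}" if "i < j" "j \<le> k" for i j
  proof -
    have "rect (arc_rect k j) \<subseteq> box (fst (arc_rect k i)) (snd (arc_rect k i))"
      using that by (auto simp: arc_rect_def in_cbox_complex_iff in_box_complex_iff)
    then show ?thesis unfolding edges_eq by blast
  qed
  then have "sorted_wrt (\<lambda>i j. edges (arc_rect k i) \<inter> edges (arc_rect k j) = {}) [1..<Suc k]"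
    unfolding sorted_wrt_iff_nth_less by auto
  then show arcs: "regions (trace_arcs k)"
    using regions_rect[OF proper_arc_rect] by (auto simp: regions_def trace_arcs_def sorted_wrt_map)
  have "frontier R \<inter> frontier R' = {}" if R: "R \<in> set (trace_arcs k)" "R' \<in> set (far_strands k n)" for R R'
  proof -
    obtain i where i: "i \<in> {1..k}" "R = rect (arc_rect k i)"
      using R(1) unfolding trace_arcs_def set_map set_upt atLeastLessThanSuc_atLeastAtMost by blast
    obtain j where j: "j \<in> {1..n}" "R' = half_plane (2 * real k + 4 + real j)"
      using R(2) unfolding far_strands_def strands_def set_map set_upt atLeastLessThanSuc_atLeastAtMost by auto
    have "Re z < 2 * real k + 2" if "z \<in> frontier R" for z
    proof -
      have "z \<in> rect (arc_rect k i)"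
        using that frontier_subset_closed[OF closed_cbox] unfolding i(2) by blast
      then show ?thesis using i(1) by (auto simp: arc_rect_def in_cbox_complex_iff)
    qed
    moreover have "Re z > 2 * real k + 2" if "z \<in> frontier R'" for z
      using that unfolding j(2) frontier_half_plane by simp
    ultimately show ?thesis by (metis disjoint_iff less_asym)
  qed
  moreover have "regions (far_strands k n)"
    unfolding far_strands_def by (rule regions_strands) (simp add: distinct_map inj_on_def)
  ultimately show "regions (contraction_regions k n)" using arcs unfolding regions_append by blast
qed

lemma curves_trace_arcs:
  "\<bar>y\<bar> < 2 \<Longrightarrow> Complex x y \<in> curves (trace_arcs k) \<longleftrightarrow> x \<in> real ` {1..k} \<union> (\<lambda>j. 2 * real k + 2 - real j) ` {1..k}"
  "real k + 1 < \<bar>y\<bar> \<Longrightarrow> Complex x y \<notin> curves (trace_arcs k)"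
proof -
  have *: "Complex x y \<in> curves (trace_arcs k) \<longleftrightarrow> (\<exists>j\<in>{1..k}. Complex x y \<in> edges (arc_rect k j))" for x y
    by (auto simp: curves_def trace_arcs_def atLeastLessThanSuc_atLeastAtMost simp del: atLeastAtMost_iff)
  have e: "Complex x y \<in> edges (arc_rect k j) \<longleftrightarrow> x = real j \<or> x = 2 * real k + 2 - real j"
    if "j \<in> {1..k}" "\<bar>y\<bar> < 2" for x y j
    using that by (auto simp: arc_rect_edges)
  show "Complex x y \<in> curves (trace_arcs k) \<longleftrightarrow> x \<in> real ` {1..k} \<union> (\<lambda>j. 2 * real k + 2 - real j) ` {1..k}"
    if "\<bar>y\<bar> < 2"
    unfolding * using e[OF _ that] by blast
  show "Complex x y \<notin> curves (trace_arcs k)" if "real k + 1 < \<bar>y\<bar>"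
    unfolding * using that by (auto simp: arc_rect_edges)
qed

lemma curves_far_strands:
  "Complex x y \<in> curves (far_strands k n) \<longleftrightarrow> x \<in> (\<lambda>j. (2 * real k + 4) + real j) ` {1..n}"
  unfolding far_strands_def curves_strands by (simp add: atLeastLessThanSuc_atLeastAtMost)

lemma crosses_contraction:
  assumes "B \<in> {trace_box k, mult_box k, upper_box k, lower_box k, far_box k n, pair_box k n, frame_box k n}"
    and "R \<in> set (contraction_regions k n)"
  shows "crosses R B"
  using assms(2) unfolding set_append
proof
  assume "R \<in> set (trace_arcs k)"
  then obtain j where j: "1 \<le> j" "j \<le> k" "R = rect (arc_rect k j)"
    by (auto simp: trace_arcs_def)
  have pr: "proper B" using assms(1) by (auto simp: contraction_box_defs proper_def)
  have "real j \<ge> 1" "real j \<le> real k" using j by auto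
  then show ?thesis
    unfolding j(3) by (intro crosses_rect proper_arc_rect j(2) pr;
        use assms(1) in \<open>auto simp: contraction_box_defs arc_rect_def\<close>)
next
  assume "R \<in> set (far_strands k n)"
  then obtain j where j: "1 \<le> j" "j \<le> n" "R = half_plane (2 * real k + 4 + real j)"
    by (auto simp: far_strands_def strands_def)
  then show ?thesis
    using assms(1) unfolding j(3) by (intro crosses_half_plane) (auto simp: contraction_box_defs)
qed

lemma card_real_images:
  "card (real ` {i..k}) = Suc k - i" "card ((\<lambda>j. c - real j) ` {i..k}) = Suc k - i"
  "card ((\<lambda>j. c + real j) ` {i..k}) = Suc k - i"
  by (subst card_image; simp add: inj_on_def)+

lemma marked_contraction:
  fixes k n :: nat
  defines "Rs \<equiv> contraction_regions k n"
  shows "marked Rs (trace_box k) 0" "marked Rs (far_box k n) n" "marked Rs (frame_box k n) n"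
    "B \<in> {mult_box k, upper_box k, lower_box k} \<Longrightarrow> marked Rs B k"
    "marked Rs (pair_box k n) (k + n)"
proof -
  let ?J = "real ` {1..k}" and ?J' = "(\<lambda>j. (2 * real k + 2) - real j) ` {1..k}"
    and ?E = "(\<lambda>j. (2 * real k + 4) + real j) ` {1..n}"
  note c = curves_append Un_iff curves_far_strands curves_trace_arcs
  have card: "card ?J = k" "card ?J' = k" "card ?E = n"
    using card_real_images(1)[of 1 k] card_real_images(2)[of "2 * real k + 2" 1 k]
      card_real_images(3)[of "2 * real k + 4" 1 n] by auto
  note card = card card[unfolded One_nat_def]
  note m = markedI[OF _ regions_contraction(1)[of k n] crosses_contraction[of _ k n], folded Rs_def]
  have pr: "proper B"
    if "B \<in> {trace_box k, mult_box k, upper_box k, lower_box k, far_box k n, pair_box k n, frame_box k n}" for B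
    using that by (auto simp: contraction_box_defs proper_def)
  show "marked Rs (trace_box k) 0"
    by (rule m[where X="{}" and Y="{}"]; (rule pr)?) (auto simp: Rs_def trace_box_def c)
  show "marked Rs (far_box k n) n" "marked Rs (frame_box k n) n"
    by (rule m[where X="?E" and Y="?E"]; (rule pr)?; auto simp: Rs_def far_box_def frame_box_def c card)+
  show "marked Rs B k" if "B \<in> {mult_box k, upper_box k, lower_box k}"
    using that
    by (intro m[where X="?J" and Y="?J"] pr) (auto simp: Rs_def mult_box_def upper_box_def lower_box_def c card)
  \<comment> \<open>The upper edge of \<open>pair_box\<close> meets each of the \<open>k\<close>
    arcs twice and each of the \<open>n\<close> far strands once, its lower edge only the far
    strands: \<open>2 * k + n\<close> and \<open>n\<close> points, hence the colour
    \<open>k + n\<close>.\<close>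
  have "?J \<inter> ?J' = {}" "(?J \<union> ?J') \<inter> ?E = {}" by auto
  then have card3: "card (?J \<union> ?J' \<union> ?E) = 2 * k + n"
    using card by (simp add: card_Un_disjoint)
  show "marked Rs (pair_box k n) (k + n)"
    by (rule m[where X="?E" and Y="?J \<union> ?J' \<union> ?E"]; (rule pr)?)
      (auto simp: Rs_def pair_box_def c card card3 card3[unfolded One_nat_def])
qed

lemma contraction_diagrams:
  fixes k n :: nat
  defines "Rs \<equiv> contraction_regions k n"
  shows "diagram (trace_box k) [mult_box k] Rs 0 [k]" (is ?A)
    and "diagram (mult_box k) [upper_box k, lower_box k] Rs k [k, k]" (is ?B)
    and "diagram (trace_box k) [upper_box k, lower_box k] Rs 0 [k, k]" (is ?C)
    and "diagram (pair_box k n) [lower_box k, far_box k n] Rs (k + n) [k, n]" (is ?D)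
    and "diagram (frame_box k n) [upper_box k, pair_box k n] Rs n [k, k + n]" (is ?E)
    and "diagram (frame_box k n) [trace_box k, far_box k n] Rs n [0, n]" (is ?F)
proof -
  have L: "layout (trace_box k) [mult_box k]" "layout (mult_box k) [upper_box k, lower_box k]"
    "layout (trace_box k) [upper_box k, lower_box k]" "layout (pair_box k n) [lower_box k, far_box k n]"
    "layout (frame_box k n) [upper_box k, pair_box k n]" "layout (frame_box k n) [trace_box k, far_box k n]"
    by (auto simp: layout_def proper_def nested_def apart_def contraction_box_defs)
  note d = diagramI[OF _ regions_contraction(1)[of k n], folded Rs_def]
    and m = marked_contraction[where k=k and n=n, folded Rs_def]
  show ?A ?B ?C ?D ?E ?F
    using d[OF L(1) m(1)] d[OF L(2) m(4)] d[OF L(3) m(1)] d[OF L(4) m(5)] d[OF L(5) m(3)] d[OF L(6) m(3)] m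
    by simp_all
qed

lemma trace_tangle_eq: "trace_tangle k = draw (trace_box k) [mult_box k] (contraction_regions k n)"
proof -
  have L: "layout (trace_box k) [mult_box k]"
    using contraction_diagrams(1)[of k n] by (simp add: diagram_def)
  have "trace_tangle k = draw (trace_box k) [mult_box k] (trace_arcs k @ [])"
    by (simp add: trace_tangle_def trace_box_def mult_box_def trace_arcs_def arc_rect_def)
  also have "\<dots> = draw (trace_box k) [mult_box k] (trace_arcs k @ far_strands k n @ [])"
    by (rule draw_remove[OF L, symmetric])
      (auto simp: contraction_box_defs far_strands_def strands_def
        closed_convex_half_plane drawing_body_def in_cbox_complex_iff)
  finally show ?thesis by simp
qed

section \<open>Evaluation of the contraction\<close>

context planar_algebra
begin

text \<open>Inside \<open>mult_box\<close> the horizontal sides and the returning side of an arc are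
  out of sight, so the rectangle of the \<open>j\<close>-th arc looks like the half-plane to the
  right of the \<open>j\<close>-th strand; the far strands are not visible at all.\<close>

lemma mult_eq_contraction:
  assumes "x \<in> P (Col k)" "y \<in> P (Col k)"
  shows "mult (Col k) x y = Z (draw (mult_box k) [upper_box k, lower_box k] (contraction_regions k n)) [x, y]"
proof -
  let ?A = "mult_box k" and ?Bs = "[upper_box k, lower_box k]"
  let ?D = "drawing_body ?A ?Bs"
  have L: "layout ?A ?Bs" using contraction_diagrams(2)[of k n] by (simp add: diagram_def)
  have "mult (Col k) x y = Z (draw ?A ?Bs (strands (reals 1 k))) [x, y]"
    by (rule mult_eq_strands) (use assms L in \<open>auto simp: upper_box_def lower_box_def\<close>)
  also have "draw ?A ?Bs (strands (reals 1 k)) = draw ?A ?Bs (trace_arcs k)"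
  proof (rule draw_cong_list[OF L])
    have body: "z \<in> ?D \<Longrightarrow> Re z \<in> {0..real k + 1} \<and> Im z \<in> {-1..1}" for z
      by (auto simp: drawing_body_def mult_box_def in_cbox_complex_iff)
    show "list_all2 (\<lambda>R R'. ?D \<inter> R = ?D \<inter> R' \<and> ?D \<inter> frontier R = ?D \<inter> frontier R')
      (strands (reals 1 k)) (trace_arcs k)"
      unfolding strands_def trace_arcs_def list_all2_map1 list_all2_map2
    proof (rule list.rel_refl_strong)
      fix j assume "j \<in> set [1..<Suc k]"
      then have j: "1 \<le> j" "j \<le> k" by auto
      have "z \<in> half_plane (real j) \<longleftrightarrow> z \<in> rect (arc_rect k j)" if "z \<in> ?D" for z
        using body[OF that] j by (auto simp: arc_rect_def in_cbox_complex_iff)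
      moreover have "z \<in> frontier (half_plane (real j)) \<longleftrightarrow> z \<in> edges (arc_rect k j)" if "z \<in> ?D" for z
        using body[OF that] j arc_rect_edges[OF j(2), of "Re z" "Im z"] by (auto simp: frontier_half_plane)
      ultimately show "?D \<inter> half_plane (real j) = ?D \<inter> rect (arc_rect k j) \<and>
          ?D \<inter> frontier (half_plane (real j)) = ?D \<inter> edges (arc_rect k j)"
        by blast
    qed
  qed
  also have "draw ?A ?Bs (trace_arcs k) = draw ?A ?Bs (trace_arcs k @ far_strands k n @ [])"
    by (subst draw_remove[OF L])
      (auto simp: contraction_box_defs far_strands_def strands_def
        closed_convex_half_plane drawing_body_def in_cbox_complex_iff)
  finally show ?thesis by simp
qed

text \<open>The arcs lie inside \<open>trace_box\<close> and are invisible from its outside, and the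
  unit of colour \<open>Col 0\<close> is an empty drawing. Substituting it deletes the box and
  leaves only strands through \<open>far_box\<close>, that is, an identity tangle.\<close>

lemma unit_beside:
  assumes "x \<in> P (Col n)"
  shows "Z (draw (frame_box k n) [trace_box k, far_box k n] (contraction_regions k n)) [unit (Col 0), x] = x"
proof -
  let ?cs = "map (\<lambda>j. (2 * real k + 4) + real j) [1..<Suc n]"
  let ?A = "frame_box k n" and ?T = "trace_box k" and ?B = "far_box k n"
  have L: "layout ?A [?T, ?B]" using contraction_diagrams(6)[of k n] by (simp add: diagram_def)
  have "draw ?A [?T, ?B] ([] @ trace_arcs k @ far_strands k n) = draw ?A [?T, ?B] ([] @ far_strands k n)"
  proof (rule draw_remove[OF L], intro ballI conjI)
    fix R assume "R \<in> set (trace_arcs k)"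
    then obtain j where j: "1 \<le> j" "j \<le> k" "R = rect (arc_rect k j)" by (auto simp: trace_arcs_def)
    then have "R \<subseteq> box (fst ?T) (snd ?T)"
      by (auto simp: arc_rect_def trace_box_def in_cbox_complex_iff in_box_complex_iff)
    then show "R \<inter> drawing_body ?A [?T, ?B] = {}" by (auto simp: drawing_body_def)
    show "closed R" unfolding j(3) by (rule closed_cbox)
  qed
  then have eq: "draw ?A [?T, ?B] (contraction_regions k n) = draw ?A [?T, ?B] (strands ?cs)"
    by (simp add: far_strands_def)
  have T: "strand_number ?cs ?T = 0" "strand_number ?cs ?B = n"
    by (subst strand_number_none strand_number_all; auto simp: trace_box_def far_box_def)+
  have cs: "distinct ?cs" "\<forall>C\<in>{?A, ?T, ?B}. \<forall>c\<in>set ?cs. lft C < c \<and> c \<noteq> rgt C"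
    by (auto simp: distinct_map inj_on_def contraction_box_defs)
  have d: "diagram ?A [?T, ?B] (strands ?cs) (strand_number ?cs ?A) [0, n]"
    using strand_diagram[OF L cs(1)] cs(2) unfolding list.map list.set T by blast
  have L0: "layout ?T []" by (simp add: trace_box_def layout_def proper_def)
  have d0: "diagram ?T [] (strands ?cs) 0 []"
    using strand_diagram[OF L0 cs(1)] cs(2) unfolding list.map list.set T by blast
  have "unit (Col 0) = Z (draw ?T [] (strands (reals 1 0))) []"
    by (rule unit_eq_strands) (auto simp: trace_box_def proper_def)
  also have "draw ?T [] (strands (reals 1 0)) = draw ?T [] ([] @ strands ?cs @ [])"
    by (subst draw_remove[OF L0])
      (auto simp: strands_def closed_convex_half_plane drawing_body_def in_cbox_complex_iff trace_box_def)
  finally have unit0: "unit (Col 0) = Z (draw ?T [] (strands ?cs)) []" by simp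
  have "Z (draw ?A [?T, ?B] (strands ?cs)) [unit (Col 0), x] = Z (draw ?A [?B] (strands ?cs)) [x]"
    unfolding unit0 using Z_substitute_first[OF d d0, of "[]" "[x]"] assms by simp
  also have "\<dots> = x"
    by (rule Z_identity_strands[OF assms]) (auto simp: far_box_def frame_box_def layout_def nested_def proper_def)
  finally show ?thesis unfolding eq .
qed

text \<open>One drawing with the three boxes of \<open>w\<close>, \<open>x\<close> and
  \<open>y\<close> is cut in two ways. Along \<open>pair_box\<close> it is the contraction of
  \<open>w\<close> with the box formed from \<open>x\<close> and \<open>y\<close>; along
  \<open>trace_box\<close> it is the closed-up product of \<open>w\<close> and \<open>x\<close>, a
  scalar \<open>s\<close>, placed beside \<open>y\<close>.\<close>

lemma contraction:
  assumes "w \<in> P (Col k)" "x \<in> P (Col k)" "y \<in> P (Col n)"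
    and s: "Z (trace_tangle k) [mult (Col k) w x] = scale s (unit (Col 0))" and u: "unit (Col 0) \<in> P (Col 0)"
  shows "Z (draw (frame_box k n) [upper_box k, pair_box k n] (contraction_regions k n))
     [w, Z (draw (pair_box k n) [lower_box k, far_box k n] (contraction_regions k n)) [x, y]] = scale s y"
proof -
  let ?Rs = "contraction_regions k n" and ?A = "frame_box k n" and ?T = "trace_box k" and ?B = "far_box k n"
  note d = contraction_diagrams[where k=k and n=n]
  have "Z (draw ?A [upper_box k, pair_box k n] ?Rs) [w, Z (draw (pair_box k n) [lower_box k, ?B] ?Rs) [x, y]] =
      Z (draw ?A [upper_box k, lower_box k, ?B] ?Rs) [w, x, y]"
    using Z_substitute_second[OF d(5,4), of "[x, y]" w] assms by simp
  also have "\<dots> = Z (draw ?A [?T, ?B] ?Rs) [Z (draw ?T [upper_box k, lower_box k] ?Rs) [w, x], y]"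
    using Z_substitute_first[OF d(6,3), of "[w, x]" "[y]"] assms by simp
  also have "Z (draw ?T [upper_box k, lower_box k] ?Rs) [w, x] = Z (trace_tangle k) [mult (Col k) w x]"
    unfolding trace_tangle_eq[of k n] mult_eq_contraction[OF assms(1,2), of n]
    using Z_substitute_first[OF d(1,2), of "[w, x]" "[]"] assms by simp
  also have "Z (draw ?A [?T, ?B] ?Rs) [Z (trace_tangle k) [mult (Col k) w x], y] =
      scale s (Z (draw ?A [?T, ?B] ?Rs) [unit (Col 0), y])"
    unfolding s using Z_diagram_scale[OF d(6), of "[]" _ "[y]"] u assms by simp
  finally show ?thesis unfolding unit_beside[OF assms(3)] .
qed

end

section \<open>Stacking boxes\<close>

text \<open>An \<open>m\<close>-box \<open>y\<close> stacked above an \<open>N\<close>-box \<open>x\<close>, with the first \<open>m\<close> strands of \<open>x\<close> meeting \<open>y\<close>. The upper edge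
  of \<open>stack_cut\<close> passes through the middle of \<open>stack_top\<close>, between the cup and the cap if \<open>y\<close> is \<open>E m\<close>.\<close>

definition stack_frame :: "nat \<Rightarrow> rectangle" where
  "stack_frame N = (Complex (-1) (-6), Complex (real N + 2) 2)"

definition stack_top :: "nat \<Rightarrow> rectangle" where
  "stack_top m = (Complex 0 (-1), Complex (real m + 1/2) 1)"

definition stack_bottom :: "nat \<Rightarrow> rectangle" where
  "stack_bottom N = (Complex (-1/2) (-4), Complex (real N + 1) (-2))"

definition stack_cut :: "nat \<Rightarrow> rectangle" where
  "stack_cut N = (Complex (-3/4) (-5), Complex (real N + 3/2) 0)"

definition top_upper :: "nat \<Rightarrow> rectangle" where
  "top_upper m = (Complex (1/8) (1/3), Complex (real m + 1/4) (2/3))"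

definition top_lower :: "nat \<Rightarrow> rectangle" where
  "top_lower m = (Complex (1/8) (-2/3), Complex (real m + 1/4) (-1/3))"

lemmas stack_box_defs = stack_frame_def stack_top_def stack_bottom_def stack_cut_def top_upper_def top_lower_def

lemma strand_number_reals:
  assumes "m \<le> N" "real m < rgt B" "m < N \<Longrightarrow> rgt B \<le> real m + 1"
  shows "strand_number (reals 1 N) B = m"
proof -
  have "strand_number (reals 1 m) B = m"
    by (subst strand_number_all) (use assms in auto)
  moreover have "strand_number (reals (Suc m) N) B = 0"
    by (rule strand_number_none) (use assms in auto)
  moreover have "reals 1 N = reals 1 m @ reals (Suc m) N" using assms(1) by (intro reals_split) auto
  ultimately show ?thesis by (simp only: strand_number_append)
qed

lemma stack_diagrams:
  assumes "m \<le> N"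
  shows "diagram (stack_frame N) [stack_top m, stack_bottom N] (strands (reals 1 N)) N [m, N]" (is ?A)
    and "diagram (stack_frame N) [top_upper m, stack_cut N] (strands (reals 1 N)) N [m, N]" (is ?B)
    and "diagram (stack_cut N) [top_lower m, stack_bottom N] (strands (reals 1 N)) N [m, N]" (is ?C)
    and "diagram (stack_top m) [] (strands (reals 1 N)) m []" (is ?D)
    and "diagram (stack_top m) [top_upper m, top_lower m] (strands (reals 1 N)) m [m, m]" (is ?E)
proof -
  have L: "layout (stack_frame N) [stack_top m, stack_bottom N]" "layout (stack_frame N) [top_upper m, stack_cut N]"
    "layout (stack_cut N) [top_lower m, stack_bottom N]" "layout (stack_top m) []"
    "layout (stack_top m) [top_upper m, top_lower m]"
    using assms by (auto simp: layout_def nested_def apart_def proper_def stack_box_defs)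
  have n: "strand_number (reals 1 N) (stack_frame N) = N" "strand_number (reals 1 N) (stack_bottom N) = N"
    "strand_number (reals 1 N) (stack_cut N) = N" "strand_number (reals 1 N) (stack_top m) = m"
    "strand_number (reals 1 N) (top_upper m) = m" "strand_number (reals 1 N) (top_lower m) = m"
    using assms by (auto simp: stack_box_defs intro!: strand_number_reals simp del: One_nat_def)
  have ne: "real c \<noteq> real m + 1/2" "real c \<noteq> real m + 1/4" for c
  proof -
    have "real c \<le> real m \<or> real c \<ge> real m + 1" by (cases "c \<le> m") auto
    then show "real c \<noteq> real m + 1/2" "real c \<noteq> real m + 1/4" by auto
  qed
  have x: "\<forall>c\<in>set (reals 1 N). lft B < c \<and> c \<noteq> rgt B"
    if "B \<in> {stack_frame N, stack_top m, stack_bottom N, stack_cut N, top_upper m, top_lower m}" for B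
    using that ne assms by (auto simp: stack_box_defs)
  note d = strand_diagram[of _ _ "reals 1 N"]
  show ?A ?B ?C ?D ?E
    using d[OF L(1)] d[OF L(2)] d[OF L(3)] d[OF L(4)] d[OF L(5)] x
    by (simp_all add: n n[unfolded One_nat_def] distinct_map)
qed

lemma strands_restrict:
  assumes "layout B Cs" "m \<le> N" "rgt B < real m + 1"
  shows "draw B Cs (strands (reals 1 m)) = draw B Cs (strands (reals 1 N))"
proof -
  have "draw B Cs (strands (reals 1 m) @ strands (reals (Suc m) N) @ []) = draw B Cs (strands (reals 1 m) @ [])"
  proof (rule draw_remove[OF assms(1)], intro ballI conjI)
    fix R assume "R \<in> set (strands (reals (Suc m) N))"
    then obtain j where j: "Suc m \<le> j" "R = half_plane (real j)" unfolding set_strands by auto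
    show "closed R" unfolding j by (rule closed_convex_half_plane)
    show "R \<inter> drawing_body B Cs = {}"
      using assms(3) j by (auto simp: drawing_body_def in_cbox_complex_iff)
  qed
  moreover have "reals 1 N = reals 1 m @ reals (Suc m) N" using assms(2) by (intro reals_split) auto
  ultimately show ?thesis by (simp add: strands_append)
qed

context planar_algebra
begin

definition stack :: "nat \<Rightarrow> nat \<Rightarrow> 'v \<Rightarrow> 'v \<Rightarrow> 'v" where
  "stack m N y x = Z (draw (stack_frame N) [stack_top m, stack_bottom N] (strands (reals 1 N))) [y, x]"

lemma stack_closed: "m \<le> N \<Longrightarrow> y \<in> P (Col m) \<Longrightarrow> x \<in> P (Col N) \<Longrightarrow> stack m N y x \<in> P (Col N)"
  unfolding stack_def by (rule Z_diagram_closed[OF stack_diagrams(1)]) auto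

text \<open>The drawing of the unit has no internal box. Substituting it removes the upper box, and
  what remains is \<open>N\<close> strands through one box.\<close>

lemma stack_unit:
  assumes "m \<le> N" "x \<in> P (Col N)"
  shows "stack m N (unit (Col m)) x = x"
proof -
  note d = stack_diagrams[OF assms(1)]
  have L: "layout (stack_top m) []" using d(4) by (simp add: diagram_def)
  have "unit (Col m) = Z (draw (stack_top m) [] (strands (reals 1 m))) []"
    by (rule unit_eq_strands) (auto simp: stack_top_def proper_def)
  also have "draw (stack_top m) [] (strands (reals 1 m)) = draw (stack_top m) [] (strands (reals 1 N))"
    by (rule strands_restrict[OF L assms(1)]) (simp add: stack_top_def)
  finally have u: "unit (Col m) = Z (draw (stack_top m) [] (strands (reals 1 N))) []" .
  have "Z (draw (stack_frame N) [stack_bottom N] (strands (map (\<lambda>j. 0 + real j) [1..<Suc N]))) [x] = x"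
    by (rule Z_identity_strands[OF assms(2)]) (auto simp: stack_box_defs layout_def nested_def proper_def)
  then show ?thesis
    unfolding stack_def u using Z_substitute_first[OF d(1,4), of "[]" "[x]"] assms by simp
qed

lemma stack_isotopic:
  assumes "m \<le> N" "y \<in> P (Col m)" "x \<in> P (Col N)" "layout A [Y, X]"
    and "lft X < lft Y" "lft Y < 1" "real m < rgt Y" "rgt Y < real m + 1" "rgt Y < rgt X" "real N < rgt X"
      "hi X < lo Y"
  shows "Z (draw A [Y, X] (strands (reals 1 N))) [y, x] = stack m N y x"
proof -
  let ?A = "stack_frame N" and ?Y = "stack_top m" and ?X = "stack_bottom N"
  \<comment> \<open>The right side of the upper box passes between the strands \<open>m\<close> and
    \<open>m + 1\<close>, hence the extra coordinate between the two groups of strands.\<close>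
  let ?us = "[-1, -1/2, 0] @ reals 1 m @ [real m + 1/2] @ reals (Suc m) N @ [real N + 1, real N + 2]"
  let ?us' = "[lft A, lft X, lft Y] @ reals 1 m @ [rgt Y] @ reals (Suc m) N @ [rgt X, rgt A]"
  let ?vs' = "[lo A, lo X, hi X, lo Y, hi Y, hi A]"
  have lay: "lft A < lft X" "rgt X < rgt A" "lo A < lo X" "hi Y < hi A" "lo Y < hi Y" "lo X < hi X" "lft Y < rgt Y"
    using assms(4) by (auto simp: layout_def nested_def proper_def)
  have split: "reals 1 N = reals 1 m @ reals (Suc m) N" using assms(1) by (intro reals_split) auto
  show ?thesis
    unfolding stack_def
  proof (rule Z_strands_isotopic[OF stack_diagrams(1)[OF assms(1)], where us="?us" and us'="?us'"
        and vs="[-6,-4,-2,-1,1,2]" and vs'="?vs'"])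
    show "sorted_wrt (<) ?us" using assms(1) by (auto simp: sorted_wrt_append)
    show "sorted_wrt (<) ?us'" using assms lay by (auto simp: sorted_wrt_append)
    show "sorted_wrt (<) ?vs'" using assms lay by auto
    fix f g :: "real \<Rightarrow> real" assume fg: "map f ?us = ?us'" "map g [-6,-4,-2,-1,1,2] = ?vs'"
    then have "f (-1) = lft A" "f (-1/2) = lft X" "f 0 = lft Y" "map f (reals 1 m) = reals 1 m"
      "f (real m + 1/2) = rgt Y" "map f (reals (Suc m) N) = reals (Suc m) N"
      "f (real N + 1) = rgt X" "f (real N + 2) = rgt A"
      by simp_all
    then show "grid_rect f g ?A = A \<and> map (grid_rect f g) [?Y, ?X] = [Y, X] \<and> map f (reals 1 N) = reals 1 N"
      using fg(2) unfolding split by (auto simp: prod_eq_iff complex_eq_iff stack_box_defs)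
  qed (use assms in auto)
qed

text \<open>Substituting the product gives three boxes above one another; grouping the lower two by
  \<open>stack_cut\<close> instead gives the iterated stack. Both groupings are in the standard
  position up to a grid isotopy.\<close>

lemma stack_mult:
  assumes "m \<le> N" "y \<in> P (Col m)" "y' \<in> P (Col m)" "x \<in> P (Col N)"
  shows "stack m N (mult (Col m) y y') x = stack m N y (stack m N y' x)"
proof -
  let ?Rs = "strands (reals 1 N)"
  note d = stack_diagrams[OF assms(1)]
  have L: "layout (stack_top m) [top_upper m, top_lower m]" "layout (stack_frame N) [top_upper m, stack_cut N]"
    "layout (stack_cut N) [top_lower m, stack_bottom N]"
    using d by (simp_all add: diagram_def)
  have "mult (Col m) y y' = Z (draw (stack_top m) [top_upper m, top_lower m] (strands (reals 1 m))) [y, y']"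
    by (rule mult_eq_strands) (use assms L in \<open>auto simp: stack_box_defs\<close>)
  also have "draw (stack_top m) [top_upper m, top_lower m] (strands (reals 1 m)) =
      draw (stack_top m) [top_upper m, top_lower m] ?Rs"
    by (rule strands_restrict[OF L(1) assms(1)]) (simp add: stack_top_def)
  finally have u: "mult (Col m) y y' = Z (draw (stack_top m) [top_upper m, top_lower m] ?Rs) [y, y']" .
  have "stack m N (mult (Col m) y y') x =
      Z (draw (stack_frame N) [stack_top m, stack_bottom N] ?Rs) [mult (Col m) y y', x]"
    by (simp only: stack_def)
  also have "\<dots> = Z (draw (stack_frame N) [top_upper m, top_lower m, stack_bottom N] ?Rs) [y, y', x]"
    unfolding u using Z_substitute_first[OF d(1,5), of "[y, y']" "[x]"] assms by simp
  also have "\<dots> = Z (draw (stack_frame N) [top_upper m, stack_cut N] ?Rs)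
      [y, Z (draw (stack_cut N) [top_lower m, stack_bottom N] ?Rs) [y', x]]"
    using Z_substitute_second[OF d(2,3), of "[y', x]" y] assms by simp
  also have "Z (draw (stack_cut N) [top_lower m, stack_bottom N] ?Rs) [y', x] = stack m N y' x"
    by (rule stack_isotopic) (use assms L in \<open>auto simp: stack_box_defs\<close>)
  also have "Z (draw (stack_frame N) [top_upper m, stack_cut N] ?Rs) [y, stack m N y' x] = stack m N y (stack m N y' x)"
    by (rule stack_isotopic) (use assms L stack_closed in \<open>auto simp: stack_box_defs\<close>)
  finally show ?thesis .
qed

end

subsection \<open>The Jones projection\<close>

text \<open>The points at distance at most 1/2 from a vertical piece of line. For a half-line this
  is a strip of width 1 closed by a half-disc: its frontier is an arc of the Jones diagram whose
  ends continue as vertical strands outside the box, which the frontier of a disc does not do. The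
  form as a sum of a closed and a compact convex set yields closedness and convexity.\<close>

definition stadium :: "real set \<Rightarrow> real \<Rightarrow> complex set" where
  "stadium I c = {u + v |u v. u \<in> {z. Re z = c \<and> Im z \<in> I} \<and> v \<in> cball 0 (1/2)}"

lemma in_stadium_iff: "z \<in> stadium I c \<longleftrightarrow> (\<exists>s\<in>I. dist z (Complex c s) \<le> 1/2)"
proof
  assume "z \<in> stadium I c"
  then obtain u v where uv: "z = u + v" "Re u = c" "Im u \<in> I" "norm v \<le> 1/2"
    by (auto simp: stadium_def)
  moreover have "u = Complex c (Im u)" using uv(2) by (simp add: complex_eq_iff)
  ultimately have "dist z (Complex c (Im u)) \<le> 1/2" by (metis add_diff_cancel_left' dist_norm)
  then show "\<exists>s\<in>I. dist z (Complex c s) \<le> 1/2" using uv(3) by blast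
next
  assume "\<exists>s\<in>I. dist z (Complex c s) \<le> 1/2"
  then obtain s where s: "s \<in> I" "dist z (Complex c s) \<le> 1/2" by blast
  then have "z = Complex c s + (z - Complex c s)" "z - Complex c s \<in> cball 0 (1/2)"
    by (auto simp: dist_norm norm_minus_commute)
  then show "z \<in> stadium I c" unfolding stadium_def using s(1) by fastforce
qed

lemma stadium_region:
  assumes "closed I" "convex I" "a \<in> I"
  shows "closed (stadium I c)" "convex (stadium I c)" "interior (stadium I c) \<noteq> {}"
proof -
  let ?l = "{z. Re z = c \<and> Im z \<in> I}"
  have l: "?l = {z. Re z = c} \<inter> Im -` I" by auto
  have "closed ?l"
    unfolding l using assms(1)
    by (intro closed_Int closed_vimage continuous_intros) (auto intro!: closed_Collect_eq continuous_intros)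
  then have "closed (\<Union>u\<in>?l. \<Union>v\<in>cball 0 (1/2). {u + v})"
    by (rule closed_compact_sums) simp
  moreover have "convex ?l"
  proof -
    have "convex (Re -` {c} \<inter> Im -` I)"
      using assms(2) by (intro convex_Int convex_linear_vimage bounded_linear.linear bounded_linear_Re bounded_linear_Im) auto
    moreover have "?l = Re -` {c} \<inter> Im -` I" by auto
    ultimately show ?thesis by simp
  qed
  then have "convex (\<Union>u\<in>?l. \<Union>v\<in>cball 0 (1/2). {u + v})"
    by (rule convex_sums) simp
  moreover have "(\<Union>u\<in>?l. \<Union>v\<in>cball 0 (1/2). {u + v}) = stadium I c"
    unfolding stadium_def by blast
  ultimately show "closed (stadium I c)" "convex (stadium I c)" by simp_all
  have "ball (Complex c a) (1/2) \<subseteq> stadium I c"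
    using assms(3) unfolding subset_eq in_stadium_iff by (auto simp: dist_commute intro!: bexI[of _ a])
  then have "ball (Complex c a) (1/2) \<subseteq> interior (stadium I c)"
    by (rule interior_maximal) simp
  then show "interior (stadium I c) \<noteq> {}" by auto
qed

lemma stadium_bounds:
  assumes "z \<in> stadium I c"
  shows "\<bar>Re z - c\<bar> \<le> 1/2" "\<exists>s\<in>I. \<bar>Im z - s\<bar> \<le> 1/2"
proof -
  obtain s where s: "s \<in> I" "dist z (Complex c s) \<le> 1/2" using assms in_stadium_iff by blast
  then show "\<bar>Re z - c\<bar> \<le> 1/2" "\<exists>s\<in>I. \<bar>Im z - s\<bar> \<le> 1/2"
    using abs_Re_le_cmod[of "z - Complex c s"] abs_Im_le_cmod[of "z - Complex c s"]
    by (auto simp: dist_norm intro!: bexI[of _ s])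
qed

lemma stadium_on_axis:
  assumes "y \<in> I" "closed I" "convex I"
  shows "Complex x y \<in> stadium I c \<longleftrightarrow> \<bar>x - c\<bar> \<le> 1/2"
    "Complex x y \<in> frontier (stadium I c) \<longleftrightarrow> \<bar>x - c\<bar> = 1/2"
    "Complex c y \<in> interior (stadium I c)"
proof -
  have d: "dist (Complex x y) (Complex x' y) = \<bar>x - x'\<bar>" for x x'
    by (simp add: dist_norm cmod_def)
  show in_iff: "Complex x y \<in> stadium I c \<longleftrightarrow> \<bar>x - c\<bar> \<le> 1/2" for x
  proof
    show "\<bar>x - c\<bar> \<le> 1/2 \<Longrightarrow> Complex x y \<in> stadium I c"
      using assms(1) d[of x c] unfolding in_stadium_iff by (intro bexI[of _ y]) auto
  qed (use stadium_bounds(1)[of "Complex x y" I c] in simp)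
  have "ball (Complex c y) (1/2) \<subseteq> stadium I c"
    using assms(1) unfolding subset_eq in_stadium_iff by (auto simp: dist_commute intro!: bexI[of _ y])
  then have int: "ball (Complex c y) (1/2) \<subseteq> interior (stadium I c)"
    by (rule interior_maximal) simp
  then show "Complex c y \<in> interior (stadium I c)" by auto
  have "frontier (stadium I c) \<subseteq> stadium I c"
    using stadium_region(1)[OF assms(2,3,1)] by (rule frontier_subset_closed)
  moreover have "Complex x y \<notin> frontier (stadium I c)" if "\<bar>x - c\<bar> < 1/2"
    using that int d[of c x] unfolding frontier_def by (auto simp: abs_minus_commute)
  moreover have "Complex x y \<in> frontier (stadium I c)" if "\<bar>x - c\<bar> = 1/2"
    unfolding frontier_straddle
  proof (intro allI impI conjI)
    fix e :: real assume e: "e > 0"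
    show "\<exists>z\<in>stadium I c. dist (Complex x y) z < e"
      using that in_iff e by (intro bexI[of _ "Complex x y"]) auto
    define x' where "x' = x + (if x > c then e/2 else - e/2)"
    have "\<not> \<bar>x' - c\<bar> \<le> 1/2" "\<bar>x - x'\<bar> < e" using that e by (auto simp: x'_def abs_if split: if_splits)
    then show "\<exists>z. z \<notin> stadium I c \<and> dist (Complex x y) z < e"
      using in_iff d by (intro exI[of _ "Complex x' y"]) auto
  qed
  ultimately show "Complex x y \<in> frontier (stadium I c) \<longleftrightarrow> \<bar>x - c\<bar> = 1/2"
    using in_iff by (metis linorder_less_linear less_eq_real_def subsetD)
qed

text \<open>Among the centres on the axis, the one at height \<open>a\<close> is the nearest to
  \<open>z\<close>, so only its disc matters.\<close>

lemma stadium_cball: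
  assumes "a \<in> I" "\<And>s. s \<in> I \<Longrightarrow> \<bar>Im z - a\<bar> \<le> \<bar>Im z - s\<bar>"
  shows "z \<in> stadium I c \<longleftrightarrow> z \<in> cball (Complex c a) (1/2)"
proof -
  have "dist z (Complex c a) \<le> dist z (Complex c s)" if "s \<in> I" for s
  proof -
    have "(Im z - a)\<^sup>2 \<le> (Im z - s)\<^sup>2" using assms(2)[OF that] by (simp add: abs_le_square_iff)
    then show ?thesis unfolding dist_norm cmod_def by (intro real_sqrt_le_mono) simp
  qed
  then show ?thesis
    using assms(1) unfolding in_stadium_iff mem_cball dist_commute[of "Complex c a" z]
    by (meson order_trans)
qed

text \<open>The two stadia replace the strands \<open>m - 1\<close> and \<open>m\<close>, between
  which they are centred: their frontiers join the last two upper points and the last two lower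
  points of the Jones box. The strands from \<open>Suc m\<close> on pass to the right of that
  box.\<close>

definition jones_regions :: "nat \<Rightarrow> nat \<Rightarrow> complex set list" where
  "jones_regions m N = strands (reals 1 (m - 2)) @
     [stadium {1..} (real m - 1/2), stadium {..-1} (real m - 1/2)] @ strands (reals (Suc m) N)"

lemma stadium_up:
  "z \<in> stadium {1..} c \<Longrightarrow> \<bar>Re z - c\<bar> \<le> 1/2 \<and> 1/2 \<le> Im z"
  "z \<in> frontier (stadium {1..} c) \<Longrightarrow> z \<in> stadium {1..} c"
proof -
  show "\<bar>Re z - c\<bar> \<le> 1/2 \<and> 1/2 \<le> Im z" if z: "z \<in> stadium {1..} c"
  proof -
    obtain s where "s \<ge> 1" "\<bar>Im z - s\<bar> \<le> 1/2" using stadium_bounds(2)[OF z] by auto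
    then have "1/2 \<le> Im z" by linarith
    then show ?thesis using stadium_bounds(1)[OF z] by blast
  qed
  have "closed (stadium {1..} c)" by (rule stadium_region[of _ 1]) auto
  then show "z \<in> frontier (stadium {1..} c) \<Longrightarrow> z \<in> stadium {1..} c"
    using frontier_subset_closed by blast
qed

lemma stadium_down:
  "z \<in> stadium {..-1} c \<Longrightarrow> \<bar>Re z - c\<bar> \<le> 1/2 \<and> Im z \<le> -1/2"
  "z \<in> frontier (stadium {..-1} c) \<Longrightarrow> z \<in> stadium {..-1} c"
proof -
  show "\<bar>Re z - c\<bar> \<le> 1/2 \<and> Im z \<le> -1/2" if z: "z \<in> stadium {..-1} c"
  proof -
    obtain s where "s \<le> -1" "\<bar>Im z - s\<bar> \<le> 1/2" using stadium_bounds(2)[OF z] by auto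
    then have "Im z \<le> -1/2" by linarith
    then show ?thesis using stadium_bounds(1)[OF z] by blast
  qed
  have "closed (stadium {..-1} c)" by (rule stadium_region[of _ "-1"]) auto
  then show "z \<in> frontier (stadium {..-1} c) \<Longrightarrow> z \<in> stadium {..-1} c"
    using frontier_subset_closed by blast
qed

lemma regions_jones:
  assumes "2 \<le> m"
  shows "regions (jones_regions m N)"
proof -
  let ?c = "real m - 1/2"
  have s: "regions [stadium {1..} ?c, stadium {..-1} ?c]"
  proof -
    have "frontier (stadium {1..} ?c) \<inter> frontier (stadium {..-1} ?c) = {}"
    proof (rule equals0I)
      fix z assume "z \<in> frontier (stadium {1..} ?c) \<inter> frontier (stadium {..-1} ?c)"
      then have "z \<in> stadium {1..} ?c" "z \<in> stadium {..-1} ?c"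
        using stadium_up(2) stadium_down(2) by blast+
      then have "1/2 \<le> Im z" "Im z \<le> -1/2" using stadium_up(1) stadium_down(1) by blast+
      then show False by simp
    qed
    then show ?thesis
      using stadium_region[of "{1..}" 1 ?c] stadium_region[of "{..-1}" "-1" ?c] by (simp add: regions_def)
  qed
  have re: "real m - 1 \<le> Re z \<and> Re z \<le> real m"
    if "R \<in> set [stadium {1..} ?c, stadium {..-1} ?c]" "z \<in> frontier R" for R z
  proof -
    have "\<bar>Re z - ?c\<bar> \<le> 1/2"
      using that stadium_up[of z ?c] stadium_down[of z ?c] by auto
    then show ?thesis by linarith
  qed
  have left: "Re z < real m - 1" if "R \<in> set (strands (reals 1 (m - 2)))" "z \<in> frontier R" for R z
    using that assms unfolding set_strands by (auto simp: frontier_half_plane)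
  have right: "Re z > real m" if "R \<in> set (strands (reals (Suc m) N))" "z \<in> frontier R" for R z
    using that assms unfolding set_strands by (auto simp: frontier_half_plane)
  have "regions (strands (reals i j))" for i j
    by (rule regions_strands) (simp add: distinct_map)
  moreover have "frontier R \<inter> frontier R' = {}"
    if "R \<in> set (strands (reals 1 (m - 2)))"
      "R' \<in> set [stadium {1..} ?c, stadium {..-1} ?c] \<union> set (strands (reals (Suc m) N))" for R R'
  proof (rule equals0I)
    fix z assume z: "z \<in> frontier R \<inter> frontier R'"
    then have "Re z < real m - 1" using left[OF that(1)] by blast
    moreover have "Re z \<ge> real m - 1"
      using that(2) z re[of R' z] right[of R' z] by (elim UnE) auto
    ultimately show False by simp
  qed
  moreover have "frontier R \<inter> frontier R' = {}"
    if "R \<in> set [stadium {1..} ?c, stadium {..-1} ?c]" "R' \<in> set (strands (reals (Suc m) N))" for R R'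
  proof (rule equals0I)
    fix z assume z: "z \<in> frontier R \<inter> frontier R'"
    then have "Re z \<le> real m" using re[OF that(1)] by blast
    moreover have "Re z > real m" using right[OF that(2)] z by blast
    ultimately show False by simp
  qed
  ultimately show ?thesis
    unfolding jones_regions_def regions_append set_append using s by blast
qed

lemma curves_jones:
  assumes "2 \<le> m" "m \<le> N"
  shows "1 \<le> \<bar>y\<bar> \<Longrightarrow> Complex x y \<in> curves (jones_regions m N) \<longleftrightarrow> x \<in> real ` {1..N}"
    "\<bar>y\<bar> < 1/2 \<Longrightarrow> Complex x y \<in> curves (jones_regions m N) \<longleftrightarrow> x \<in> real ` ({1..m-2} \<union> {Suc m..N})"
proof -
  let ?c = "real m - 1/2"
  have c: "Complex x y \<in> curves (jones_regions m N) \<longleftrightarrow> x \<in> real ` {1..m-2} \<or>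
      Complex x y \<in> frontier (stadium {1..} ?c) \<or> Complex x y \<in> frontier (stadium {..-1} ?c) \<or> x \<in> real ` {Suc m..N}"
    unfolding jones_regions_def curves_append curves_Cons curves_Nil Un_iff curves_strands set_reals by blast
  have "{1..N} = {1..m-2} \<union> {m-1, m} \<union> {Suc m..N}" using assms by auto
  then have N: "x \<in> real ` {1..N} \<longleftrightarrow> x \<in> real ` {1..m-2} \<or> x = real m - 1 \<or> x = real m \<or> x \<in> real ` {Suc m..N}"
    using assms(1) by (simp add: image_Un of_nat_diff) blast
  have half: "\<bar>x - ?c\<bar> = 1/2 \<longleftrightarrow> x = real m - 1 \<or> x = real m" by (auto simp: abs_if)
  show "Complex x y \<in> curves (jones_regions m N) \<longleftrightarrow> x \<in> real ` {1..N}" if y: "1 \<le> \<bar>y\<bar>"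
  proof (cases "y \<ge> 1")
    case True
    then have "Complex x y \<notin> frontier (stadium {..-1} ?c)" using stadium_down[of "Complex x y" ?c] by auto
    then show ?thesis
      unfolding c N using stadium_on_axis(2)[of y "{1..}" x ?c] True half by auto
  next
    case False
    then have "y \<le> -1" using y by auto
    then have "Complex x y \<notin> frontier (stadium {1..} ?c)" using stadium_up[of "Complex x y" ?c] by auto
    then show ?thesis
      unfolding c N using stadium_on_axis(2)[of y "{..-1}" x ?c] \<open>y \<le> -1\<close> half by auto
  qed
  show "Complex x y \<in> curves (jones_regions m N) \<longleftrightarrow> x \<in> real ` ({1..m-2} \<union> {Suc m..N})" if y: "\<bar>y\<bar> < 1/2"
    using c y stadium_down[of "Complex x y" ?c] stadium_up[of "Complex x y" ?c] by (auto simp: image_Un)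
qed

lemma crosses_stadium:
  assumes I: "closed I" "convex I" "I \<noteq> {}" and B: "lft B < c - 1/2" "c + 1/2 < rgt B"
    and y: "\<forall>y\<in>{lo B, hi B}. y \<in> I \<or> (\<forall>s\<in>I. 1/2 < \<bar>y - s\<bar>)"
  shows "crosses (stadium I c) B"
proof -
  obtain a where "a \<in> I" using I(3) by blast
  then have fr: "frontier (stadium I c) \<subseteq> stadium I c"
    using stadium_region(1)[OF I(1,2)] by (intro frontier_subset_closed)
  have "Complex (lft B) y \<notin> stadium I c" "Complex (rgt B) y \<notin> stadium I c" for y
    using stadium_bounds(1)[of "Complex (lft B) y" I c] stadium_bounds(1)[of "Complex (rgt B) y" I c] B by auto
  moreover have "(\<exists>x. Complex x y \<in> interior (stadium I c)) \<or> (\<forall>x\<in>{lft B..rgt B}. Complex x y \<notin> frontier (stadium I c))"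
    if "y \<in> {lo B, hi B}" for y
  proof (cases "y \<in> I")
    case True
    then show ?thesis using stadium_on_axis(3)[OF _ I(1,2)] by blast
  next
    case False
    then have "Complex x y \<notin> stadium I c" for x
      using y that stadium_bounds(2)[of "Complex x y" I c] by fastforce
    then show ?thesis using fr by blast
  qed
  ultimately show ?thesis using fr unfolding crosses_def by blast
qed

lemma crosses_jones:
  assumes "2 \<le> m" "m \<le> N" "B \<in> {stack_frame N, stack_top m, stack_bottom N, stack_cut N}"
    and "R \<in> set (jones_regions m N)"
  shows "crosses R B"
proof -
  have m: "real m \<ge> 2" "real m \<le> real N" using assms by auto
  consider j where "j \<in> {1..m-2} \<union> {Suc m..N}" "R = half_plane (real j)"
    | "R = stadium {1..} (real m - 1/2)" | "R = stadium {..-1} (real m - 1/2)"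
    using assms(4) unfolding jones_regions_def set_append set_strands list.set by blast
  then show ?thesis
  proof cases
    case 1
    then have "real j \<noteq> real m + 1/2"
    proof -
      have "real j \<le> real m \<or> real j \<ge> real m + 1" using 1 by auto
      then show ?thesis by auto
    qed
    moreover have "1 \<le> real j" "real j \<le> real N" using 1 assms by auto
    ultimately show ?thesis
      unfolding 1(2) by (intro crosses_half_plane) (use assms(3) in \<open>auto simp: stack_box_defs\<close>)
  next
    case 2
    then show ?thesis
      using assms(3) m unfolding 2 by (intro crosses_stadium) (auto simp: stack_box_defs)
  next
    case 3
    then show ?thesis
      using assms(3) m unfolding 3 by (intro crosses_stadium) (auto simp: stack_box_defs)
  qed
qed

lemma marked_jones:
  assumes "2 \<le> m" "m \<le> N"
  shows "marked (jones_regions m N) (stack_frame N) N" "marked (jones_regions m N) (stack_bottom N) N"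
    "marked (jones_regions m N) (stack_top m) m" "marked (jones_regions m N) (stack_cut N) (N - 1)"
proof -
  note cr = crosses_jones[OF assms] and c = curves_jones[OF assms]
  have card: "card (real ` {1..n}) = n" for n using card_real_images(1)[of 1 n] by simp
  note card = card card[unfolded One_nat_def]
  show "marked (jones_regions m N) (stack_frame N) N"
    by (rule markedI[where X="real ` {1..N}" and Y="real ` {1..N}"], simp add: stack_box_defs proper_def,
        rule regions_jones[OF assms(1)], rule cr, simp, assumption)
      (auto simp: stack_frame_def c card)
  show "marked (jones_regions m N) (stack_bottom N) N"
    by (rule markedI[where X="real ` {1..N}" and Y="real ` {1..N}"], simp add: stack_box_defs proper_def,
        rule regions_jones[OF assms(1)], rule cr, simp, assumption)
      (auto simp: stack_bottom_def c card)
  have top: "x \<in> real ` {1..N} \<longleftrightarrow> x \<in> real ` {1..m}" if "x \<le> real m + 1/2" for x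
  proof
    assume "x \<in> real ` {1..N}"
    then obtain j where j: "j \<in> {1..N}" "x = real j" by blast
    then have "real j < real (Suc m)" using that by simp
    then have "j \<le> m" unfolding of_nat_less_iff by simp
    then show "x \<in> real ` {1..m}" using j by auto
  qed (use assms in auto)
  show "marked (jones_regions m N) (stack_top m) m"
    by (rule markedI[where X="real ` {1..m}" and Y="real ` {1..m}"], simp add: stack_box_defs proper_def,
        rule regions_jones[OF assms(1)], rule cr, simp, assumption)
      (auto simp: stack_top_def c card top top[unfolded One_nat_def])
  \<comment> \<open>At height 0, between the two stadia, the strands \<open>m - 1\<close> and
    \<open>m\<close> are missing. The upper edge of \<open>stack_cut\<close> thus carries
    \<open>N - 2\<close> points and its lower edge \<open>N\<close>, which makes it an
    \<open>(N - 1)\<close>-box.\<close>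
  have "card (real ` ({1..m-2} \<union> {Suc m..N})) = N - 2"
  proof -
    have "card ({1..m-2} \<union> {Suc m..N}) = N - 2" using assms by (subst card_Un_disjoint) auto
    then show ?thesis by (subst card_image) auto
  qed
  then show "marked (jones_regions m N) (stack_cut N) (N - 1)"
    using assms
    by - (rule markedI[where X="real ` {1..N}" and Y="real ` ({1..m-2} \<union> {Suc m..N})"], simp add: stack_box_defs proper_def,
        rule regions_jones[OF assms(1)], rule cr, simp, assumption,
        auto simp: stack_cut_def c card simp del: One_nat_def image_Un Un_iff)
qed

lemma jones_diagrams:
  assumes "2 \<le> m" "m \<le> N"
  shows "diagram (stack_frame N) [stack_cut N] (jones_regions m N) N [N - 1]" (is ?A)
    and "diagram (stack_cut N) [stack_bottom N] (jones_regions m N) (N - 1) [N]" (is ?B)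
    and "diagram (stack_frame N) [stack_top m, stack_bottom N] (jones_regions m N) N [m, N]" (is ?C)
    and "diagram (stack_top m) [] (jones_regions m N) m []" (is ?D)
proof -
  have L: "layout (stack_frame N) [stack_cut N]" "layout (stack_cut N) [stack_bottom N]"
    "layout (stack_frame N) [stack_top m, stack_bottom N]" "layout (stack_top m) []"
    using assms by (auto simp: layout_def proper_def nested_def apart_def stack_box_defs)
  note d = diagramI[OF _ regions_jones[OF assms(1)]] and m = marked_jones[OF assms]
  show ?A ?B ?C ?D
    using d[OF L(1) m(1)] d[OF L(2) m(4)] d[OF L(3) m(1)] d[OF L(4) m(3)] m by simp_all
qed

text \<open>The lists differ only between heights -1 and 1, where the relevant strip is hidden
  inside \<open>stack_top\<close>. At all other heights exactly one stadium appears, as the strip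
  between the strands \<open>m - 1\<close> and \<open>m\<close>; this is also where a point lies in
  one of the two replaced half-planes but not in the other, so the parity is the same.\<close>

lemma stack_jones_regions:
  assumes "2 \<le> m" "m \<le> N"
  shows "draw (stack_frame N) [stack_top m, stack_bottom N] (strands (reals 1 N)) =
    draw (stack_frame N) [stack_top m, stack_bottom N] (jones_regions m N)"
proof (rule draw_cong)
  let ?D = "drawing_body (stack_frame N) [stack_top m, stack_bottom N]" and ?c = "real m - 1/2"
  show "layout (stack_frame N) [stack_top m, stack_bottom N]"
    using jones_diagrams(3)[OF assms] by (simp add: diagram_def)
  have D: "1 \<le> \<bar>Im z\<bar> \<or> Re z \<le> 0 \<or> Re z \<ge> real m + 1/2" if "z \<in> ?D" for z
    using that by (auto simp: drawing_body_def stack_top_def in_box_complex_iff not_less)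
  have split: "reals 1 N = reals 1 (m-2) @ [real m - 1, real m] @ reals (Suc m) N"
  proof -
    have "[m-1..<Suc m] = [m-1, m]" using assms(1) by (simp add: upt_rec)
    moreover have "reals 1 N = reals 1 (m-2) @ reals (Suc (m-2)) N" using assms by (intro reals_split) auto
    moreover have "reals (Suc (m-2)) N = reals (Suc (m-2)) m @ reals (Suc m) N"
      using assms by (intro reals_split) auto
    ultimately show ?thesis using assms(1) by (simp add: Suc_diff_Suc numeral_2_eq_2 of_nat_diff)
  qed
  have out: "\<not> \<bar>Re z - ?c\<bar> \<le> 1/2" if "Re z \<le> 0 \<or> Re z \<ge> real m + 1/2" for z
    using that assms(1) by (auto simp: abs_if)
  have "z \<in> curves (strands (reals 1 N)) \<longleftrightarrow> z \<in> curves (jones_regions m N)" if z: "z \<in> ?D" for z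
  proof (cases "1 \<le> \<bar>Im z\<bar>")
    case True
    then show ?thesis
      using curves_jones(1)[OF assms, of "Im z" "Re z"] unfolding curves_strands_iff set_reals by simp
  next
    case False
    then have "Re z \<le> 0 \<or> Re z \<ge> real m + 1/2" using D[OF z] by blast
    moreover have "z \<notin> frontier (stadium {1..} ?c)" "z \<notin> frontier (stadium {..-1} ?c)"
      using out[OF calculation] stadium_up[of z ?c] stadium_down[of z ?c] by blast+
    moreover have "Re z \<noteq> real m - 1" "Re z \<noteq> real m" using calculation(1) assms(1) by auto
    ultimately show ?thesis
      unfolding split jones_regions_def curves_append curves_Cons curves_Nil Un_iff curves_strands_iff set_append by simp
  qed
  then show "?D \<inter> curves (strands (reals 1 N)) = ?D \<inter> curves (jones_regions m N)" by blast
  fix z assume z: "z \<in> ?D" "z \<notin> curves (strands (reals 1 N))"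
  have ne: "Re z \<noteq> real m" using z(2) assms unfolding curves_strands_iff split by simp
  have "z \<in> shaded (strands [real m - 1, real m]) \<longleftrightarrow> z \<in> shaded [stadium {1..} ?c, stadium {..-1} ?c]"
  proof -
    have 1: "z \<in> shaded (strands [real m - 1, real m]) \<longleftrightarrow> \<bar>Re z - ?c\<bar> \<le> 1/2"
      using ne by (auto simp: strands_def shaded_Cons shaded_Nil abs_if)
    have 2: "\<bar>Re z - ?c\<bar> \<le> 1/2 \<longleftrightarrow> (z \<in> stadium {1..} ?c \<or> z \<in> stadium {..-1} ?c)"
    proof (cases "1 \<le> \<bar>Im z\<bar>")
      case True
      then have "Im z \<in> {1..} \<or> Im z \<in> {..-1}" by auto
      then show ?thesis
        using stadium_on_axis(1)[of "Im z" "{1..}" "Re z" ?c] stadium_on_axis(1)[of "Im z" "{..-1}" "Re z" ?c]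
          stadium_up(1)[of z ?c] stadium_down(1)[of z ?c] by auto
    next
      case False
      then show ?thesis
        using D[OF z(1)] out[of z] stadium_up(1)[of z ?c] stadium_down(1)[of z ?c] by blast
    qed
    have "\<not> (z \<in> stadium {1..} ?c \<and> z \<in> stadium {..-1} ?c)"
      using stadium_up(1)[of z ?c] stadium_down(1)[of z ?c] by auto
    then show ?thesis unfolding 1 2 by (auto simp: shaded_Cons shaded_Nil)
  qed
  then show "z \<in> shaded (strands (reals 1 N)) \<longleftrightarrow> z \<in> shaded (jones_regions m N)"
    unfolding split strands_append jones_regions_def shaded_append by simp
qed

lemma jones_tangle_eq:
  assumes "2 \<le> m"
  shows "jones_tangle m = draw (Complex 0 (-1), Complex (real m + 1) 1) [] (jones_regions m m)"
proof -
  let ?A = "(Complex 0 (-1), Complex (real m + 1) 1)" and ?c = "real m - 1/2"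
  have L: "layout ?A []" by (simp add: layout_def proper_def)
  have "jones_tangle m = draw ?A [] (strands (reals 1 (m - 2)) @ [cball (Complex ?c 1) (1/2), cball (Complex ?c (-1)) (1/2)])"
    by (simp add: jones_tangle_def vertical_strands_eq)
  also have "\<dots> = draw ?A [] (strands (reals 1 (m - 2)) @ [stadium {1..} ?c, stadium {..-1} ?c])"
  proof (rule draw_cong_list[OF L])
    have body: "\<bar>Im z\<bar> \<le> 1" if "z \<in> drawing_body ?A []" for z
      using that by (auto simp: drawing_body_def in_cbox_complex_iff)
    have up: "z \<in> stadium {1..} ?c \<longleftrightarrow> z \<in> cball (Complex ?c 1) (1/2)" if "Im z \<le> 1" for z
      by (rule stadium_cball) (use that in auto)
    have down: "z \<in> stadium {..-1} ?c \<longleftrightarrow> z \<in> cball (Complex ?c (-1)) (1/2)" if "Im z \<ge> -1" for z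
      by (rule stadium_cball) (use that in auto)
    have sph: "Complex x y \<in> frontier (cball (Complex ?c y) (1/2)) \<longleftrightarrow> \<bar>x - ?c\<bar> = 1/2" for x y
      by (simp add: dist_norm cmod_def abs_minus_commute)
    \<comment> \<open>Below height 1 the sets agree locally, hence so do their frontiers. At height
      1 they differ just above, and the frontier points there are compared directly: both are the
      two points at distance 1/2 from the axis.\<close>
    have fup: "z \<in> frontier (stadium {1..} ?c) \<longleftrightarrow> z \<in> frontier (cball (Complex ?c 1) (1/2))" if "Im z \<le> 1" for z
    proof (cases "Im z = 1")
      case True
      then show ?thesis
        using stadium_on_axis(2)[of 1 "{1..}" "Re z" ?c] sph[of "Re z" 1] by (cases z) simp
    next
      case False
      then show ?thesis
        using that up by (intro frontier_local[of "{z. Im z < 1}"]) (auto simp: open_halfspace_Im_lt)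
    qed
    have fdown: "z \<in> frontier (stadium {..-1} ?c) \<longleftrightarrow> z \<in> frontier (cball (Complex ?c (-1)) (1/2))" if "Im z \<ge> -1" for z
    proof (cases "Im z = -1")
      case True
      then show ?thesis
        using stadium_on_axis(2)[of "-1" "{..-1}" "Re z" ?c] sph[of "Re z" "-1"] by (cases z) simp
    next
      case False
      then show ?thesis
        using that down by (intro frontier_local[of "{z. Im z > -1}"]) (auto simp: open_halfspace_Im_gt)
    qed
    show "list_all2 (\<lambda>R R'. drawing_body ?A [] \<inter> R = drawing_body ?A [] \<inter> R' \<and>
        drawing_body ?A [] \<inter> frontier R = drawing_body ?A [] \<inter> frontier R')
      (strands (reals 1 (m - 2)) @ [cball (Complex ?c 1) (1/2), cball (Complex ?c (-1)) (1/2)])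
      (strands (reals 1 (m - 2)) @ [stadium {1..} ?c, stadium {..-1} ?c])"
    proof (rule list_all2_appendI)
      show "list_all2 (\<lambda>R R'. drawing_body ?A [] \<inter> R = drawing_body ?A [] \<inter> R' \<and>
        drawing_body ?A [] \<inter> frontier R = drawing_body ?A [] \<inter> frontier R')
        [cball (Complex ?c 1) (1/2), cball (Complex ?c (-1)) (1/2)] [stadium {1..} ?c, stadium {..-1} ?c]"
      proof -
        have b: "Im z \<le> 1 \<and> -1 \<le> Im z" if "z \<in> drawing_body ?A []" for z
          using body[OF that] by linarith
        have "drawing_body ?A [] \<inter> cball (Complex ?c 1) (1/2) = drawing_body ?A [] \<inter> stadium {1..} ?c"
          using b up by blast
        moreover have "drawing_body ?A [] \<inter> cball (Complex ?c (-1)) (1/2) = drawing_body ?A [] \<inter> stadium {..-1} ?c"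
          using b down by blast
        moreover have "drawing_body ?A [] \<inter> frontier (cball (Complex ?c 1) (1/2)) = drawing_body ?A [] \<inter> frontier (stadium {1..} ?c)"
          using b fup by blast
        moreover have "drawing_body ?A [] \<inter> frontier (cball (Complex ?c (-1)) (1/2)) = drawing_body ?A [] \<inter> frontier (stadium {..-1} ?c)"
          using b fdown by blast
        ultimately show ?thesis by (simp only: list_all2_Cons list_all2_Nil)
      qed
    qed (simp add: list.rel_refl)
  qed
  also have "\<dots> = draw ?A [] (jones_regions m m)"
    by (simp add: jones_regions_def strands_def)
  finally show ?thesis .
qed

context planar_algebra
begin

text \<open>The boxes of \<open>jones_tangle\<close> and \<open>stack_top\<close> differ only in the
  right side, \<open>m + 1\<close> against \<open>m + 1/2\<close>. The grid map that doubles
  distances to the right of the last strand corrects this and fixes all curves; afterwards the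
  further strands, which miss the box, are added.\<close>

lemma jones_eq_stack_top:
  assumes "2 \<le> m" "m \<le> N"
  shows "E m = Z (draw (stack_top m) [] (jones_regions m N)) []"
proof -
  let ?A = "(Complex 0 (-1), Complex (real m + 1) 1)" and ?c = "real m - 1/2"
  let ?f = "\<lambda>x. if x \<le> real m then 1 * x + 0 else 2 * x + (- real m)" and ?g = "\<lambda>y::real. 1 * y + 0"
  have f: "increasing_homeo ?f" by (intro increasing_homeo_glue increasing_homeo_affine) auto
  have g: "increasing_homeo ?g" by (rule increasing_homeo_affine) simp
  have fix_left: "grid_map ?f ?g z = z" if "Re z \<le> real m" for z
    using that by (simp add: complex_eq_iff)
  have "grid_map ?f ?g ` stadium I ?c = stadium I ?c" for I
  proof -
    have "Re z \<le> real m" if "z \<in> stadium I ?c" for z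
      using stadium_bounds(1)[OF that] by linarith
    then show ?thesis using fix_left by (simp add: image_cong)
  qed
  moreover have "map ((`) (grid_map ?f ?g)) (strands (reals 1 (m - 2))) = strands (reals 1 (m - 2))"
    unfolding strands_grid[OF f g] using assms(1) by (intro arg_cong[of _ _ strands] map_idI) auto
  ultimately have im: "map ((`) (grid_map ?f ?g)) (jones_regions m m) = jones_regions m m"
    by (simp add: jones_regions_def strands_def)
  have "grid_rect ?f ?g (stack_top m) = ?A"
    by (simp add: stack_top_def complex_eq_iff)
  moreover have "Z (draw (grid_rect ?f ?g (stack_top m)) (map (grid_rect ?f ?g) []) (map ((`) (grid_map ?f ?g)) (jones_regions m m))) [] =
      Z (draw (stack_top m) [] (jones_regions m m)) []"
    by (rule Z_diagram_grid[OF jones_diagrams(4)[OF assms(1) order_refl] _ f g]) simp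
  ultimately have "E m = Z (draw (stack_top m) [] (jones_regions m m)) []"
    unfolding E_def jones_tangle_eq[OF assms(1)] im by simp
  also have "draw (stack_top m) [] (jones_regions m m) = draw (stack_top m) [] (jones_regions m N)"
  proof -
    let ?Rs = "strands (reals 1 (m - 2)) @ [stadium {1..} ?c, stadium {..-1} ?c]"
    have L: "layout (stack_top m) []" using jones_diagrams(4)[OF assms] by (simp add: diagram_def)
    have "draw (stack_top m) [] (?Rs @ strands (reals (Suc m) N) @ []) = draw (stack_top m) [] (?Rs @ [])"
    proof (rule draw_remove[OF L], intro ballI conjI)
      fix R assume "R \<in> set (strands (reals (Suc m) N))"
      then obtain j where j: "Suc m \<le> j" "R = half_plane (real j)" unfolding set_strands by auto
      show "closed R" unfolding j by (rule closed_convex_half_plane)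
      show "R \<inter> drawing_body (stack_top m) [] = {}"
        using j by (auto simp: drawing_body_def in_cbox_complex_iff stack_top_def)
    qed
    then show ?thesis by (simp add: jones_regions_def strands_def)
  qed
  finally show ?thesis .
qed

text \<open>Substituting the curves of \<open>E m\<close> removes the upper box. The result can then
  be cut between its two arcs, so it factors through a box of colour \<open>N - 1\<close>; this is
  what brings the induction down by one colour.\<close>

lemma stack_jones:
  assumes "2 \<le> m" "m \<le> N" "x \<in> P (Col N)"
  shows "stack m N (E m) x = Z (draw (stack_frame N) [stack_cut N] (jones_regions m N))
      [Z (draw (stack_cut N) [stack_bottom N] (jones_regions m N)) [x]]"
proof -
  note d = jones_diagrams[OF assms(1,2)]
  show ?thesis
    unfolding stack_def stack_jones_regions[OF assms(1,2)] jones_eq_stack_top[OF assms(1,2)]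
    using Z_substitute_first[OF d(3,4), of "[]" "[x]"] Z_substitute_first[OF d(1,2), of "[x]" "[]"] assms(3)
    by simp
qed

end

section \<open>Dual vectors\<close>

context vector_space
begin

lemma linear_form_sum:
  assumes V: "subspace V" and add: "\<And>u v. u \<in> V \<Longrightarrow> v \<in> V \<Longrightarrow> h (u + v) = h u + h v"
    and scl: "\<And>a v. v \<in> V \<Longrightarrow> h (scale a v) = a * h v"
    and "finite I" "\<And>i. i \<in> I \<Longrightarrow> g i \<in> V"
  shows "h (\<Sum>i\<in>I. scale (c i) (g i)) = (\<Sum>i\<in>I. c i * h (g i))"
  using assms(4,5)
proof (induction I rule: finite_induct)
  case empty
  show ?case using scl[of 0 0] subspace_0[OF V] by simp
next
  case (insert i I)
  have "(\<Sum>i\<in>I. scale (c i) (g i)) \<in> V"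
    using V insert.prems by (intro subspace_sum subspace_scale) auto
  moreover have "scale (c i) (g i) \<in> V" using V insert.prems by (intro subspace_scale) auto
  ultimately show ?case using insert add scl by simp
qed

text \<open>Induction on the number of dual vectors. If every \<open>v\<close> annihilated by the
  first \<open>n\<close> basis vectors were annihilated by \<open>bs ! n\<close> too, then
  \<open>bs ! n\<close> would differ from a combination of them by an element of the kernel of the
  form, against nondegeneracy and independence.\<close>

lemma dual_vectors:
  assumes V: "subspace V"
    and add1: "\<And>u u' v. u \<in> V \<Longrightarrow> u' \<in> V \<Longrightarrow> v \<in> V \<Longrightarrow> \<beta> (u + u') v = \<beta> u v + \<beta> u' v"
    and scl1: "\<And>a u v. u \<in> V \<Longrightarrow> v \<in> V \<Longrightarrow> \<beta> (scale a u) v = a * \<beta> u v"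
    and add2: "\<And>u v v'. u \<in> V \<Longrightarrow> v \<in> V \<Longrightarrow> v' \<in> V \<Longrightarrow> \<beta> u (v + v') = \<beta> u v + \<beta> u v'"
    and scl2: "\<And>a u v. u \<in> V \<Longrightarrow> v \<in> V \<Longrightarrow> \<beta> u (scale a v) = a * \<beta> u v"
    and nondeg: "\<And>u. u \<in> V \<Longrightarrow> (\<And>v. v \<in> V \<Longrightarrow> \<beta> u v = 0) \<Longrightarrow> u = 0"
    and b: "set bs \<subseteq> V" "independent (set bs)" "distinct bs"
    and n: "n \<le> length bs"
  shows "\<exists>f. \<forall>i<n. f i \<in> V \<and> (\<forall>j<n. \<beta> (bs ! j) (f i) = (if i = j then 1 else 0))"
  using n
proof (induction n)
  case (Suc n)
  then obtain f where f: "\<And>i. i < n \<Longrightarrow> f i \<in> V"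
    "\<And>i j. i < n \<Longrightarrow> j < n \<Longrightarrow> \<beta> (bs ! j) (f i) = (if i = j then 1 else 0)"
    by (metis Suc_leD)
  have bV: "bs ! i \<in> V" if "i \<le> n" for i using b(1) Suc.prems that by auto
  have sum2: "\<beta> u (\<Sum>j<n. scale (c j) (g j)) = (\<Sum>j<n. c j * \<beta> u (g j))"
    if "u \<in> V" "\<And>j. j < n \<Longrightarrow> g j \<in> V" for u c g
    by (rule linear_form_sum[OF V]) (use add2 scl2 that in auto)
  have sum1: "\<beta> (\<Sum>j<n. scale (c j) (g j)) v = (\<Sum>j<n. c j * \<beta> (g j) v)"
    if "v \<in> V" "\<And>j. j < n \<Longrightarrow> g j \<in> V" for v c g
    by (rule linear_form_sum[OF V, where h="\<lambda>u. \<beta> u v"]) (use add1 scl1 that in auto)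
  have "\<exists>v\<in>V. (\<forall>i<n. \<beta> (bs ! i) v = 0) \<and> \<beta> (bs ! n) v \<noteq> 0"
  proof (rule ccontr)
    assume no: "\<not> ?thesis"
    \<comment> \<open>\<open>bs ! n\<close> minus the combination of earlier vectors having the same
      pairings with the \<open>f j\<close>.\<close>
    define u where "u = bs ! n + (\<Sum>j<n. scale (- \<beta> (bs ! n) (f j)) (bs ! j))"
    have sV: "(\<Sum>j<n. scale (c j) (bs ! j)) \<in> V" for c
      using V bV by (intro subspace_sum subspace_scale) auto
    have uV: "u \<in> V" unfolding u_def by (intro subspace_add[OF V] bV sV) simp
    have "\<beta> u v = 0" if v: "v \<in> V" for v
    proof -
      \<comment> \<open>\<open>v\<close> corrected so that the first \<open>n\<close> basis vectors
        vanish on it. By assumption \<open>bs ! n\<close> vanishes on it as well, and written out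
        this says that \<open>\<beta> u v = 0\<close>.\<close>
      define v' where "v' = v + (\<Sum>j<n. scale (- \<beta> (bs ! j) v) (f j))"
      have fV: "(\<Sum>j<n. scale (- \<beta> (bs ! j) v) (f j)) \<in> V"
        using V f(1) by (intro subspace_sum subspace_scale) auto
      have v'V: "v' \<in> V" unfolding v'_def by (intro subspace_add[OF V] v fV)
      have e: "\<beta> (bs ! i) v' = \<beta> (bs ! i) v + (\<Sum>j<n. - \<beta> (bs ! j) v * \<beta> (bs ! i) (f j))" if "i \<le> n" for i
        unfolding v'_def add2[OF bV[OF that] v fV] by (subst sum2) (use bV[OF that] f(1) in auto)
      have "\<beta> (bs ! i) v' = 0" if i: "i < n" for i
      proof -
        have "(\<Sum>j<n. - \<beta> (bs ! j) v * \<beta> (bs ! i) (f j)) = (\<Sum>j<n. if j = i then - \<beta> (bs ! i) v else 0)"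
          using f(2) i by (intro sum.cong) auto
        then show ?thesis using e[of i] i by simp
      qed
      then have "\<beta> (bs ! n) v' = 0" using no v'V by blast
      moreover have "\<beta> u v = \<beta> (bs ! n) v + (\<Sum>j<n. - \<beta> (bs ! n) (f j) * \<beta> (bs ! j) v)"
        unfolding u_def add1[OF bV[OF order_refl] sV v] by (subst sum1) (use v bV in auto)
      ultimately show ?thesis using e[of n] by (simp add: mult.commute)
    qed
    then have "u = 0" using nondeg uV by blast
    then have "bs ! n = - (\<Sum>j<n. scale (- \<beta> (bs ! n) (f j)) (bs ! j))"
      unfolding u_def by (simp add: eq_neg_iff_add_eq_0)
    moreover have "bs ! j \<in> set bs - {bs ! n}" if "j < n" for j
      using that Suc.prems b(3) by (auto simp: nth_eq_iff_index_eq)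
    then have "(\<Sum>j<n. scale (- \<beta> (bs ! n) (f j)) (bs ! j)) \<in> span (set bs - {bs ! n})"
      by (intro span_sum span_scale span_base) auto
    ultimately have "bs ! n \<in> span (set bs - {bs ! n})" by (metis span_neg)
    moreover have "bs ! n \<in> set bs" using Suc.prems by simp
    ultimately show False using b(2) dependent_def by blast
  qed
  then obtain v where v: "v \<in> V" "\<And>i. i < n \<Longrightarrow> \<beta> (bs ! i) v = 0" "\<beta> (bs ! n) v \<noteq> 0" by blast
  define g where "g = scale (inverse (\<beta> (bs ! n) v)) v"
  have g: "g \<in> V" "\<And>i. i < n \<Longrightarrow> \<beta> (bs ! i) g = 0" "\<beta> (bs ! n) g = 1"
    using v V bV scl2 by (auto simp: g_def subspace_scale)
  \<comment> \<open>Subtracting multiples of \<open>g\<close> makes the old dual vectors pair to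
    zero with \<open>bs ! n\<close>, while their pairings with the earlier basis vectors stay the
    same, because \<open>g\<close> pairs to zero with those.\<close>
  define f' where "f' = (\<lambda>i. if i = n then g else f i - scale (\<beta> (bs ! n) (f i)) g)"
  have "f' i \<in> V" if "i < Suc n" for i
    using that f(1) g(1) V by (auto simp: f'_def less_Suc_eq intro!: subspace_diff subspace_scale)
  moreover have "\<beta> (bs ! j) (f' i) = (if i = j then 1 else 0)" if ij: "i < Suc n" "j < Suc n" for i j
  proof (cases "i = n")
    case True
    then show ?thesis using g(2,3) ij by (auto simp: f'_def less_Suc_eq)
  next
    case False
    then have i: "i < n" using ij by simp
    have "\<beta> (bs ! j) (f' i) = \<beta> (bs ! j) (f i) - \<beta> (bs ! n) (f i) * \<beta> (bs ! j) g"
    proof -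
      have "f' i = f i + scale (- \<beta> (bs ! n) (f i)) g" using False by (simp add: f'_def)
      moreover have "bs ! j \<in> V" using bV ij by simp
      ultimately show ?thesis
        using add2[OF _ f(1)[OF i] subspace_scale[OF V g(1)]] scl2[OF _ g(1)] by (simp del: scale_minus_left)
    qed
    then show ?thesis using f(2)[OF i] g(2,3) ij i by (auto simp: less_Suc_eq)
  qed
  ultimately show ?case by (intro exI[of _ f']) blast
qed simp

end

section \<open>Generation\<close>

text \<open>The only region is the whole plane, which contains the left side of the box, so the
  general criterion for drawings does not apply and the conditions are checked directly. This tangle
  puts the unit of colour \<open>Zero_minus\<close> into every planar subalgebra.\<close>

lemma unit_tangle_minus:
  "tangle (unit_tangle Zero_minus)" "ext_colour (unit_tangle Zero_minus) = Zero_minus"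
  "int_boxes (unit_tangle Zero_minus) = []"
proof -
  let ?A = "(Complex 0 (-1), Complex 1 1)"
  have L: "layout ?A []" by (simp add: layout_def proper_def)
  have pr: "proper ?A" by (simp add: proper_def)
  have "unit_tangle Zero_minus = draw ?A [] [UNIV]" by (simp add: unit_tangle_def)
  also have "\<dots> = drawing ?A [] {} UNIV"
    unfolding draw_eq_drawing[OF L] by (simp add: curves_def shaded_def)
  finally have eq: "unit_tangle Zero_minus = drawing ?A [] {} UNIV" .
  have mid: "Complex 0 0 \<in> edges ?A" unfolding in_edges_iff[OF pr] by simp
  have "starred (rectangle_box {} ?A) \<in> components (edges ?A)"
    unfolding starred_rectangle_box using mid by (auto intro: componentsI simp: Complex_eq)
  moreover have "rect ?A homeomorphic cball (0::complex) 1"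
  proof -
    have "Complex (1/2) 0 \<in> box (fst ?A) (snd ?A)" by (simp add: in_box_complex_iff)
    then have "interior (rect ?A) \<noteq> {}" by auto
    then show ?thesis by (intro homeomorphic_convex_compact_cball) auto
  qed
  ultimately show "tangle (unit_tangle Zero_minus)"
    unfolding tangle_def eq by (simp add: boxes_drawing marks_def) (intro exI[of _ "{}"], simp)
  have "edges ?A \<subseteq> drawing_body ?A []" using edges_subset_body[OF L] by simp
  then show "ext_colour (unit_tangle Zero_minus) = Zero_minus"
    unfolding eq box_colour_def by (simp add: marks_def)
  show "int_boxes (unit_tangle Zero_minus) = []" unfolding eq by simp
qed

lemma inclusion_diagram:
  "diagram (Complex (-1) (-2), Complex (real n + 2) 2) [(Complex 0 (-1), Complex (real n + 1/2) 1)]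
     (strands (reals 1 (Suc n))) (Suc n) [n]"
proof -
  let ?A = "(Complex (-1) (-2), Complex (real n + 2) 2)" and ?B = "(Complex 0 (-1), Complex (real n + 1/2) 1)"
  have ne: "real c \<noteq> real n + 1/2" for c
  proof -
    have "real c \<le> real n \<or> real c \<ge> real n + 1" by (cases "c \<le> n") auto
    then show ?thesis by auto
  qed
  have "strand_number (reals 1 (Suc n)) ?A = Suc n" "strand_number (reals 1 (Suc n)) ?B = n"
    by (rule strand_number_reals; simp)+
  moreover have "diagram ?A [?B] (strands (reals 1 (Suc n))) (strand_number (reals 1 (Suc n)) ?A)
      (map (strand_number (reals 1 (Suc n))) [?B])"
    by (rule strand_diagram) (use ne in \<open>auto simp: layout_def nested_def proper_def distinct_map\<close>)
  ultimately show ?thesis by simp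
qed

section \<open>Closure properties of planar subalgebras and the induction step\<close>

context planar_algebra
begin

lemma incl_eq:
  "incl n x = Z (draw (Complex (-1) (-2), Complex (real n + 2) 2) [(Complex 0 (-1), Complex (real n + 1/2) 1)]
     (strands (reals 1 (Suc n)))) [x]"
  by (simp add: incl_def inclusion_tangle_def vertical_strands_eq)

lemma planar_subalgebra_P: "planar_subalgebra P"
  unfolding planar_subalgebra_def using subspace_P Z_closed by blast

lemma subalgebra_unit:
  assumes "planar_subalgebra Q"
  shows "unit c \<in> Q c"
proof (cases c)
  case Zero_minus
  then show ?thesis
    using assms unit_tangle_minus unfolding planar_subalgebra_def unit_def inputs_def
    by (metis (no_types, lifting) list_all2_Nil mem_Collect_eq)
next
  case (Col m)
  have "unit (Col m) = Z (draw (stack_top m) [] (strands (reals 1 m))) []"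
    by (rule unit_eq_strands) (auto simp: stack_top_def proper_def)
  then show ?thesis
    using subalgebra_diagram_closed[OF assms stack_diagrams(4)[of m m]] Col by simp
qed

lemma subalgebra_incl:
  assumes "planar_subalgebra Q" "x \<in> Q (Col n)"
  shows "incl n x \<in> Q (Col (Suc n))"
  unfolding incl_eq by (rule subalgebra_diagram_closed[OF assms(1) inclusion_diagram]) (simp add: assms(2))

lemma subalgebra_stack:
  assumes "planar_subalgebra Q" "m \<le> N" "y \<in> Q (Col m)" "x \<in> Q (Col N)"
  shows "stack m N y x \<in> Q (Col N)"
  unfolding stack_def by (rule subalgebra_diagram_closed[OF assms(1) stack_diagrams(1)[OF assms(2)]]) (use assms in simp)

lemma E_closed: "2 \<le> m \<Longrightarrow> E m \<in> P (Col m)"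
  unfolding jones_eq_stack_top[of m m, OF _ order_refl] by (rule Z_diagram_closed[OF jones_diagrams(4)]) auto

lemma mult_closed_P:
  assumes "x \<in> P (Col k)" "y \<in> P (Col k)"
  shows "mult (Col k) x y \<in> P (Col k)"
  unfolding mult_eq_contraction[OF assms, of k] by (rule Z_diagram_closed[OF contraction_diagrams(2)]) (use assms in simp)

lemma generation_step:
  assumes Q: "planar_subalgebra Q" and k: "k > 0" "depth_condition k" "k \<le> n"
    and Qk: "Q (Col k) = P (Col k)" and Qn: "Q (Col n) = P (Col n)"
  shows "P (Col (Suc n)) \<subseteq> Q (Col (Suc n))"
proof
  fix x assume x: "x \<in> P (Col (Suc n))"
  let ?m = "Suc k" and ?N = "Suc n"
  let ?S = "{mult (Col ?m) (mult (Col ?m) (incl k a) (E ?m)) (incl k b) | a b. a \<in> P (Col k) \<and> b \<in> P (Col k)}"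
  have m: "2 \<le> ?m" "?m \<le> ?N" using k by auto
  have E: "E ?m \<in> P (Col ?m)" by (rule E_closed[OF m(1)])
  have sub: "subspace (Q c)" for c using Q by (simp add: planar_subalgebra_def)
  note d = stack_diagrams(1)[OF m(2)] and dj = jones_diagrams[OF m]
  have QP: "Q c \<subseteq> P c" for c using Q by (simp add: planar_subalgebra_def)
  have gen: "stack ?m ?N y x \<in> Q (Col ?N)" if y: "y \<in> ?S" for y
  proof -
    obtain a b where ab: "a \<in> P (Col k)" "b \<in> P (Col k)"
      "y = mult (Col ?m) (mult (Col ?m) (incl k a) (E ?m)) (incl k b)" using y by blast
    have i: "incl k a \<in> P (Col ?m)" "incl k b \<in> P (Col ?m)" "incl k a \<in> Q (Col ?m)"
      using ab(1,2) subalgebra_incl[OF planar_subalgebra_P] subalgebra_incl[OF Q] Qk by auto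
    let ?x = "stack ?m ?N (incl k b) x"
    have x': "?x \<in> P (Col ?N)" by (rule stack_closed[OF m(2) i(2) x])
    have "stack ?m ?N y x = stack ?m ?N (incl k a) (stack ?m ?N (E ?m) ?x)"
      unfolding ab(3) using stack_mult[OF m(2) _ _ x] stack_mult[OF m(2) _ _ x'] mult_closed_P i E by simp
    \<comment> \<open>The part below the cut is an \<open>n\<close>-box built from \<open>b\<close>
      and \<open>x\<close>. It lies in \<open>P (Col n)\<close>, which is already contained in
      \<open>Q\<close>, and the part above the cut is a tangle applied to it.\<close>
    moreover have "Z (draw (stack_cut ?N) [stack_bottom ?N] (jones_regions ?m ?N)) [?x] \<in> P (Col n)"
      using Z_diagram_closed[OF dj(2), of "[?x]"] x' by simp
    then have "stack ?m ?N (E ?m) ?x \<in> Q (Col ?N)"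
      unfolding stack_jones[OF m x'] using subalgebra_diagram_closed[OF Q dj(1)] Qn by simp
    ultimately show ?thesis using subalgebra_stack[OF Q m(2) i(3)] by simp
  qed
  have "unit (Col ?m) \<in> span ?S"
    using subalgebra_unit[OF planar_subalgebra_P, of "Col ?m"] k(2) unfolding depth_condition_def by simp
  \<comment> \<open>Membership in \<open>P\<close> is carried through the induction because
    \<open>Z\<close> is linear only on vectors of the right colour.\<close>
  then have "unit (Col ?m) \<in> P (Col ?m) \<and> stack ?m ?N (unit (Col ?m)) x \<in> Q (Col ?N)"
  proof (induction rule: span_induct)
    case base
    let ?T = "{y. y \<in> P (Col ?m) \<and> stack ?m ?N y x \<in> Q (Col ?N)}"
    have "subspace ?T"
    proof (rule subspaceI)
      fix u v assume uv: "u \<in> ?T" "v \<in> ?T"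
      then have "stack ?m ?N (u + v) x = stack ?m ?N u x + stack ?m ?N v x"
        using Z_diagram_add[OF d, of "[]" u "[x]" v] x unfolding stack_def by simp
      then show "u + v \<in> ?T" using uv sub subspace_P by (simp add: subspace_add)
    next
      fix a u assume u: "u \<in> ?T"
      then have "stack ?m ?N (scale a u) x = scale a (stack ?m ?N u x)"
        using Z_diagram_scale[OF d, of "[]" u "[x]" a] x unfolding stack_def by simp
      then show "scale a u \<in> ?T" using u sub subspace_P by (simp add: subspace_scale)
    next
      have 0: "0 \<in> P (Col ?m)" using subspace_P subspace_0 by blast
      then have "stack ?m ?N (scale 0 0) x = scale 0 (stack ?m ?N 0 x)"
        using Z_diagram_scale[OF d, of "[]" 0 "[x]" 0] x unfolding stack_def by simp
      then show "0 \<in> ?T" using 0 sub by (simp add: subspace_0)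
    qed
    then show "subspace (Collect (\<lambda>y. y \<in> P (Col ?m) \<and> stack ?m ?N y x \<in> Q (Col ?N)))" .
  next
    case (step y)
    have "y \<in> P (Col ?m)"
      using span_base[OF step] k(2) unfolding depth_condition_def by (simp only:)
    then show ?case using gen[OF step] by blast
  qed
  then show "x \<in> Q (Col ?N)" using stack_unit[OF m(2) x] by simp
qed

end

section \<open>The trace form, the single generator and the generation of all colours\<close>

context subfactor_planar_algebra
begin

lemma cstar_facts:
  assumes "x \<in> P c" "y \<in> P c" "z \<in> P c"
  shows "mult c (unit c) x = x" "adj c x \<in> P c" "mult c (x + y) z = mult c x z + mult c y z"
    "mult c (scale a x) y = scale a (mult c x y)"
proof -
  obtain N where "cstar_algebra scale (P c) (mult c) (unit c) (adj c) N" using cstar by blast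
  then interpret A: cstar_algebra scale "P c" "mult c" "unit c" "adj c" N .
  show "mult c (unit c) x = x" "adj c x \<in> P c" "mult c (x + y) z = mult c x z + mult c y z"
    "mult c (scale a x) y = scale a (mult c x y)"
    using assms A.unit_left A.adj_closed A.mult_add_left A.mult_scale_left by auto
qed

lemma unit_zero:
  assumes "unit c = 0" "x \<in> P c"
  shows "x = 0"
  using cstar_facts(1)[OF assms(2,2,2)] cstar_facts(4)[OF assms(2,2,2), of 0] assms(1) by simp

text \<open>A vanishing unit would annihilate the whole space, so in dimension one the unit is a
  basis. This identifies closed diagrams with scalars.\<close>

lemma unit_spans:
  assumes "dim (P c) = 1"
  shows "unit c \<noteq> 0" "x \<in> P c \<Longrightarrow> \<exists>s. x = scale s (unit c)"
proof -
  obtain B where B: "B \<subseteq> P c" "independent B" "P c \<subseteq> span B" "card B = dim (P c)"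
    using basis_exists by blast
  then obtain b where b: "B = {b}" using assms by (metis card_1_singletonE)
  have b0: "b \<noteq> 0" using B(2) b by (metis dependent_zero singletonI)
  have bP: "b \<in> P c" using B(1) b by simp
  show u: "unit c \<noteq> 0"
    using unit_zero[OF _ bP] b0 by blast
  have sp: "\<exists>s. y = scale s b" if "y \<in> P c" for y
    using B(3) that unfolding b span_singleton by blast
  then obtain t where t: "unit c = scale t b" using subalgebra_unit[OF planar_subalgebra_P] by blast
  then have "t \<noteq> 0" using u by auto
  then have "b = scale (inverse t) (unit c)" using t by simp
  then show "\<exists>s. x = scale s (unit c)" if "x \<in> P c" using sp[OF that] by (metis scale_scale)
qed

lemma scalar_of_scale: "scalar_of (scale a (unit (Col 0))) = a"
  using unit_spans(1)[OF dim_zero_plus] unfolding scalar_of_def by (auto simp: scale_right_imp_eq)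

text \<open>The unnormalised trace of the product, without the adjoint: this form is bilinear, and
  it is the scalar that \<open>contraction\<close> produces.\<close>

definition trace_form :: "nat \<Rightarrow> 'v \<Rightarrow> 'v \<Rightarrow> complex" where
  "trace_form k u v = scalar_of (Z (trace_tangle k) [mult (Col k) u v])"

lemma trace_form:
  assumes "u \<in> P (Col k)" "v \<in> P (Col k)"
  shows "Z (trace_tangle k) [mult (Col k) u v] = scale (trace_form k u v) (unit (Col 0))"
proof -
  have "Z (trace_tangle k) [mult (Col k) u v] \<in> P (Col 0)"
    unfolding trace_tangle_eq[of k k]
    by (rule Z_diagram_closed[OF contraction_diagrams(1)]) (use mult_closed_P assms in simp)
  then obtain s where s: "Z (trace_tangle k) [mult (Col k) u v] = scale s (unit (Col 0))"
    using unit_spans(2)[OF dim_zero_plus] by blast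
  then show ?thesis unfolding trace_form_def by (simp add: scalar_of_scale)
qed

lemma trace_form_eqI:
  assumes "u \<in> P (Col k)" "v \<in> P (Col k)" "Z (trace_tangle k) [mult (Col k) u v] = scale s (unit (Col 0))"
  shows "trace_form k u v = s"
  using assms(3) by (simp add: trace_form_def scalar_of_scale)

lemma trace_form_linear:
  assumes "u \<in> P (Col k)" "u' \<in> P (Col k)" "v \<in> P (Col k)"
  shows "trace_form k (u + u') v = trace_form k u v + trace_form k u' v"
    "trace_form k (scale a u) v = a * trace_form k u v"
proof -
  note d = contraction_diagrams(1)[of k k]
  have sum: "u + u' \<in> P (Col k)" "scale a u \<in> P (Col k)"
    using assms subspace_P by (auto intro: subspace_add subspace_scale)
  have "Z (trace_tangle k) [mult (Col k) u v + mult (Col k) u' v] =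
      Z (trace_tangle k) [mult (Col k) u v] + Z (trace_tangle k) [mult (Col k) u' v]"
    unfolding trace_tangle_eq[of k k] using Z_diagram_add[OF d, of "[]" _ "[]"] mult_closed_P assms by simp
  then show "trace_form k (u + u') v = trace_form k u v + trace_form k u' v"
    using assms sum by (intro trace_form_eqI) (simp_all add: cstar_facts(3) trace_form scale_left_distrib)
  have "Z (trace_tangle k) [scale a (mult (Col k) u v)] = scale a (Z (trace_tangle k) [mult (Col k) u v])"
    unfolding trace_tangle_eq[of k k] using Z_diagram_scale[OF d, of "[]" _ "[]"] mult_closed_P assms by simp
  then show "trace_form k (scale a u) v = a * trace_form k u v"
    using assms sum by (intro trace_form_eqI) (simp_all add: cstar_facts(4)[where z=v] trace_form)
qed

lemma trace_form_commute:
  assumes "u \<in> P (Col k)" "v \<in> P (Col k)"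
  shows "trace_form k u v = trace_form k v u"
  using trace_commute[OF assms] modulus_pos unfolding tr_def trace_form_def by simp

text \<open>Pairing \<open>u\<close> with its adjoint and using the trace property gives the trace
  of \<open>u*u\<close>, so faithfulness applies.\<close>

lemma trace_form_nondegenerate:
  assumes "u \<in> P (Col k)" "\<And>v. v \<in> P (Col k) \<Longrightarrow> trace_form k u v = 0"
  shows "u = 0"
proof -
  have "adj (Col k) u \<in> P (Col k)" by (rule cstar_facts(2)[OF assms(1,1,1)])
  then have "trace_form k (adj (Col k) u) u = 0" using assms trace_form_commute by metis
  then show ?thesis
    using trace_faithful[OF assms(1)] unfolding tr_def trace_form_def by simp
qed

text \<open>Contraction with \<open>z\<close> is the shift \<open>b\<^sub>i \<mapsto> b\<^sub>i\<^sub>+\<^sub>1\<close> of a basis starting at the unit,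
  so iterating it from the unit reaches the whole basis.\<close>

lemma cyclic_element:
  obtains z where "z \<in> P (Col (2 * k))"
    "\<And>Q. planar_subalgebra Q \<Longrightarrow> z \<in> Q (Col (2 * k)) \<Longrightarrow> P (Col k) \<subseteq> Q (Col k)"
proof (cases "unit (Col k) = 0")
  \<comment> \<open>\<open>P (Col k)\<close> is then zero. In the other case the unit is an
    independent set and can be extended to a basis.\<close>
  case True
  have "0 \<in> Q (Col k)" if "planar_subalgebra Q" for Q
    using that subspace_0 unfolding planar_subalgebra_def by blast
  then show thesis using that[of 0] unit_zero[OF True] subspace_P subspace_0 by blast
next
  case False
  let ?V = "P (Col k)"
  let ?F = "draw (frame_box k k) [upper_box k, pair_box k k] (contraction_regions k k)"
  let ?G = "draw (pair_box k k) [lower_box k, far_box k k] (contraction_regions k k)"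
  note dF = contraction_diagrams(5)[of k k, folded mult_2] and dG = contraction_diagrams(4)[of k k, folded mult_2]
  have u: "unit c \<in> P c" for c by (rule subalgebra_unit[OF planar_subalgebra_P])
  obtain B where B: "{unit (Col k)} \<subseteq> B" "B \<subseteq> ?V" "independent B" "?V \<subseteq> span B"
    using maximal_independent_subset_extend[of "{unit (Col k)}" ?V] u False by auto
  obtain B0 where B0: "finite B0" "span B0 = ?V" using finite_dimensional by blast
  have "finite B" using independent_span_bound[OF B0(1) B(3)] B(2) B0(2) by simp
  then obtain cs where cs: "set cs = B - {unit (Col k)}" "distinct cs"
    using finite_distinct_list[of "B - {unit (Col k)}"] by auto
  define bs where "bs = unit (Col k) # cs"
  have bs: "set bs = B" "distinct bs" "bs ! 0 = unit (Col k)" "bs \<noteq> []" using cs B(1) by (auto simp: bs_def)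
  have bV: "bs ! i \<in> ?V" if "i < length bs" for i using that bs(1) B(2) nth_mem by blast
  have "\<exists>f. \<forall>i<length bs. f i \<in> ?V \<and> (\<forall>j<length bs. trace_form k (bs ! j) (f i) = (if i = j then 1 else 0))"
  proof (rule dual_vectors[OF subspace_P[of "Col k"]])
    show "trace_form k u (v + v') = trace_form k u v + trace_form k u v'"
      if "u \<in> ?V" "v \<in> ?V" "v' \<in> ?V" for u v v'
      using that trace_form_linear(1)[of v k v' u] trace_form_commute subspace_P by (metis subspace_add)
    show "trace_form k u (scale a v) = a * trace_form k u v" if "u \<in> ?V" "v \<in> ?V" for a u v
      using that trace_form_linear(2)[of v k v u a] trace_form_commute subspace_P by (metis subspace_scale)
  qed (use trace_form_linear trace_form_nondegenerate B bs in auto)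
  then obtain f where f: "\<And>i. i < length bs \<Longrightarrow> f i \<in> ?V"
    "\<And>i j. i < length bs \<Longrightarrow> j < length bs \<Longrightarrow> trace_form k (bs ! j) (f i) = (if i = j then 1 else 0)"
    by blast
  \<comment> \<open>The sum stops one term early, since the last basis vector has no
    successor.\<close>
  define z where "z = (\<Sum>i<length bs - 1. Z ?G [f i, bs ! Suc i])"
  have GP: "Z ?G [f i, bs ! Suc i] \<in> P (Col (2 * k))" if "i < length bs - 1" for i
    using that f(1) bV by (intro Z_diagram_closed[OF dG]) auto
  have zP: "z \<in> P (Col (2 * k))" unfolding z_def using GP subspace_P by (intro subspace_sum) auto
  have Fsum: "Z ?F [w, \<Sum>i\<in>I. Z ?G [f i, bs ! Suc i]] = (\<Sum>i\<in>I. scale (trace_form k w (f i)) (bs ! Suc i))"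
    if "w \<in> ?V" "finite I" "I \<subseteq> {..<length bs - 1}" for w I
    using that(2,3)
  proof (induction I rule: finite_induct)
    case empty
    have "Z ?F ([w] @ scale 0 0 # []) = scale 0 (Z ?F ([w] @ 0 # []))"
      by (rule Z_diagram_scale[OF dF]) (use that(1) subspace_P subspace_0 in auto)
    then show ?case by simp
  next
    case (insert i I)
    have i: "i < length bs - 1" "i < length bs" "Suc i < length bs" using insert.prems by auto
    have s: "(\<Sum>i\<in>I. Z ?G [f i, bs ! Suc i]) \<in> P (Col (2 * k))"
      using GP insert.prems subspace_P by (intro subspace_sum) auto
    have "Z ?F ([w] @ (Z ?G [f i, bs ! Suc i] + (\<Sum>i\<in>I. Z ?G [f i, bs ! Suc i])) # []) =
        Z ?F ([w] @ Z ?G [f i, bs ! Suc i] # []) + Z ?F ([w] @ (\<Sum>i\<in>I. Z ?G [f i, bs ! Suc i]) # [])"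
      by (rule Z_diagram_add[OF dF]) (use that(1) GP i(1) s in auto)
    moreover have "Z ?F [w, Z ?G [f i, bs ! Suc i]] = scale (trace_form k w (f i)) (bs ! Suc i)"
      by (rule contraction[OF that(1) f(1)[OF i(2)] bV[OF i(3)] trace_form[OF that(1) f(1)[OF i(2)]] u])
    ultimately show ?case using insert by simp
  qed
  have shift: "Z ?F [bs ! j, z] = bs ! Suc j" if j: "Suc j < length bs" for j
  proof -
    have "Z ?F [bs ! j, z] = (\<Sum>i<length bs - 1. scale (trace_form k (bs ! j) (f i)) (bs ! Suc i))"
      unfolding z_def using j bV by (intro Fsum) auto
    also have "\<dots> = (\<Sum>i<length bs - 1. if i = j then bs ! Suc j else 0)"
      using f(2) j by (intro sum.cong) auto
    also have "\<dots> = bs ! Suc j" using less_diff_conv[of j "length bs" 1] j by simp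
    finally show ?thesis .
  qed
  show thesis
  proof (rule that[OF zP])
    fix Q assume Q: "planar_subalgebra Q" "z \<in> Q (Col (2 * k))"
    have "bs ! j \<in> Q (Col k)" if "j < length bs" for j
      using that
    proof (induction j)
      case 0
      then show ?case using bs(3) subalgebra_unit[OF Q(1)] by simp
    next
      case (Suc j)
      then have "Z ?F [bs ! j, z] \<in> Q (Col k)"
        using Q(2) by (intro subalgebra_diagram_closed[OF Q(1) dF]) auto
      then show ?case using shift Suc.prems by simp
    qed
    then have "B \<subseteq> Q (Col k)" unfolding bs(1)[symmetric] by (auto simp: in_set_conv_nth)
    then show "?V \<subseteq> Q (Col k)"
      using B(4) Q(1) span_minimal unfolding planar_subalgebra_def by blast
  qed
qed

lemma trace_form_unit: "trace_form k (unit (Col k)) (unit (Col k)) \<noteq> 0"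
proof -
  have "unit (Col k) \<in> P (Col k)" by (rule subalgebra_unit[OF planar_subalgebra_P])
  from cstar_facts(1)[OF this this this] show ?thesis
    using trace_normalised[of k] by (auto simp: tr_def trace_form_def)
qed

text \<open>Contracting the unit of \<open>P\<^sub>j\<close> with \<open>1 \<otimes> x \<in> P\<^sub>j\<^sub>+\<^sub>n\<close> gives a nonzero multiple of \<open>x\<close>.\<close>

lemma generation_below:
  assumes Q: "planar_subalgebra Q" and "P (Col (j + n)) \<subseteq> Q (Col (j + n))"
  shows "P (Col n) \<subseteq> Q (Col n)"
proof
  fix x assume x: "x \<in> P (Col n)"
  let ?u = "unit (Col j)" and ?Rs = "contraction_regions j n"
  let ?z = "Z (draw (pair_box j n) [lower_box j, far_box j n] ?Rs) [?u, x]"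
  note d = contraction_diagrams[where k=j and n=n]
  have u: "unit c \<in> P c" for c by (rule subalgebra_unit[OF planar_subalgebra_P])
  have "?z \<in> P (Col (j + n))"
    by (rule Z_diagram_closed[OF d(4)]) (use u x in simp)
  then have "Z (draw (frame_box j n) [upper_box j, pair_box j n] ?Rs) [?u, ?z] \<in> Q (Col n)"
    using assms(2) subalgebra_unit[OF Q] by (intro subalgebra_diagram_closed[OF Q d(5)]) auto
  then have "scale (trace_form j ?u ?u) x \<in> Q (Col n)"
    unfolding contraction[OF u u x trace_form[OF u u] u] .
  then have "scale (inverse (trace_form j ?u ?u)) (scale (trace_form j ?u ?u) x) \<in> Q (Col n)"
    using Q subspace_scale unfolding planar_subalgebra_def by blast
  then show "x \<in> Q (Col n)" using trace_form_unit[of j] by simp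
qed

text \<open>Contraction with units reaches every colour below \<open>k\<close>, among them the
  colour \<open>l\<close> at which the depth condition holds; this provides what
  \<open>generation_step\<close> needs for the induction upwards from \<open>k\<close>. The space of
  colour \<open>Zero_minus\<close> is spanned by its unit.\<close>

lemma generation:
  assumes Q: "planar_subalgebra Q" and k: "P (Col k) \<subseteq> Q (Col k)"
    and l: "0 < l" "l \<le> k" "depth_condition l"
  shows "Q c = P c"
proof -
  have QP: "Q c \<subseteq> P c" for c using Q by (simp add: planar_subalgebra_def)
  have below: "Q (Col n) = P (Col n)" if "n \<le> k" for n
    using generation_below[OF Q, of "k - n" n] k QP that by auto
  have above: "Q (Col n) = P (Col n)" if "k \<le> n" for n
    using that
  proof (induction rule: dec_induct)
    case base
    show ?case using below by simp
  next
    case (step n)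
    then show ?case
      using generation_step[OF Q l(1,3), of n] below[OF l(2)] l(2) QP by (meson order_trans subset_antisym)
  qed
  show ?thesis
  proof (cases c)
    case Zero_minus
    have "x \<in> Q Zero_minus" if "x \<in> P Zero_minus" for x
      using unit_spans(2)[OF dim_zero_minus that] subalgebra_unit[OF Q, of Zero_minus] Q subspace_scale
      unfolding planar_subalgebra_def by metis
    then show ?thesis using QP Zero_minus by blast
  next
    case (Col n)
    then show ?thesis using below above by (meson linear)
  qed
qed

end

theorem proposition7:
  fixes scale :: "complex \<Rightarrow> 'v::ab_group_add \<Rightarrow> 'v"
    and P :: "colour \<Rightarrow> 'v set"
    and Z :: "tangle \<Rightarrow> 'v list \<Rightarrow> 'v"
    and adj :: "colour \<Rightarrow> 'v \<Rightarrow> 'v"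
    and \<delta> :: real
    and k :: nat
  assumes "k > 0"
    and "subfactor_planar_algebra scale P Z adj \<delta>"
    and "planar_algebra.finite_depth scale P Z"
    and "planar_algebra.depth scale P Z \<le> k"
  shows "\<exists>z\<in>P (Col (2 * k)). \<forall>c. planar_algebra.generated scale P Z (Col (2 * k)) z c = P c"
proof -
  interpret subfactor_planar_algebra scale P Z adj \<delta> by (rule assms(2))
  have l: "0 < depth" "depth_condition depth"
    using assms(3) LeastI_ex[of "\<lambda>k. k > 0 \<and> depth_condition k"] unfolding finite_depth_def depth_def by auto
  obtain z where z: "z \<in> P (Col (2 * k))"
    "\<And>Q. planar_subalgebra Q \<Longrightarrow> z \<in> Q (Col (2 * k)) \<Longrightarrow> P (Col k) \<subseteq> Q (Col k)"
    using cyclic_element[of k] by blast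
  have "generated (Col (2 * k)) z c = P c" for c
  proof -
    have "Q c = P c" if "planar_subalgebra Q" "z \<in> Q (Col (2 * k))" for Q
      using generation[OF that(1) z(2)[OF that] l(1) assms(4) l(2)] .
    \<comment> \<open>\<open>P\<close> itself is a member of the family, so the intersection
      defining \<open>generated\<close> is not over an empty set.\<close>
    then have "{Q c | Q. planar_subalgebra Q \<and> z \<in> Q (Col (2 * k))} = {P c}"
      using planar_subalgebra_P z(1) by blast
    then show ?thesis by (simp add: generated_def)
  qed
  then show ?thesis using z(1) by blast
qed

end
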